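(* Let $f_1,\dots,f_h$ ($h\ge 2$) be germs of biholomorphisms of $\mathbb{C}^n$ fixing the origin, each formally linearizable, with simultaneously diagonalizable linear parts, and satisfying the simultaneous Brjuno condition. Then $f_1,\dots,f_h$ are simultaneously holomorphically linearizable (there is a germ of biholomorphism $\varphi$ with $\varphi(0)=0$ and $\varphi^{-1}\circ f_k\circ\varphi$ linear for all $k$) if and only if $f_p\circ f_q=f_q\circ f_p$ for all $p,q\in\{1,\dots,h\}$.
   Context: Formally linearizable: there is an invertible formal power series map $\varphi$, $\varphi(0)=0$, with $\varphi^{-1}\circ f\circ\varphi$ linear. Let $\Lambda_k=(\lambda_{k,1},\dots,\lambda_{k,n})$ be the eigenvalues of the linear part of $f_k$ listed along a common eigenbasis. For $Q\in\mathbb{N}^n$ write $|Q|=\sum q_i$, $\Lambda_k^Q=\prod_i\lambda_{k,i}^{q_i}$, and $\mathrm{Res}_j(\Lambda_k)=\{Q:|Q|\ge2,\ \Lambda_k^Q=\lambda_{k,j}\}$. Set $\varepsilon_Q=\min_{1\le j\le n}\max_{1\le k\le h}|\Lambda_k^Q-\lambda_{k,j}|$ and, for $m\ge2$, $\omega(m)=\min\{\varepsilon_Q: 2\le|Q|\le m,\ Q\notin\bigcap_{k=1}^h\bigcap_{j=1}^n\mathrm{Res}_j(\Lambda_k)\}$ (convention $\log(1/0)=+\infty$). The simultaneous Brjuno condition holds if there is a strictly increasing sequence of integers $(p_\nu)_{\nu\ge0}$ with $p_0=1$ such that $\sum_{\nu\ge0}\frac1{p_\nu}\log\frac1{\omega(p_{\nu+1})}<+\infty$.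 *)

theory Defs
  imports "HOL-Analysis.Analysis"
begin

definition holo_on :: "(complex^'n \<Rightarrow> complex^'n) \<Rightarrow> (complex^'n) set \<Rightarrow> bool" where
  "holo_on f U \<longleftrightarrow> (\<forall>z\<in>U. \<exists>L. (f has_derivative L) (at z) \<and>
       (\<forall>(c::complex) v. L (c *s v) = c *s L v))"

definition biholo_germ0_inv ::
  "(complex^'n \<Rightarrow> complex^'n) \<Rightarrow> (complex^'n \<Rightarrow> complex^'n) \<Rightarrow> bool" where
  "biholo_germ0_inv f g \<longleftrightarrow> f 0 = 0 \<and>
     (\<exists>U V. open U \<and> open V \<and> 0 \<in> U \<and> f ` U = V \<and> holo_on f U \<and> holo_on g V \<and>
            (\<forall>z\<in>U. g (f z) = z))"

definition biholo_germ0 :: "(complex^'n \<Rightarrow> complex^'n) \<Rightarrow> bool" where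
  "biholo_germ0 f \<longleftrightarrow> (\<exists>g. biholo_germ0_inv f g)"

text \<open>Multi-indices Q : 'n \<Rightarrow> nat; a formal power series is its coefficient function;
  a formal map C^n \<rightarrow> C^n is a family of n formal power series (one per component).\<close>

type_synonym 'n mps = "('n \<Rightarrow> nat) \<Rightarrow> complex"
type_synonym 'n fmap = "'n \<Rightarrow> 'n mps"

definition mi_deg :: "('n::finite \<Rightarrow> nat) \<Rightarrow> nat" where
  "mi_deg Q = (\<Sum>i\<in>UNIV. Q i)"

definition mi_unit :: "'n \<Rightarrow> ('n \<Rightarrow> nat)" where
  "mi_unit i = (\<lambda>j. if j = i then 1 else 0)"

definition mps_one :: "'n mps" where
  "mps_one = (\<lambda>Q. if Q = (\<lambda>_. 0) then 1 else 0)"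

definition mps_mult :: "'n::finite mps \<Rightarrow> 'n mps \<Rightarrow> 'n mps" where
  "mps_mult a b = (\<lambda>Q. \<Sum>P\<in>{P. \<forall>i. P i \<le> Q i}. a P * b (\<lambda>i. Q i - P i))"

definition mps_prod_list :: "'n::finite mps list \<Rightarrow> 'n mps" where
  "mps_prod_list xs = foldr mps_mult xs mps_one"

definition enum_idx :: "'n::finite list" where
  "enum_idx = (SOME xs. distinct xs \<and> set xs = UNIV)"

definition fmap_monpow :: "'n::finite fmap \<Rightarrow> ('n \<Rightarrow> nat) \<Rightarrow> 'n mps" where
  "fmap_monpow \<phi> P = mps_prod_list (concat (map (\<lambda>i. replicate (P i) (\<phi> i)) enum_idx))"

text \<open>Substitution a(phi) of a formal map phi with phi(0)=0 into a series a.
  Since phi^P has order at least |P|, only |P| \<le> |Q| contributes to the coefficient of z^Q.\<close>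
definition mps_comp :: "'n::finite mps \<Rightarrow> 'n fmap \<Rightarrow> 'n mps" where
  "mps_comp a \<phi> = (\<lambda>Q. \<Sum>P\<in>{P. mi_deg P \<le> mi_deg Q}. a P * fmap_monpow \<phi> P Q)"

definition fmap_comp :: "'n::finite fmap \<Rightarrow> 'n fmap \<Rightarrow> 'n fmap" where
  "fmap_comp g \<phi> = (\<lambda>i. mps_comp (g i) \<phi>)"

definition fmap_id :: "'n fmap" where
  "fmap_id = (\<lambda>i Q. if Q = mi_unit i then 1 else 0)"

definition fmap_lin :: "complex^'n^'n \<Rightarrow> 'n::finite fmap" where
  "fmap_lin B = (\<lambda>i Q. \<Sum>j\<in>UNIV. B $ i $ j * (if Q = mi_unit j then 1 else 0))"

definition fmap_fixes0 :: "'n fmap \<Rightarrow> bool" where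
  "fmap_fixes0 \<phi> \<longleftrightarrow> (\<forall>i. \<phi> i (\<lambda>_. 0) = 0)"

definition has_power_series_at0 :: "(complex^'n \<Rightarrow> complex^'n) \<Rightarrow> 'n::finite fmap \<Rightarrow> bool" where
  "has_power_series_at0 f a \<longleftrightarrow> (\<exists>r>0. \<forall>z. (\<forall>j. norm (z $ j) < r) \<longrightarrow>
      (\<forall>i. ((\<lambda>Q. a i Q * (\<Prod>j\<in>UNIV. (z $ j) ^ Q j)) has_sum (f z $ i)) UNIV))"

definition formally_linearizable :: "'n::finite fmap \<Rightarrow> bool" where
  "formally_linearizable a \<longleftrightarrow> (\<exists>\<phi> \<psi> B. fmap_fixes0 \<phi> \<and> fmap_fixes0 \<psi> \<and>
       fmap_comp \<psi> \<phi> = fmap_id \<and> fmap_comp \<phi> \<psi> = fmap_id \<and>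
       fmap_comp \<psi> (fmap_comp a \<phi>) = fmap_lin B)"

definition sim_holo_linearizable :: "(nat \<Rightarrow> complex^'n \<Rightarrow> complex^'n) \<Rightarrow> nat \<Rightarrow> bool" where
  "sim_holo_linearizable f h \<longleftrightarrow> (\<exists>\<phi> \<psi>. biholo_germ0_inv \<phi> \<psi> \<and>
      (\<forall>k<h. \<exists>B::complex^'n^'n. eventually (\<lambda>z. \<psi> (f k (\<phi> z)) = B *v z) (nhds 0)))"

text \<open>lam k j = lambda_{k,j}, for k < h (the paper's k = 1..h shifted to 0..h-1).\<close>

definition lam_pow :: "(nat \<Rightarrow> 'n::finite \<Rightarrow> complex) \<Rightarrow> nat \<Rightarrow> ('n \<Rightarrow> nat) \<Rightarrow> complex" where
  "lam_pow lam k Q = (\<Prod>i\<in>UNIV. lam k i ^ Q i)"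

definition res_set :: "(nat \<Rightarrow> 'n::finite \<Rightarrow> complex) \<Rightarrow> nat \<Rightarrow> 'n \<Rightarrow> ('n \<Rightarrow> nat) set" where
  "res_set lam k j = {Q. 2 \<le> mi_deg Q \<and> lam_pow lam k Q = lam k j}"

definition eps_Q :: "(nat \<Rightarrow> 'n::finite \<Rightarrow> complex) \<Rightarrow> nat \<Rightarrow> ('n \<Rightarrow> nat) \<Rightarrow> real" where
  "eps_Q lam h Q = Min ((\<lambda>j. Max ((\<lambda>k. cmod (lam_pow lam k Q - lam k j)) ` {..<h})) ` UNIV)"

text \<open>omega(m) as an extended real; the minimum of the empty set is +infinity.\<close>
definition omega_B :: "(nat \<Rightarrow> 'n::finite \<Rightarrow> complex) \<Rightarrow> nat \<Rightarrow> nat \<Rightarrow> ereal" where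
  "omega_B lam h m = Inf ((\<lambda>Q. ereal (eps_Q lam h Q)) `
      {Q. 2 \<le> mi_deg Q \<and> mi_deg Q \<le> m \<and> Q \<notin> (\<Inter>k\<in>{..<h}. \<Inter>j. res_set lam k j)})"

definition log_inv :: "ereal \<Rightarrow> ereal" where
  "log_inv x = (if x = 0 then \<infinity> else if x = \<infinity> then - \<infinity> else ereal (ln (1 / real_of_ereal x)))"

text \<open>The series sum_nu (1/p_nu) log(1/omega(p_{nu+1})) is < +\<infinity>: its partial sums are
  bounded above (a single +\<infinity> term makes it infinite).\<close>
definition sim_brjuno :: "(nat \<Rightarrow> 'n::finite \<Rightarrow> complex) \<Rightarrow> nat \<Rightarrow> bool" where
  "sim_brjuno lam h \<longleftrightarrow> (\<exists>p::nat \<Rightarrow> nat. strict_mono p \<and> p 0 = 1 \<and>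
      (\<exists>C::real. \<forall>N. (\<Sum>\<nu><N. ereal (1 / real (p \<nu>)) * log_inv (omega_B lam h (p (Suc \<nu>))))
                        \<le> ereal C))"

end

theory Submission
  imports Defs "HOL-Complex_Analysis.Complex_Analysis"
begin

text \<open>
  If the germs are simultaneously linearizable, commutativity follows from that of the
  diagonalizable linear parts. For the converse, the resonances excluded from \<open>\<omega>\<close> are those
  occurring in all components at once, so the Brjuno condition leaves only two cases.

  If there is such a resonance \<open>Q\<close>, every linear part is a scalar \<open>c\<^sub>k\<close> with
  \<open>c\<^sub>k ^ (|Q| - 1) = 1\<close>. A formally linearizable germ of this kind has finite order, and
  averaging over the finite abelian group generated by the germs gives a linearization.

  Otherwise \<open>\<epsilon>\<^sub>Q > 0\<close> whenever \<open>|Q| \<ge> 2\<close>. For each \<open>Q\<close> and each component \<open>j\<close>, solve the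
  conjugacy equation for the germ with the largest divisor. The solution is a sum over finite
  trees, one small divisor per inner node, and Brjuno's counting argument together with the
  Brjuno condition bounds the product of the divisors of a tree exponentially in the number of
  its leaves; hence the series converges. Commutativity of the germs then forces the conjugacy
  equations of the remaining germs, degree by degree.
\<close>

text \<open>The germ that defines a coefficient changes with \<open>Q\<close> and \<open>j\<close>,
  so the transformation \<open>Phi\<close> solves no single conjugacy equation, and what
  commutativity yields can only be formulated for germs once \<open>Phi\<close> converges. Hence
  convergence is derived from divisor estimates alone; afterwards the Taylor coefficients of the
  defects \<open>H k\<close> are killed by induction on the degree, working with actual germs modulo
  O(|z|^(m+1)).

  Trees replace a recursion on Taylor coefficients because the size of one tree coefficient is
  controlled by a single product of divisors. The number of trees with m leaves grows only
  exponentially, so it suffices to bound each product separately.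

  Two nested exponents can be compared only if their divisors are small in the same component. Bad
  nodes are therefore counted for each component separately, at the price of a factor n.

  In the resonant case the formal conjugacies may diverge. Only their truncations enter: each shows
  that f^d is the identity up to some order, and a holomorphic map that is flat to every order is
  zero.\<close>

no_notation fps_nth (infixl "$" 75)

section \<open>Asymptotics and germs\<close>

text \<open>This is O(|z|^m) at the origin. The filter is \<open>nhds 0\<close> and not
  \<open>at 0\<close>: for m > 0 the estimate includes g(0) = 0, so it survives the substitution of
  maps that take the value 0 away from the origin.\<close>

definition vanishes :: "nat \<Rightarrow> ('a::real_normed_vector \<Rightarrow> 'b::real_normed_vector) \<Rightarrow> bool" where
  "vanishes m g \<longleftrightarrow> (\<exists>C. \<forall>\<^sub>F z in nhds 0. norm (g z) \<le> C * norm z ^ m)"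

lemma vanishesI: "(\<forall>\<^sub>F z in nhds 0. norm (g z) \<le> C * norm z ^ m) \<Longrightarrow> vanishes m g"
  by (auto simp: vanishes_def)

lemma vanishesE:
  assumes "vanishes m g"
  obtains C where "C > 0" "\<forall>\<^sub>F z in nhds 0. norm (g z) \<le> C * norm z ^ m"
proof -
  from assms obtain C where C: "\<forall>\<^sub>F z in nhds 0. norm (g z) \<le> C * norm z ^ m"
    by (auto simp: vanishes_def)
  have "\<forall>\<^sub>F z in nhds 0. norm (g z) \<le> (\<bar>C\<bar> + 1) * norm z ^ m"
    using C by eventually_elim (erule order_trans, intro mult_right_mono, auto)
  then show thesis by (rule that[rotated]) simp
qed

lemma vanishes_cong:
  assumes "\<forall>\<^sub>F z in nhds 0. f z = g z" "vanishes m f"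
  shows "vanishes m g"
proof -
  from assms(2) obtain C where "\<forall>\<^sub>F z in nhds 0. norm (f z) \<le> C * norm z ^ m" by (auto elim: vanishesE)
  with assms(1) have "\<forall>\<^sub>F z in nhds 0. norm (g z) \<le> C * norm z ^ m" by eventually_elim auto
  then show ?thesis by (rule vanishesI)
qed

lemma vanishes_zero [simp]: "vanishes m (\<lambda>z. 0)"
  by (rule vanishesI[where C = 0]) auto

lemma vanishes_add:
  assumes "vanishes m f" "vanishes m g"
  shows "vanishes m (\<lambda>z. f z + g z)"
proof -
  obtain C D where C: "\<forall>\<^sub>F z in nhds 0. norm (f z) \<le> C * norm z ^ m"
    and D: "\<forall>\<^sub>F z in nhds 0. norm (g z) \<le> D * norm z ^ m"
    using assms by (auto elim!: vanishesE)
  have "\<forall>\<^sub>F z in nhds 0. norm (f z + g z) \<le> (C + D) * norm z ^ m"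
    using C D by eventually_elim (simp add: algebra_simps, smt (verit) norm_triangle_ineq)
  then show ?thesis by (rule vanishesI)
qed

lemma vanishes_bounded_linear:
  assumes "bounded_linear L" "vanishes m f"
  shows "vanishes m (\<lambda>z. L (f z))"
proof -
  interpret L: bounded_linear L by fact
  from L.nonneg_bounded obtain K where K: "K \<ge> 0" "\<And>x. norm (L x) \<le> norm x * K" by auto
  obtain C where C: "\<forall>\<^sub>F z in nhds 0. norm (f z) \<le> C * norm z ^ m"
    using assms by (auto elim!: vanishesE)
  have "\<forall>\<^sub>F z in nhds 0. norm (L (f z)) \<le> (C * K) * norm z ^ m"
    using C
  proof eventually_elim
    case (elim z)
    have "norm (L (f z)) \<le> norm (f z) * K" by (rule K)
    also have "\<dots> \<le> (C * norm z ^ m) * K" by (intro mult_right_mono elim K)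
    finally show ?case by (simp add: algebra_simps)
  qed
  then show ?thesis by (rule vanishesI)
qed

lemma vanishes_minus: "vanishes m f \<Longrightarrow> vanishes m (\<lambda>z. - f z)"
  by (simp add: vanishes_def)

lemma vanishes_diff: "vanishes m f \<Longrightarrow> vanishes m g \<Longrightarrow> vanishes m (\<lambda>z. f z - g z)"
  using vanishes_add[of m f "\<lambda>z. - g z"] by (simp add: vanishes_minus)

lemma vanishes_sum: "(\<And>i. i \<in> I \<Longrightarrow> vanishes m (f i)) \<Longrightarrow> vanishes m (\<lambda>z. \<Sum>i\<in>I. f i z)"
  by (induction I rule: infinite_finite_induct) (auto intro: vanishes_add)

lemma vanishes_mult:
  fixes f g :: "'a::real_normed_vector \<Rightarrow> 'b::real_normed_algebra"
  assumes "vanishes m f" "vanishes n g"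
  shows "vanishes (m + n) (\<lambda>z. f z * g z)"
proof -
  obtain C D where C: "C > 0" "\<forall>\<^sub>F z in nhds 0. norm (f z) \<le> C * norm z ^ m"
    and D: "D > 0" "\<forall>\<^sub>F z in nhds 0. norm (g z) \<le> D * norm z ^ n"
    using assms by (auto elim!: vanishesE)
  have "\<forall>\<^sub>F z in nhds 0. norm (f z * g z) \<le> (C * D) * norm z ^ (m + n)"
    using C(2) D(2)
  proof eventually_elim
    case (elim z)
    have "norm (f z * g z) \<le> norm (f z) * norm (g z)" by (rule norm_mult_ineq)
    also have "\<dots> \<le> (C * norm z ^ m) * (D * norm z ^ n)"
      by (intro mult_mono elim) (use C in auto)
    finally show ?case by (simp add: algebra_simps power_add)
  qed
  then show ?thesis by (rule vanishesI)
qed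

lemma vanishes_mono:
  assumes "vanishes m f" "n \<le> m"
  shows "vanishes n f"
proof -
  obtain C where C: "C > 0" "\<forall>\<^sub>F z in nhds 0. norm (f z) \<le> C * norm z ^ m"
    using assms by (auto elim!: vanishesE)
  have "\<forall>\<^sub>F z in nhds (0::'a). norm z < 1"
    unfolding eventually_nhds_metric by (auto intro!: exI[of _ 1])
  with C(2) have "\<forall>\<^sub>F z in nhds 0. norm (f z) \<le> C * norm z ^ n"
  proof eventually_elim
    case (elim z)
    then have "norm z ^ m \<le> norm z ^ n" using assms(2) by (intro power_decreasing) auto
    then show ?case using elim(1) C(1) by (smt (verit) mult_left_mono)
  qed
  then show ?thesis by (rule vanishesI)
qed

lemma vanishes_tendsto:
  assumes "vanishes m f" "m > 0"
  shows "(f \<longlongrightarrow> 0) (nhds 0)"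
proof -
  obtain C where C: "\<forall>\<^sub>F z in nhds 0. norm (f z) \<le> C * norm z ^ 1"
    using vanishes_mono[of m f 1] assms by (auto elim!: vanishesE)
  have "((\<lambda>z::'a. C * norm z ^ 1) \<longlongrightarrow> C * norm (0::'a) ^ 1) (nhds 0)"
    by (intro tendsto_intros) (auto simp: filterlim_ident)
  then show ?thesis by (intro Lim_null_comparison[OF C]) simp
qed

lemma vanishes_compose:
  assumes f: "vanishes m f" and g: "vanishes 1 g"
  shows "vanishes m (\<lambda>z. f (g z))"
proof -
  obtain C where C: "C > 0" "\<forall>\<^sub>F z in nhds 0. norm (f z) \<le> C * norm z ^ m"
    using f by (auto elim!: vanishesE)
  obtain D where D: "D > 0" "\<forall>\<^sub>F z in nhds 0. norm (g z) \<le> D * norm z ^ 1"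
    using g by (auto elim!: vanishesE)
  have "filterlim g (nhds 0) (nhds 0)" using vanishes_tendsto[OF g] by simp
  from filterlim_iff[THEN iffD1, rule_format, OF this C(2)] D(2)
  have "\<forall>\<^sub>F z in nhds 0. norm (f (g z)) \<le> (C * D ^ m) * norm z ^ m"
  proof eventually_elim
    case (elim z)
    note elim(1)
    also have "C * norm (g z) ^ m \<le> C * (D * norm z) ^ m"
      using elim C by (intro mult_left_mono power_mono) auto
    finally show ?case by (simp add: power_mult_distrib)
  qed
  then show ?thesis by (rule vanishesI)
qed

lemma vanishes_vec:
  fixes f :: "'a::real_normed_vector \<Rightarrow> complex^'n"
  assumes "\<And>i. vanishes m (\<lambda>z. f z $ i)"
  shows "vanishes m f"
proof -
  from assms have "\<forall>i. \<exists>C. \<forall>\<^sub>F z in nhds 0. norm (f z $ i) \<le> C * norm z ^ m"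
    by (auto simp: vanishes_def)
  then obtain C where C: "\<And>i. \<forall>\<^sub>F z in nhds 0. norm (f z $ i) \<le> C i * norm z ^ m" by metis
  then have "\<forall>\<^sub>F z in nhds 0. \<forall>i. norm (f z $ i) \<le> C i * norm z ^ m"
    by (intro eventually_all_finite)
  then have "\<forall>\<^sub>F z in nhds 0. norm (f z) \<le> (\<Sum>i\<in>UNIV. C i) * norm z ^ m"
  proof eventually_elim
    case (elim z)
    have "norm (f z) \<le> (\<Sum>i\<in>UNIV. norm (f z $ i))"
      unfolding norm_vec_def by (rule L2_set_le_sum) auto
    also have "\<dots> \<le> (\<Sum>i\<in>UNIV. C i * norm z ^ m)" by (intro sum_mono) (use elim in auto)
    finally show ?case by (simp add: sum_distrib_right)
  qed
  then show ?thesis by (rule vanishesI)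
qed

lemma vanishes_nth:
  assumes "vanishes m f" shows "vanishes m (\<lambda>z. f z $ i)"
  by (rule vanishes_bounded_linear[OF bounded_linear_vec_nth assms])

section \<open>Holomorphic germs with a strict derivative at the origin\<close>

definition complex_linear :: "(complex^'n \<Rightarrow> complex^'m) \<Rightarrow> bool" where
  "complex_linear L \<longleftrightarrow> bounded_linear L \<and> (\<forall>c v. L (c *s v) = c *s L v)"

lemma complex_linear_matrix: "complex_linear (\<lambda>v. (A::complex^'n^'m) *v v)"
  unfolding complex_linear_def
proof (intro conjI allI)
  show "bounded_linear (\<lambda>v. A *v v)"
    by (intro linear_conv_bounded_linear[THEN iffD1] linearI)
       (auto simp: vec_eq_iff matrix_vector_mult_def scaleR_sum_right algebra_simps sum.distrib)
  show "A *v (c *s v) = c *s (A *v v)" for c v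
    by (auto simp: vec_eq_iff matrix_vector_mult_def sum_distrib_left algebra_simps)
qed

lemma holo_on_iff_complex_linear:
  "holo_on f U \<longleftrightarrow> (\<forall>z\<in>U. \<exists>L. (f has_derivative L) (at z) \<and> complex_linear L)"
  unfolding holo_on_def complex_linear_def using has_derivative_bounded_linear by blast

lemma holo_on_subset: "holo_on f U \<Longrightarrow> V \<subseteq> U \<Longrightarrow> holo_on f V"
  by (auto simp: holo_on_def)

lemma holo_on_continuous: "holo_on f U \<Longrightarrow> z \<in> U \<Longrightarrow> continuous (at z) f"
  unfolding holo_on_def using has_derivative_continuous by blast

lemma holo_on_continuous_on: "holo_on f U \<Longrightarrow> continuous_on U f"
  using holo_on_continuous continuous_at_imp_continuous_on by blast

lemma complex_linear_compose: "complex_linear L \<Longrightarrow> complex_linear M \<Longrightarrow> complex_linear (\<lambda>v. L (M v))"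
  by (auto simp: complex_linear_def intro: bounded_linear_compose)

lemma holo_on_compose:
  assumes "holo_on f V" "holo_on g U" "g ` U \<subseteq> V"
  shows "holo_on (\<lambda>z. f (g z)) U"
  unfolding holo_on_iff_complex_linear
proof
  fix z assume z: "z \<in> U"
  obtain L where L: "(g has_derivative L) (at z)" "complex_linear L"
    using assms(2) z unfolding holo_on_iff_complex_linear by blast
  obtain M where M: "(f has_derivative M) (at (g z))" "complex_linear M"
    using assms(1,3) z unfolding holo_on_iff_complex_linear by blast
  show "\<exists>L. ((\<lambda>z. f (g z)) has_derivative L) (at z) \<and> complex_linear L"
    using has_derivative_compose[OF L(1) M(1)] complex_linear_compose[OF M(2) L(2)] by blast
qed

text \<open>The last clause is strict differentiability at 0 with derivative \<open>L\<close>. It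
  survives sums and compositions, makes \<open>f\<close> Lipschitz near 0 and, for invertible
  \<open>L\<close>, injective near 0, without recourse to continuity of the derivative.\<close>

definition holo_germ :: "(complex^'n \<Rightarrow> complex^'n) \<Rightarrow> (complex^'n \<Rightarrow> complex^'n) \<Rightarrow> bool" where
  "holo_germ f L \<longleftrightarrow> f 0 = 0 \<and> complex_linear L \<and> (\<exists>r>0. holo_on f (ball 0 r)) \<and>
     (\<forall>e>0. \<exists>d>0. \<forall>x y. norm x < d \<longrightarrow> norm y < d \<longrightarrow>
        norm (f x - f y - L (x - y)) \<le> e * norm (x - y))"

lemma holo_germ_vanishes:
  assumes "holo_germ f L"
  shows "vanishes 1 f"
proof -
  have f0: "f 0 = 0" and L: "bounded_linear L"
    using assms by (auto simp: holo_germ_def complex_linear_def)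
  from assms obtain d where d: "d > 0" "\<And>x y. norm x < d \<Longrightarrow> norm y < d \<Longrightarrow>
      norm (f x - f y - L (x - y)) \<le> 1 * norm (x - y)"
    unfolding holo_germ_def by (meson zero_less_one)
  from bounded_linear.nonneg_bounded[OF L] obtain K where K: "\<And>x. norm (L x) \<le> norm x * K" by auto
  have "norm (f x) \<le> (K + 1) * norm x ^ 1" if "norm x < d" for x
    using d(2)[of x 0] K[of x] d(1) that f0 norm_triangle_sub[of "f x" "L x"]
    by (auto simp: algebra_simps)
  then have "\<forall>\<^sub>F z in nhds 0. norm (f z) \<le> (K + 1) * norm z ^ 1"
    unfolding eventually_nhds_metric using d(1) by (auto intro!: exI[of _ d])
  then show ?thesis by (rule vanishesI)
qed

lemma holo_germ_continuous: "holo_germ f L \<Longrightarrow> (f \<longlongrightarrow> 0) (nhds 0)"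
  using vanishes_tendsto[OF holo_germ_vanishes] by simp

lemma holo_germ_eventually:
  "holo_germ f L \<Longrightarrow> (\<forall>\<^sub>F z in nhds 0. P z) \<Longrightarrow> \<forall>\<^sub>F z in nhds 0. P (f z)"
  using holo_germ_continuous[of f L] by (simp add: filterlim_iff)

lemma holo_germ_compose:
  assumes f: "holo_germ f L" and g: "holo_germ g M"
  shows "holo_germ (\<lambda>z. f (g z)) (\<lambda>z. L (M z))"
  unfolding holo_germ_def
proof (intro conjI allI impI)
  have L: "complex_linear L" and M: "complex_linear M" and "f 0 = 0" "g 0 = 0"
    using f g by (auto simp: holo_germ_def)
  then show "f (g 0) = 0" by simp
  show "complex_linear (\<lambda>z. L (M z))" using L M by (rule complex_linear_compose)
  obtain r s where r: "r > 0" "holo_on f (ball 0 r)" and s: "s > 0" "holo_on g (ball 0 s)"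
    using f g by (auto simp: holo_germ_def)
  have "\<forall>\<^sub>F z in nhds 0. g z \<in> ball 0 r"
    using holo_germ_eventually[OF g, of "\<lambda>z. z \<in> ball 0 r"] r(1)
    by (metis centre_in_ball eventually_nhds open_ball)
  then obtain t where t: "t > 0" "\<And>z. norm z < t \<Longrightarrow> g z \<in> ball 0 r"
    by (auto simp: eventually_nhds_metric)
  show "\<exists>r>0. holo_on (\<lambda>z. f (g z)) (ball 0 r)"
  proof (intro exI conjI)
    show "holo_on (\<lambda>z. f (g z)) (ball 0 (min s t))"
      by (rule holo_on_compose[OF r(2) holo_on_subset[OF s(2)]]) (use t in auto)
  qed (use s t in auto)
  fix e :: real assume e: "e > 0"
  from L bounded_linear.pos_bounded[of L] obtain K where K: "K > 0" "\<And>x. norm (L x) \<le> norm x * K"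
    by (auto simp: complex_linear_def)
  from M bounded_linear.pos_bounded[of M] obtain N where N: "N > 0" "\<And>x. norm (M x) \<le> norm x * N"
    by (auto simp: complex_linear_def)
  \<comment> \<open>The error of the composition is the error of \<open>f\<close> at the points g x,
    g y plus \<open>L\<close> applied to the error of \<open>g\<close>; each gets e/2.
    \<open>N + 1\<close> is a Lipschitz constant of \<open>g\<close> near 0, which is why
    \<open>e2\<close> is kept at most 1, and \<open>K\<close> bounds \<open>L\<close>.\<close>
  define e1 where "e1 = e / (2 * (N + 1))"
  define e2 where "e2 = min 1 (e / (2 * K))"
  have e1: "e1 > 0" and e2: "e2 > 0" using e K N by (auto simp: e1_def e2_def)
  obtain d1 where d1: "d1 > 0" "\<And>x y. norm x < d1 \<Longrightarrow> norm y < d1 \<Longrightarrow>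
      norm (f x - f y - L (x - y)) \<le> e1 * norm (x - y)"
    using f e1 unfolding holo_germ_def by meson
  obtain d2 where d2: "d2 > 0" "\<And>x y. norm x < d2 \<Longrightarrow> norm y < d2 \<Longrightarrow>
      norm (g x - g y - M (x - y)) \<le> e2 * norm (x - y)"
    using g e2 unfolding holo_germ_def by meson
  have "\<forall>\<^sub>F z in nhds 0. g z \<in> ball 0 d1"
    using holo_germ_eventually[OF g, of "\<lambda>z. z \<in> ball 0 d1"] d1(1)
    by (metis centre_in_ball eventually_nhds open_ball)
  then obtain d3 where d3: "d3 > 0" "\<And>z. norm z < d3 \<Longrightarrow> norm (g z) < d1"
    by (auto simp: eventually_nhds_metric)
  show "\<exists>d>0. \<forall>x y. norm x < d \<longrightarrow> norm y < d \<longrightarrow>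
        norm (f (g x) - f (g y) - L (M (x - y))) \<le> e * norm (x - y)"
  proof (intro exI[of _ "min d2 d3"] conjI allI impI)
    fix x y :: "complex^'a" assume xy: "norm x < min d2 d3" "norm y < min d2 d3"
    interpret L: bounded_linear L using L by (simp add: complex_linear_def)
    have 1: "norm (g x - g y - M (x - y)) \<le> e2 * norm (x - y)" using xy d2 by auto
    have "norm (g x - g y) \<le> norm (M (x - y)) + e2 * norm (x - y)"
      using 1 norm_triangle_sub[of "g x - g y" "M (x - y)"] by linarith
    also have "\<dots> \<le> (N + 1) * norm (x - y)"
      using N(2)[of "x - y"] mult_right_mono[of e2 1 "norm (x - y)"]
      by (auto simp: algebra_simps e2_def)
    finally have 2: "norm (g x - g y) \<le> (N + 1) * norm (x - y)" .
    have "norm (f (g x) - f (g y) - L (g x - g y)) \<le> e1 * norm (g x - g y)"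
      using xy d3 d1 by auto
    also have "\<dots> \<le> e1 * ((N + 1) * norm (x - y))" using 2 e1 by (intro mult_left_mono) auto
    also have "\<dots> = e / 2 * norm (x - y)" using N by (simp add: e1_def field_simps)
    finally have 3: "norm (f (g x) - f (g y) - L (g x - g y)) \<le> e / 2 * norm (x - y)" .
    have "norm (L (g x - g y - M (x - y))) \<le> (e2 * norm (x - y)) * K"
      using K(2)[of "g x - g y - M (x - y)"] 1 K(1) by (smt (verit) mult_right_mono)
    also have "\<dots> = (e2 * K) * norm (x - y)" by simp
    also have "\<dots> \<le> e / 2 * norm (x - y)"
      using K(1) by (intro mult_right_mono) (auto simp: e2_def field_simps min_def)
    finally have 4: "norm (L (g x - g y - M (x - y))) \<le> e / 2 * norm (x - y)" .
    have "f (g x) - f (g y) - L (M (x - y))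
        = (f (g x) - f (g y) - L (g x - g y)) + L (g x - g y - M (x - y))"
      by (simp add: L.diff)
    then have "norm (f (g x) - f (g y) - L (M (x - y)))
        \<le> norm (f (g x) - f (g y) - L (g x - g y)) + norm (L (g x - g y - M (x - y)))"
      using norm_triangle_ineq by metis
    then show "norm (f (g x) - f (g y) - L (M (x - y))) \<le> e * norm (x - y)"
      using 3 4 by linarith
  qed (use d2 d3 in auto)
qed

lemma holo_germ_linear: "complex_linear L \<Longrightarrow> holo_germ L L"
  unfolding holo_germ_def
proof (intro conjI allI impI)
  assume L: "complex_linear L"
  then have b: "bounded_linear L" by (simp add: complex_linear_def)
  show "L 0 = 0" using linear_0 b bounded_linear.linear by blast
  show "\<exists>r>0. holo_on L (ball 0 r)"
    unfolding holo_on_iff_complex_linear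
    using bounded_linear_imp_has_derivative[OF b] L by (meson zero_less_one)
  fix e :: real assume "e > 0"
  then show "\<exists>d>0. \<forall>x y. norm x < d \<longrightarrow> norm y < d \<longrightarrow> norm (L x - L y - L (x - y)) \<le> e * norm (x - y)"
    using linear_diff[OF bounded_linear.linear[OF b]] by (intro exI[of _ 1]) auto
qed

lemma holo_germ_add:
  assumes f: "holo_germ f L" and g: "holo_germ g M"
  shows "holo_germ (\<lambda>z. f z + g z) (\<lambda>z. L z + M z)"
  unfolding holo_germ_def
proof (intro conjI allI impI)
  have L: "complex_linear L" and M: "complex_linear M" and "f 0 = 0" "g 0 = 0"
    using f g by (auto simp: holo_germ_def)
  then show "f 0 + g 0 = 0" by simp
  have *: "complex_linear (\<lambda>z. L z + M z)" if "complex_linear L" "complex_linear M" for L M :: "complex^'a \<Rightarrow> complex^'a"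
    using that by (auto simp: complex_linear_def vector_add_ldistrib intro!: bounded_linear_add)
  then show "complex_linear (\<lambda>z. L z + M z)" using L M by blast
  obtain r s where r: "r > 0" "holo_on f (ball 0 r)" and s: "s > 0" "holo_on g (ball 0 s)"
    using f g by (auto simp: holo_germ_def)
  show "\<exists>r>0. holo_on (\<lambda>z. f z + g z) (ball 0 r)"
    unfolding holo_on_iff_complex_linear
  proof (intro exI[of _ "min r s"] conjI ballI)
    fix z :: "complex^'a" assume "z \<in> ball 0 (min r s)"
    then obtain Lz Mz where "(f has_derivative Lz) (at z)" "complex_linear Lz"
      "(g has_derivative Mz) (at z)" "complex_linear Mz"
      using r(2) s(2) unfolding holo_on_iff_complex_linear by (auto simp: Ball_def) blast
    then show "\<exists>L. ((\<lambda>z. f z + g z) has_derivative L) (at z) \<and> complex_linear L"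
      by (intro exI[of _ "\<lambda>z. Lz z + Mz z"] conjI has_derivative_add *)
  qed (use r s in auto)
  fix e :: real assume e: "e > 0"
  obtain d1 where d1: "d1 > 0" "\<And>x y. norm x < d1 \<Longrightarrow> norm y < d1 \<Longrightarrow>
      norm (f x - f y - L (x - y)) \<le> e / 2 * norm (x - y)"
    using f e unfolding holo_germ_def by (meson half_gt_zero)
  obtain d2 where d2: "d2 > 0" "\<And>x y. norm x < d2 \<Longrightarrow> norm y < d2 \<Longrightarrow>
      norm (g x - g y - M (x - y)) \<le> e / 2 * norm (x - y)"
    using g e unfolding holo_germ_def by (meson half_gt_zero)
  show "\<exists>d>0. \<forall>x y. norm x < d \<longrightarrow> norm y < d \<longrightarrow>
        norm (f x + g x - (f y + g y) - (L (x - y) + M (x - y))) \<le> e * norm (x - y)"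
  proof (intro exI[of _ "min d1 d2"] conjI allI impI)
    fix x y :: "complex^'a" assume xy: "norm x < min d1 d2" "norm y < min d1 d2"
    have "norm (f x + g x - (f y + g y) - (L (x - y) + M (x - y)))
      = norm ((f x - f y - L (x - y)) + (g x - g y - M (x - y)))" by (simp add: algebra_simps)
    also have "\<dots> \<le> norm (f x - f y - L (x - y)) + norm (g x - g y - M (x - y))"
      by (rule norm_triangle_ineq)
    also have "\<dots> \<le> e / 2 * norm (x - y) + e / 2 * norm (x - y)"
      using d1(2) d2(2) xy by (intro add_mono) auto
    finally show "norm (f x + g x - (f y + g y) - (L (x - y) + M (x - y))) \<le> e * norm (x - y)"
      by simp
  qed (use d1 d2 in auto)
qed

lemma holo_germ_sum:
  assumes "finite I" "\<And>i. i \<in> I \<Longrightarrow> holo_germ (f i) (L i)"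
  shows "holo_germ (\<lambda>z. \<Sum>i\<in>I. f i z) (\<lambda>z. \<Sum>i\<in>I. L i z)"
  using assms
proof (induction I rule: finite_induct)
  case empty
  have "complex_linear (\<lambda>z::complex^'b. 0 :: complex^'b)" by (simp add: complex_linear_def)
  then show ?case using holo_germ_linear by fastforce
qed (auto intro: holo_germ_add)

lemma complex_linear_scale: "complex_linear (\<lambda>v::complex^'n::finite. c *s v)"
proof -
  have "(\<lambda>v::complex^'n. c *s v) = (\<lambda>v. mat c *v v)"
    by (auto simp: fun_eq_iff vec_eq_iff matrix_vector_mult_def mat_def if_distrib if_distribR sum.If_cases)
  then show ?thesis by (metis complex_linear_matrix)
qed

lemma holo_germ_scale: "holo_germ f L \<Longrightarrow> holo_germ (\<lambda>z. c *s f z) (\<lambda>z. c *s L z)"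
  using holo_germ_compose[OF holo_germ_linear[OF complex_linear_scale]] .

section \<open>Inverses of germs\<close>

lemma biholo_germ0_inv_sym: "biholo_germ0_inv f g \<Longrightarrow> biholo_germ0_inv g f"
  unfolding biholo_germ0_inv_def
proof (elim conjE exE)
  fix U V assume *: "f 0 = 0" "open U" "open V" "0 \<in> U" "f ` U = V" "holo_on f U" "holo_on g V" "\<forall>z\<in>U. g (f z) = z"
  have "g 0 = 0" using * by metis
  moreover have "0 \<in> V" using * by (metis image_eqI)
  moreover have "g ` V = U" using * by (auto simp: image_image)
  moreover have "\<forall>z\<in>V. f (g z) = z" using * by auto
  ultimately show "g 0 = 0 \<and> (\<exists>U V. open U \<and> open V \<and> 0 \<in> U \<and> g ` U = V \<and> holo_on g U \<and> holo_on f V \<and> (\<forall>z\<in>U. f (g z) = z))"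
    using * by blast
qed

text \<open>Bounded below means injective, hence bijective in finite dimension, and complex
  linearity passes to the inverse.\<close>

lemma complex_linear_inverse:
  assumes L: "complex_linear L" and c: "c > 0" "\<And>v. c * norm v \<le> norm (L v)"
  obtains M :: "complex^'n \<Rightarrow> complex^'n" where "complex_linear M" "L \<circ> M = id" "M \<circ> L = id"
proof -
  have lin: "linear L" and bl: "bounded_linear L"
    using L by (auto simp: complex_linear_def bounded_linear.linear)
  have inj: "inj L"
    unfolding linear_injective_0[OF lin]
  proof (intro allI impI)
    fix x assume "L x = 0" then show "x = 0" using c(2)[of x] c(1) by (simp add: mult_le_0_iff)
  qed
  then obtain M where M: "linear M" "\<And>x. M (L x) = x" "\<And>x. L (M x) = x"
    using linear_injective_isomorphism[OF lin inj] by blast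
  have "M (k *s v) = k *s M v" for k v
    using L M(2)[of "k *s M v"] M(3)[of v] by (simp add: complex_linear_def)
  with M that[of M] show thesis
    by (auto simp: complex_linear_def linear_conv_bounded_linear fun_eq_iff)
qed

text \<open>Strictness at 0 gives |f x - f y| >= c |x - y| on a ball. So \<open>f\<close> is
  injective there, the image is open by invariance of domain, and the same lower bound makes the
  derivative at every point of the ball invertible, which yields the derivative of the
  inverse.\<close>

lemma holo_germ_inverse:
  assumes f: "holo_germ f L" and LM: "complex_linear M" "\<And>v. M (L v) = v"
  obtains g where "biholo_germ0_inv f g"
proof -
  have L: "complex_linear L" using f by (simp add: holo_germ_def)
  obtain K where K: "K > 0" "\<And>x. norm (M x) \<le> norm x * K"
    using LM(1) bounded_linear.pos_bounded[of M] by (auto simp: complex_linear_def)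
  \<comment> \<open>From |v| = |M (L v)| <= K |L v| one gets |L v| >= 2 c |v|; half of this is spent
    on the remainder of \<open>f\<close>.\<close>
  define c where "c = 1 / (2 * K)"
  have c: "c > 0" using K by (simp add: c_def)
  have Lc: "2 * c * norm v \<le> norm (L v)" for v
    using K LM(2) [of v] K(2)[of "L v"] by (simp add: c_def field_simps)
  obtain d where d: "d > 0" "\<And>x y. norm x < d \<Longrightarrow> norm y < d \<Longrightarrow>
      norm (f x - f y - L (x - y)) \<le> c * norm (x - y)"
    using f c unfolding holo_germ_def by meson
  obtain r where r: "r > 0" "holo_on f (ball 0 r)" using f by (auto simp: holo_germ_def)
  define U :: "(complex^'a) set" where "U = ball 0 (min d r)"
  have U: "open U" "0 \<in> U" "holo_on f U"
    using d r by (auto simp: U_def intro: holo_on_subset)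
  have lower: "c * norm (x - y) \<le> norm (f x - f y)" if "x \<in> U" "y \<in> U" for x y
    using Lc[of "x - y"] d(2)[of x y] that norm_triangle_ineq2[of "L (x - y)" "f x - f y"]
    by (auto simp: U_def norm_minus_commute)
  have inj: "inj_on f U"
    using lower c by (intro inj_onI) (metis cancel_comm_monoid_add_class.diff_cancel eq_iff_diff_eq_0 mult_le_0_iff norm_le_zero_iff norm_zero not_le)
  have contf: "continuous_on U f" using U(3) by (rule holo_on_continuous_on)
  have opV: "open (f ` U)" by (rule invariance_of_domain[OF contf U(1) inj])
  define g where "g = inv_into U f"
  have gf: "g (f x) = x" if "x \<in> U" for x using inj that by (simp add: g_def)
  have "holo_on g (f ` U)"
    unfolding holo_on_iff_complex_linear
  proof
    fix w assume "w \<in> f ` U"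
    then obtain x where x: "x \<in> U" "w = f x" by auto
    obtain Lx where Lx: "(f has_derivative Lx) (at x)" "complex_linear Lx"
      using U(3) x unfolding holo_on_iff_complex_linear by blast
    interpret Lx: bounded_linear Lx using Lx by (simp add: complex_linear_def)
    \<comment> \<open>The lower bound for increments of \<open>f\<close> passes to its derivative at
      \<open>x\<close>; c is halved to absorb the remainder along a short multiple of
      \<open>v\<close>.\<close>
    have low: "c / 2 * norm v \<le> norm (Lx v)" for v
    proof (cases "v = 0")
      case False
      from Lx(1) have "\<exists>e>0. \<forall>y. norm (y - x) < e \<longrightarrow> norm (f y - f x - Lx (y - x)) \<le> c / 2 * norm (y - x)"
        unfolding has_derivative_at_alt using c by (meson half_gt_zero)
      then obtain e where e: "e > 0" "\<And>y. norm (y - x) < e \<Longrightarrow> norm (f y - f x - Lx (y - x)) \<le> c / 2 * norm (y - x)"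
        by blast
      obtain e' where e': "e' > 0" "ball x e' \<subseteq> U" using U(1) x openE by blast
      define t where "t = min e e' / (2 * norm v)"
      have t: "t > 0" using e e' False by (simp add: t_def)
      define y where "y = x + t *\<^sub>R v"
      have nyx: "norm (y - x) = t * norm v" using t by (simp add: y_def)
      have "t * norm v = min e e' / 2" using False by (simp add: t_def)
      then have "t * norm v < min e e'" using e(1) e'(1) by linarith
      then have 1: "norm (y - x) < e" "y \<in> U" using nyx e' by (auto simp: dist_norm norm_minus_commute subset_iff)
      have "c * (t * norm v) \<le> norm (f y - f x)" using lower[OF 1(2) x(1)] nyx by simp
      also have "\<dots> \<le> norm (Lx (y - x)) + c / 2 * (t * norm v)"
        using e(2)[OF 1(1)] nyx norm_triangle_ineq2[of "f y - f x" "Lx (y - x)"] by simp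
      also have "Lx (y - x) = t *\<^sub>R Lx v" by (simp add: y_def Lx.scaleR)
      finally have "c * (t * norm v) \<le> t * norm (Lx v) + c / 2 * (t * norm v)" using t by simp
      then have "t * (c / 2 * norm v) \<le> t * norm (Lx v)" by argo
      then show ?thesis using t by (simp only: mult_le_cancel_left_pos)
    qed (simp add: Lx.zero)
    obtain N where N: "complex_linear N" "Lx \<circ> N = id" "N \<circ> Lx = id"
      using complex_linear_inverse[OF Lx(2) _ low] c by (metis half_gt_zero)
    have "(g has_derivative N) (at (f x))"
      by (rule has_derivative_inverse_strong[OF U(1) x(1) contf gf Lx(1) N(2)])
    with N(1) x(2) show "\<exists>L. (g has_derivative L) (at w) \<and> complex_linear L" by blast
  qed
  moreover have "f 0 = 0" using f by (simp add: holo_germ_def)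
  ultimately have "biholo_germ0_inv f g"
    unfolding biholo_germ0_inv_def using U opV gf by blast
  then show thesis by (rule that)
qed

text \<open>On the complex line through \<open>z\<close>, a component that is not identically zero
  has a finite order n at 0, which contradicts vanishing to order n + 1. This identity theorem turns
  agreement to every order into equality of germs.\<close>

lemma holo_on_vanishes_imp_zero:
  fixes g :: "complex^'n \<Rightarrow> complex^'n"
  assumes g: "holo_on g (ball 0 r)" and van: "\<And>m. vanishes m g" and z: "norm z < r"
  shows "g z = 0"
proof (rule ccontr)
  assume "g z \<noteq> 0"
  then obtain j where j: "g z $ j \<noteq> 0" by (auto simp: vec_eq_iff)
  define q where "q = (\<lambda>t::complex. g (t *s z) $ j)"
  have g0: "g 0 = 0"
    using van[of 1] by (auto simp: vanishes_def eventually_nhds)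
  then have z0: "z \<noteq> 0" using \<open>g z \<noteq> 0\<close> by auto
  \<comment> \<open>R > 1 puts t = 1 into the disc. There \<open>q\<close> is nonzero, so
    connectedness of the disc makes the order at 0 finite.\<close>
  define R where "R = r / norm z"
  have R: "R > 1" using z z0 by (simp add: R_def field_simps)
  have nsz: "norm (t *s z) = norm t * norm z" for t :: complex
    by (simp add: norm_vec_def norm_mult L2_set_right_distrib)
  have bl: "bounded_linear (\<lambda>t::complex. t *s z)"
    by (intro linear_conv_bounded_linear[THEN iffD1] linearI)
       (auto simp: vec_eq_iff algebra_simps)
  have hol: "q holomorphic_on ball 0 R"
    unfolding holomorphic_on_def
  proof
    fix t :: complex assume t: "t \<in> ball 0 R"
    then have "t *s z \<in> ball 0 r" using nsz[of t] z0 by (simp add: R_def field_simps)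
    then obtain L where L: "(g has_derivative L) (at (t *s z))" "complex_linear L"
      using g unfolding holo_on_iff_complex_linear by blast
    have "(q has_derivative (\<lambda>s. L (s *s z) $ j)) (at t)"
      unfolding q_def
      by (intro bounded_linear.has_derivative[OF bounded_linear_vec_nth]
          has_derivative_compose[OF bounded_linear_imp_has_derivative[OF bl] L(1)])
    also have "(\<lambda>s. L (s *s z) $ j) = (*) (L z $ j)"
      using L(2) by (auto simp: complex_linear_def)
    finally have "(q has_field_derivative (L z $ j)) (at t)" by (simp add: has_field_derivative_def)
    then show "q field_differentiable at t within ball 0 R"
      using field_differentiable_at_within field_differentiable_def by blast
  qed
  have "1 \<in> ball (0::complex) R" "q 1 \<noteq> 0" using R j by (auto simp: q_def)
  then have "\<exists>w\<in>ball 0 R. q w \<noteq> 0" by blast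
  from zorder_exist_zero[OF hol open_ball connected_ball _ this, of 0] R
  have "\<exists>e>0. zor_poly q 0 holomorphic_on cball 0 e \<and>
    (\<forall>w\<in>cball 0 e. q w = zor_poly q 0 w * (w - 0) ^ nat (zorder q 0) \<and> zor_poly q 0 w \<noteq> 0)"
    by (metis centre_in_ball less_trans zero_less_one)
  then obtain e where e: "e > 0"
    "zor_poly q 0 holomorphic_on cball 0 e"
    "\<And>w. w \<in> cball 0 e \<Longrightarrow> q w = zor_poly q 0 w * (w - 0) ^ nat (zorder q 0) \<and> zor_poly q 0 w \<noteq> 0"
    by blast
  define n h where "n = nat (zorder q 0)" and "h = zor_poly q 0"
  have qn: "q w = h w * w ^ n" "h w \<noteq> 0" if "norm w \<le> e" for w
    using e(3)[of w] that by (auto simp: n_def h_def)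
  obtain C where C: "\<forall>\<^sub>F z in nhds 0. norm (g z) \<le> C * norm z ^ Suc n"
    using van[of "Suc n"] by (auto simp: vanishes_def)
  have "((\<lambda>t::complex. t *s z) \<longlongrightarrow> 0 *s z) (nhds 0)"
    using bounded_linear.tendsto[OF bl, of "\<lambda>t. t" 0 "nhds 0"] by (simp add: filterlim_ident)
  then have "\<forall>\<^sub>F t in nhds 0. norm (g (t *s z)) \<le> C * norm (t *s z) ^ Suc n"
    using C by (auto simp: filterlim_iff)
  then have "\<forall>\<^sub>F t in at 0. norm (g (t *s z)) \<le> C * norm (t *s z) ^ Suc n"
    unfolding eventually_at_filter by eventually_elim auto
  moreover have "\<forall>\<^sub>F t in at (0::complex). norm t < e"
    using e(1) by (auto simp: eventually_at)
  moreover have "\<forall>\<^sub>F t in at (0::complex). t \<noteq> 0" by (simp add: eventually_neq_at_within)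
  ultimately have ev: "\<forall>\<^sub>F t in at 0. norm (h t) \<le> C * norm z ^ Suc n * norm t"
  proof eventually_elim
    case (elim t)
    have "norm (h t) * norm t ^ n = norm (q t)" using qn(1)[of t] elim by (simp add: norm_mult norm_power)
    also have "\<dots> \<le> norm (g (t *s z))" unfolding q_def by (rule Finite_Cartesian_Product.norm_nth_le)
    also have "\<dots> \<le> C * norm (t *s z) ^ Suc n" by (rule elim)
    also have "\<dots> = (C * norm z ^ Suc n * norm t) * norm t ^ n"
      by (simp add: nsz power_mult_distrib)
    finally show ?case using elim by simp
  qed
  have "((\<lambda>t. C * norm z ^ Suc n * norm t) \<longlongrightarrow> C * norm z ^ Suc n * norm (0::complex)) (at (0::complex))"
    by (intro tendsto_intros)
  then have lim0: "(h \<longlongrightarrow> 0) (at 0)"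
    by (intro Lim_null_comparison[OF ev]) simp
  have "continuous_on (cball 0 e) h" using e(2) holomorphic_on_imp_continuous_on h_def by blast
  then have "isCont h 0" using e(1)
    by (meson centre_in_ball continuous_on_eq_continuous_at continuous_on_subset ball_subset_cball open_ball)
  then have "(h \<longlongrightarrow> h 0) (at 0)" by (simp add: isCont_def)
  with lim0 have "h 0 = 0" using tendsto_unique[OF trivial_limit_at] by blast
  then show False using qn(2)[of 0] e(1) by simp
qed

section \<open>Convergent power series\<close>

lemma eventually_nhds_0_ballI:
  fixes P :: "'a::real_normed_vector \<Rightarrow> bool"
  assumes "r > 0" "\<And>z. norm z < r \<Longrightarrow> P z"
  shows "\<forall>\<^sub>F z in nhds 0. P z"
  using assms by (auto simp: eventually_nhds_metric)

section \<open>Monomials as multi-indices and as words\<close>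

definition mon :: "('n::finite \<Rightarrow> nat) \<Rightarrow> complex^'n \<Rightarrow> complex" where
  "mon Q z = (\<Prod>j\<in>UNIV. (z $ j) ^ Q j)"

text \<open>Words in the variables accompany multi-indices for two reasons: estimates go by
  induction on the letters, and sums substituted into a series expand along words without
  multinomial coefficients.\<close>

definition wmon :: "'n list \<Rightarrow> complex^'n \<Rightarrow> complex" where
  "wmon w z = prod_list (map (($) z) w)"

text \<open>The canonical word of a multi-index. Its letters follow \<open>enum_idx\<close>, the
  order used by \<open>fmap_monpow\<close>, so that formal powers become products along this
  word.\<close>

definition index_word :: "('n::finite \<Rightarrow> nat) \<Rightarrow> 'n list" where
  "index_word Q = concat (map (\<lambda>i. replicate (Q i) i) enum_idx)"

lemma enum_idx: "distinct (enum_idx :: 'n::finite list)" "set (enum_idx :: 'n list) = UNIV"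
proof -
  have "\<exists>xs::'n list. distinct xs \<and> set xs = UNIV"
    using finite_distinct_list[of "UNIV :: 'n set"] by auto
  then have "distinct (enum_idx :: 'n list) \<and> set (enum_idx :: 'n list) = UNIV"
    unfolding enum_idx_def by (rule someI_ex)
  then show "distinct (enum_idx :: 'n list)" "set (enum_idx :: 'n list) = UNIV" by auto
qed

lemma prod_list_map_eq_prod_count:
  fixes f :: "'n::finite \<Rightarrow> 'a::comm_monoid_mult"
  shows "prod_list (map f w) = (\<Prod>i\<in>UNIV. f i ^ count_list w i)"
proof (induction w)
  case (Cons a w)
  have "(\<Prod>i\<in>UNIV. f i ^ count_list (a # w) i)
      = (\<Prod>i\<in>UNIV. f i ^ count_list w i * (if i = a then f i else 1))"
    by (intro prod.cong) (auto simp: mult.commute)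
  also have "\<dots> = (\<Prod>i\<in>UNIV. f i ^ count_list w i) * f a"
    by (simp add: prod.distrib)
  finally show ?case using Cons by (simp add: mult.commute)
qed auto

lemma wmon_eq_mon: "wmon w z = mon (count_list w) z"
  by (simp add: wmon_def mon_def prod_list_map_eq_prod_count)

lemma mi_deg_count_list: "mi_deg (count_list w) = length w"
proof (induction w)
  case (Cons a w)
  have "mi_deg (count_list (a # w)) = (\<Sum>i\<in>UNIV. count_list w i + (if i = a then 1 else 0))"
    unfolding mi_deg_def by (intro sum.cong) auto
  also have "\<dots> = mi_deg (count_list w) + 1" by (simp add: sum.distrib mi_deg_def)
  finally show ?case using Cons by (simp del: count_list.simps)
qed (simp add: mi_deg_def)

lemma count_list_index_word [simp]: "count_list (index_word Q) = Q"
proof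
  fix i
  have "count_list (concat (map (\<lambda>i. replicate (Q i) i) xs)) i = (if i \<in> set xs then Q i else 0)"
    if "distinct xs" for xs
    using that
  proof (induction xs)
    case (Cons a xs)
    have "count_list (replicate n a) i = (if i = a then n else 0)" for n
      by (induction n) auto
    with Cons show ?case by auto
  qed auto
  then show "count_list (index_word Q) i = Q i" by (simp add: index_word_def enum_idx)
qed

lemma length_index_word [simp]: "length (index_word Q) = mi_deg Q"
  by (metis count_list_index_word mi_deg_count_list)

lemma mon_eq_wmon: "mon Q z = wmon (index_word Q) z"
  by (simp add: wmon_eq_mon)

lemma mon_scale: "mon Q (t *s z) = t ^ mi_deg Q * mon Q z"
  by (simp add: mon_def power_mult_distrib prod.distrib mi_deg_def power_sum)

lemma norm_scale_complex: "norm (t *s z) = norm t * norm (z::complex^'n)"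
  by (simp add: norm_vec_def norm_mult L2_set_right_distrib)

lemma wmon_simps [simp]: "wmon [] z = 1" "wmon (i # w) z = z $ i * wmon w z"
  "wmon (w @ v) z = wmon w z * wmon v z"
  by (auto simp: wmon_def)

lemma norm_nth_le_bound: "norm x \<le> \<rho> \<Longrightarrow> norm (x $ i) \<le> \<rho>" for x :: "complex^'n"
  using Finite_Cartesian_Product.norm_nth_le order_trans by blast

lemma norm_wmon_le:
  assumes "norm x \<le> \<rho>"
  shows "norm (wmon w x) \<le> \<rho> ^ length w"
proof (induction w)
  case (Cons i w)
  have "0 \<le> \<rho>" using assms norm_ge_zero order_trans by blast
  then show ?case using Cons norm_nth_le_bound[OF assms, of i]
    by (auto simp: norm_mult intro!: mult_mono)
qed auto

lemma norm_mon_le: "norm x \<le> \<rho> \<Longrightarrow> norm (mon Q x) \<le> \<rho> ^ mi_deg Q"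
  using norm_wmon_le[of x \<rho> "index_word Q"] by (simp add: mon_eq_wmon)

text \<open>Telescoping over the letters. The factor \<rho> on the left turns the natural exponent n
  - 1 on the right into n, which avoids a truncated subtraction at the empty word.\<close>

lemma norm_wmon_diff_le:
  assumes x: "norm x \<le> \<rho>" and y: "norm y \<le> \<rho>"
  shows "\<rho> * norm (wmon w x - wmon w y) \<le> real (length w) * \<rho> ^ length w * norm (x - y)"
proof (induction w)
  case (Cons i w)
  have \<rho>: "0 \<le> \<rho>" using x norm_ge_zero order_trans by blast
  have "wmon (i # w) x - wmon (i # w) y = x $ i * (wmon w x - wmon w y) + (x $ i - y $ i) * wmon w y"
    by (simp add: algebra_simps)
  then have "norm (wmon (i # w) x - wmon (i # w) y)
      \<le> norm (x $ i) * norm (wmon w x - wmon w y) + norm ((x - y) $ i) * norm (wmon w y)"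
    by (metis norm_mult norm_triangle_ineq vector_minus_component)
  also have "\<dots> \<le> \<rho> * norm (wmon w x - wmon w y) + norm (x - y) * \<rho> ^ length w"
    using \<rho> x by (intro add_mono mult_mono norm_wmon_le y norm_nth_le_bound) auto
  also have "\<dots> \<le> real (length w) * \<rho> ^ length w * norm (x - y) + norm (x - y) * \<rho> ^ length w"
    using Cons by simp
  finally have "norm (wmon (i # w) x - wmon (i # w) y) \<le> real (Suc (length w)) * \<rho> ^ length w * norm (x - y)"
    by (simp add: algebra_simps)
  from mult_left_mono[OF this \<rho>] show ?case by (simp add: mult_ac)
qed auto

fun dmon :: "'n list \<Rightarrow> complex^'n \<Rightarrow> complex^'n \<Rightarrow> complex" where
  "dmon [] x h = 0"
| "dmon (i # w) x h = h $ i * wmon w x + x $ i * dmon w x h"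

lemma dmon_add: "dmon w x (h + k) = dmon w x h + dmon w x k"
  by (induction w) (auto simp: algebra_simps)

lemma dmon_scale: "dmon w x (c *s h) = c * dmon w x h"
  by (induction w) (auto simp: algebra_simps)

lemma norm_dmon_le:
  assumes x: "norm x \<le> \<rho>"
  shows "\<rho> * norm (dmon w x h) \<le> real (length w) * \<rho> ^ length w * norm h"
proof (induction w)
  case (Cons i w)
  have \<rho>: "0 \<le> \<rho>" using x norm_ge_zero order_trans by blast
  have "norm (dmon (i # w) x h) \<le> norm (h $ i) * norm (wmon w x) + norm (x $ i) * norm (dmon w x h)"
    by (metis dmon.simps(2) norm_mult norm_triangle_ineq)
  also have "\<dots> \<le> norm h * \<rho> ^ length w + \<rho> * norm (dmon w x h)"
    using \<rho> x by (intro add_mono mult_mono norm_wmon_le norm_nth_le_bound) auto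
  also have "\<dots> \<le> norm h * \<rho> ^ length w + real (length w) * \<rho> ^ length w * norm h"
    using Cons by simp
  finally have "norm (dmon (i # w) x h) \<le> real (Suc (length w)) * \<rho> ^ length w * norm h"
    by (simp add: algebra_simps)
  from mult_left_mono[OF this \<rho>] show ?case by (simp add: mult_ac)
qed auto

text \<open>Splitting off a letter, the Taylor remainder becomes x_i R + (y - x)_i D with R the
  remainder and D the increment of the tail. The constants therefore obey n^2 + n <= (n +
  1)^2.\<close>

lemma norm_wmon_remainder_le:
  assumes x: "norm x \<le> \<rho>" and y: "norm y \<le> \<rho>"
  shows "\<rho>\<^sup>2 * norm (wmon w y - wmon w x - dmon w x (y - x))
           \<le> (real (length w))\<^sup>2 * \<rho> ^ length w * (norm (y - x))\<^sup>2"
proof (induction w)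
  case (Cons i w)
  define R where "R = wmon w y - wmon w x - dmon w x (y - x)"
  define D where "D = wmon w y - wmon w x"
  define n where "n = real (length w)"
  have \<rho>: "0 \<le> \<rho>" using x norm_ge_zero order_trans by blast
  have "wmon (i # w) y - wmon (i # w) x - dmon (i # w) x (y - x) = x $ i * R + (y - x) $ i * D"
    by (simp add: R_def D_def algebra_simps)
  then have "norm (wmon (i # w) y - wmon (i # w) x - dmon (i # w) x (y - x))
      \<le> norm (x $ i) * norm R + norm ((y - x) $ i) * norm D"
    by (metis norm_mult norm_triangle_ineq)
  also have "\<dots> \<le> \<rho> * norm R + norm (y - x) * norm D"
    using x \<rho> by (intro add_mono mult_right_mono norm_nth_le_bound) auto
  finally have "\<rho>\<^sup>2 * norm (wmon (i # w) y - wmon (i # w) x - dmon (i # w) x (y - x))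
      \<le> \<rho>\<^sup>2 * (\<rho> * norm R + norm (y - x) * norm D)"
    by (intro mult_left_mono) auto
  also have "\<dots> = \<rho> * (\<rho>\<^sup>2 * norm R) + (\<rho> * norm (y - x)) * (\<rho> * norm D)"
    by (simp add: algebra_simps power2_eq_square)
  also have "\<dots> \<le> \<rho> * (n\<^sup>2 * \<rho> ^ length w * (norm (y - x))\<^sup>2)
      + (\<rho> * norm (y - x)) * (n * \<rho> ^ length w * norm (y - x))"
    using Cons norm_wmon_diff_le[OF y x, of w] \<rho>
    by (intro add_mono mult_left_mono) (auto simp: R_def D_def n_def)
  also have "\<dots> = (n\<^sup>2 + n) * (\<rho> ^ Suc (length w) * (norm (y - x))\<^sup>2)"
    by (simp add: algebra_simps power2_eq_square)
  also have "\<dots> \<le> (n + 1)\<^sup>2 * (\<rho> ^ Suc (length w) * (norm (y - x))\<^sup>2)"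
    using \<rho> by (intro mult_right_mono) (auto simp: n_def power2_eq_square algebra_simps)
  finally show ?case by (simp add: n_def algebra_simps)
qed auto

section \<open>Absolutely convergent series, their derivatives and leading terms\<close>

definition mps_conv :: "'n::finite mps \<Rightarrow> real \<Rightarrow> bool" where
  "mps_conv a r \<longleftrightarrow> r > 0 \<and> (\<lambda>Q. norm (a Q) * r ^ mi_deg Q) summable_on UNIV"

definition mps_eval :: "'n::finite mps \<Rightarrow> complex^'n \<Rightarrow> complex" where
  "mps_eval a z = (\<Sum>\<^sub>\<infinity>Q. a Q * mon Q z)"

lemma mps_conv_mono:
  assumes "mps_conv a r" "0 < s" "s \<le> r"
  shows "mps_conv a s"
  unfolding mps_conv_def
proof
  have sm: "(\<lambda>Q. norm (a Q) * r ^ mi_deg Q) summable_on UNIV" using assms by (simp add: mps_conv_def)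
  show "(\<lambda>Q. norm (a Q) * s ^ mi_deg Q) summable_on UNIV"
  proof (rule summable_on_comparison_test[OF sm])
    show "norm (a Q) * s ^ mi_deg Q \<le> norm (a Q) * r ^ mi_deg Q" for Q
      using assms by (intro mult_left_mono power_mono) auto
  qed (use assms in auto)
qed (use assms in auto)

lemma mps_conv_smaller:
  assumes "mps_conv a r" "\<And>Q. norm (b Q) \<le> norm (a Q)"
  shows "mps_conv b r"
  unfolding mps_conv_def
proof
  have r: "r > 0" and sm: "(\<lambda>Q. norm (a Q) * r ^ mi_deg Q) summable_on UNIV"
    using assms by (auto simp: mps_conv_def)
  show "(\<lambda>Q. norm (b Q) * r ^ mi_deg Q) summable_on UNIV"
    by (rule summable_on_comparison_test[OF sm]) (use assms(2) r in \<open>auto intro: mult_right_mono\<close>)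
qed (use assms in \<open>auto simp: mps_conv_def\<close>)

text \<open>The common form of all termwise estimates below: \<open>X\<close> will be a monomial,
  its differential, an increment or a Taylor remainder, each bounded by a fixed multiple of
  r^|Q|.\<close>

lemma summable_bounded_mult:
  fixes a :: "'q \<Rightarrow> complex" and X :: "'q \<Rightarrow> complex"
  assumes s: "(\<lambda>Q. norm (a Q) * B Q) summable_on UNIV" and "\<And>Q. norm (X Q) \<le> C * B Q"
  shows "(\<lambda>Q. a Q * X Q) summable_on UNIV"
    and "norm (\<Sum>\<^sub>\<infinity>Q. a Q * X Q) \<le> C * (\<Sum>\<^sub>\<infinity>Q. norm (a Q) * B Q)"
proof -
  have s': "(\<lambda>Q. C * (norm (a Q) * B Q)) summable_on UNIV"
    by (rule summable_on_cmult_right[OF s])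
  have le: "norm (a Q * X Q) \<le> C * (norm (a Q) * B Q)" for Q
    using mult_left_mono[OF assms(2)[of Q] norm_ge_zero[of "a Q"]] by (simp add: norm_mult mult_ac)
  have abs: "(\<lambda>Q. norm (a Q * X Q)) summable_on UNIV"
    by (rule summable_on_comparison_test[OF s']) (use le in auto)
  then show "(\<lambda>Q. a Q * X Q) summable_on UNIV" by (rule abs_summable_summable)
  have "norm (\<Sum>\<^sub>\<infinity>Q. a Q * X Q) \<le> (\<Sum>\<^sub>\<infinity>Q. norm (a Q * X Q))"
    by (rule norm_infsum_bound[OF abs])
  also have "\<dots> \<le> (\<Sum>\<^sub>\<infinity>Q. C * (norm (a Q) * B Q))"
    by (rule infsum_mono[OF abs s']) (use le in auto)
  also have "\<dots> = C * (\<Sum>\<^sub>\<infinity>Q. norm (a Q) * B Q)" by (rule infsum_cmult_right[OF s])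
  finally show "norm (\<Sum>\<^sub>\<infinity>Q. a Q * X Q) \<le> C * (\<Sum>\<^sub>\<infinity>Q. norm (a Q) * B Q)" .
qed

lemma mps_eval_has_sum:
  assumes "mps_conv a r" "norm z \<le> r"
  shows "((\<lambda>Q. a Q * mon Q z) has_sum mps_eval a z) UNIV"
  unfolding mps_eval_def
  by (intro has_sum_infsum summable_bounded_mult(1)[where B = "\<lambda>Q. r ^ mi_deg Q" and C = 1])
     (use assms norm_mon_le[of z r] in \<open>auto simp: mps_conv_def\<close>)

text \<open>Since n <= 2^n, the polynomial factors n and n^2 produced by differentiation are
  absorbed by shrinking the radius to a quarter. This is the origin of r/4 in the following
  lemmas.\<close>

lemma length_pow_le:
  assumes "0 \<le> \<rho>" "\<rho> \<le> r / 4"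
  shows "(real n)\<^sup>2 * \<rho> ^ n \<le> r ^ n" "real n * \<rho> ^ n \<le> (r / 2) ^ n"
proof -
  have n: "real n \<le> 2 ^ n" using of_nat_less_two_power[of n, where 'a = real] by simp
  have "(real n)\<^sup>2 * \<rho> ^ n \<le> (2 ^ n)\<^sup>2 * (r / 4) ^ n"
    using assms n by (intro mult_mono power_mono) auto
  also have "\<dots> = r ^ n" by (simp add: power2_eq_square flip: power_mult_distrib)
  finally show "(real n)\<^sup>2 * \<rho> ^ n \<le> r ^ n" .
  have "real n * \<rho> ^ n \<le> 2 ^ n * (r / 4) ^ n"
    using assms n by (intro mult_mono power_mono) auto
  also have "\<dots> = (r / 2) ^ n" by (simp flip: power_mult_distrib)
  finally show "real n * \<rho> ^ n \<le> (r / 2) ^ n" .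
qed

text \<open>Termwise differentiation: the second-order remainders of the monomials add up to O(|y -
  x|^2), with one constant for the whole ball of radius r/4.\<close>

lemma mps_eval_has_derivative:
  assumes a: "mps_conv a r" and x: "norm x < r / 4"
  obtains L where "(mps_eval a has_derivative L) (at x)" "\<And>c v. L (c *s v) = c * L v"
proof -
  define \<rho> where "\<rho> = r / 4"
  have r: "r > 0" using a by (simp add: mps_conv_def)
  have \<rho>: "\<rho> > 0" using r by (simp add: \<rho>_def)
  have sm: "(\<lambda>Q. norm (a Q) * r ^ mi_deg Q) summable_on UNIV" using a by (simp add: mps_conv_def)
  define S where "S = (\<Sum>\<^sub>\<infinity>Q. norm (a Q) * r ^ mi_deg Q)"
  define D where "D = (\<lambda>Q h. dmon (index_word Q) x h)"
  define L where "L = (\<lambda>h. \<Sum>\<^sub>\<infinity>Q. a Q * D Q h)"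
  have Db: "norm (D Q h) \<le> (norm h / \<rho>) * r ^ mi_deg Q" for Q h
  proof -
    have "\<rho> * norm (D Q h) \<le> real (mi_deg Q) * \<rho> ^ mi_deg Q * norm h"
      using norm_dmon_le[of x \<rho> "index_word Q" h] x by (simp add: D_def \<rho>_def)
    also have "\<dots> \<le> (r / 2) ^ mi_deg Q * norm h"
      using length_pow_le(2)[of \<rho> r "mi_deg Q"] \<rho> by (intro mult_right_mono) (auto simp: \<rho>_def)
    also have "\<dots> \<le> r ^ mi_deg Q * norm h" using r by (intro mult_right_mono power_mono) auto
    finally show ?thesis using \<rho> by (simp add: field_simps)
  qed
  note Ls = summable_bounded_mult[OF sm Db]
  have L_add: "L (h + k) = L h + L k" for h k
    unfolding L_def using infsum_add[OF Ls(1)[of h] Ls(1)[of k]]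
    by (simp add: D_def dmon_add algebra_simps)
  have L_scale: "L (c *s h) = c * L h" for c h
    unfolding L_def using infsum_cmult_right[OF Ls(1)[of h], of c]
    by (simp add: D_def dmon_scale mult_ac)
  have L_bl: "bounded_linear L"
  proof (rule bounded_linear_intro)
    show "L (r *\<^sub>R x) = r *\<^sub>R L x" for r x
      using L_scale[of "of_real r" x]
      by (metis scaleR_conv_of_real vec_eq_iff vector_scaleR_component vector_smult_component)
    show "norm (L h) \<le> norm h * (S / \<rho>)" for h
      using Ls(2)[of h] by (simp add: L_def S_def)
  qed (rule L_add)
  have rem: "norm (mps_eval a y - mps_eval a x - L (y - x)) \<le> (S / \<rho>\<^sup>2) * (norm (y - x))\<^sup>2"
    if y: "norm y < \<rho>" for y
  proof -
    define X where "X = (\<lambda>Q. mon Q y - mon Q x - D Q (y - x))"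
    have Xb: "norm (X Q) \<le> ((norm (y - x))\<^sup>2 / \<rho>\<^sup>2) * r ^ mi_deg Q" for Q
    proof -
      have "\<rho>\<^sup>2 * norm (X Q) \<le> (real (mi_deg Q))\<^sup>2 * \<rho> ^ mi_deg Q * (norm (y - x))\<^sup>2"
        using norm_wmon_remainder_le[of x \<rho> y "index_word Q"] x y
        by (simp add: X_def D_def mon_eq_wmon \<rho>_def)
      also have "\<dots> \<le> r ^ mi_deg Q * (norm (y - x))\<^sup>2"
        using length_pow_le(1)[of \<rho> r "mi_deg Q"] \<rho> by (intro mult_right_mono) (auto simp: \<rho>_def)
      finally show ?thesis using \<rho> by (simp add: field_simps)
    qed
    have xy: "norm x \<le> r" "norm y \<le> r" using x y r by (auto simp: \<rho>_def)
    have "((\<lambda>Q. a Q * mon Q y - a Q * mon Q x - a Q * D Q (y - x)) has_sum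
           (mps_eval a y - mps_eval a x - L (y - x))) UNIV"
      using has_sum_add[OF has_sum_add[OF mps_eval_has_sum[OF a xy(2)]
          has_sum_uminusI[OF mps_eval_has_sum[OF a xy(1)]]]
          has_sum_uminusI[OF has_sum_infsum[OF Ls(1)[of "y - x"]]]] by (simp add: L_def)
    then have "mps_eval a y - mps_eval a x - L (y - x) = (\<Sum>\<^sub>\<infinity>Q. a Q * X Q)"
      by (simp add: X_def algebra_simps infsumI)
    also have "norm \<dots> \<le> ((norm (y - x))\<^sup>2 / \<rho>\<^sup>2) * S"
      unfolding S_def by (rule summable_bounded_mult(2)[OF sm Xb])
    finally show ?thesis by (simp add: mult_ac)
  qed
  have "(mps_eval a has_derivative L) (at x)"
    unfolding has_derivative_at_alt
  proof (intro conjI allI impI L_bl)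
    fix e :: real assume e: "e > 0"
    define K where "K = S / \<rho>\<^sup>2"
    have "S \<ge> 0" unfolding S_def using r by (intro infsum_nonneg) auto
    then have K: "K \<ge> 0" using \<rho> by (simp add: K_def)
    define d where "d = min (\<rho> - norm x) (e / (K + 1))"
    have "d > 0" using x e K by (auto simp: d_def \<rho>_def)
    moreover have "norm (mps_eval a y - mps_eval a x - L (y - x)) \<le> e * norm (y - x)"
      if "norm (y - x) < d" for y
    proof -
      have "norm y < \<rho>" using that norm_triangle_sub[of y x] by (simp add: d_def)
      then have "norm (mps_eval a y - mps_eval a x - L (y - x)) \<le> K * (norm (y - x))\<^sup>2"
        using rem by (simp add: K_def)
      also have "\<dots> = (K * norm (y - x)) * norm (y - x)" by (simp add: power2_eq_square)
      also have "K * norm (y - x) \<le> (K + 1) * (e / (K + 1))"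
        using that K by (intro mult_mono) (auto simp: d_def)
      also have "\<dots> = e" using K by simp
      finally show ?thesis by (simp add: mult_right_mono)
    qed
    ultimately show "\<exists>d>0. \<forall>y. norm (y - x) < d \<longrightarrow>
        norm (mps_eval a y - mps_eval a x - L (y - x)) \<le> e * norm (y - x)" by blast
  qed
  then show thesis using that L_scale by blast
qed

text \<open>Terms of degree at least 2 have a Lipschitz constant proportional to \<rho> on the ball
  of radius \<rho>. This factor is the source both of strict differentiability at 0 and of the gain
  of one order in \<open>series_map_nonlinear_vanishes\<close>.\<close>

lemma mps_eval_lipschitz:
  assumes a: "mps_conv a r" and low: "\<And>Q. mi_deg Q < 2 \<Longrightarrow> a Q = 0"
  obtains C where "C \<ge> 0" "\<And>x y \<rho>. norm x \<le> \<rho> \<Longrightarrow> norm y \<le> \<rho> \<Longrightarrow> \<rho> \<le> r / 4 \<Longrightarrow>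
     norm (mps_eval a x - mps_eval a y) \<le> C * \<rho> * norm (x - y)"
proof -
  have r: "r > 0" using a by (simp add: mps_conv_def)
  have sm: "(\<lambda>Q. norm (a Q) * r ^ mi_deg Q) summable_on UNIV" using a by (simp add: mps_conv_def)
  define S where "S = (\<Sum>\<^sub>\<infinity>Q. norm (a Q) * r ^ mi_deg Q)"
  define C where "C = 16 / r\<^sup>2 * S"
  have "S \<ge> 0" unfolding S_def using r by (intro infsum_nonneg) auto
  then have C0: "C \<ge> 0" using r by (simp add: C_def)
  have "norm (mps_eval a x - mps_eval a y) \<le> C * \<rho> * norm (x - y)"
    if x: "norm x \<le> \<rho>" and y: "norm y \<le> \<rho>" and \<rho>r: "\<rho> \<le> r / 4" for x y \<rho>
  proof (cases "\<rho> > 0")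
    case True
    define X where "X = (\<lambda>Q. if mi_deg Q < 2 then 0 else mon Q x - mon Q y)"
    have Xb: "norm (X Q) \<le> (16 / r\<^sup>2 * \<rho> * norm (x - y)) * r ^ mi_deg Q" for Q
    proof (cases "mi_deg Q < 2")
      case False
      then obtain n where n: "mi_deg Q = n + 2" by (metis add.commute le_Suc_ex not_less)
      have "\<rho> * norm (X Q) \<le> real (mi_deg Q) * \<rho> ^ mi_deg Q * norm (x - y)"
        using norm_wmon_diff_le[OF x y, of "index_word Q"] False by (simp add: X_def mon_eq_wmon)
      also have "\<dots> = \<rho> * (\<rho> * (real (mi_deg Q) * \<rho> ^ n) * norm (x - y))"
        by (simp add: n algebra_simps power_add power2_eq_square)
      finally have "norm (X Q) \<le> \<rho> * (real (mi_deg Q) * \<rho> ^ n) * norm (x - y)"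
        using True by simp
      also have "\<dots> \<le> \<rho> * (real (mi_deg Q) * (r / 4) ^ n) * norm (x - y)"
        using True \<rho>r by (intro mult_left_mono mult_right_mono power_mono) auto
      also have "\<dots> = \<rho> * (real (mi_deg Q) * (r / 4) ^ mi_deg Q * (16 / r\<^sup>2)) * norm (x - y)"
        using r by (simp add: n power_add power2_eq_square field_simps)
      also have "\<dots> \<le> \<rho> * (r ^ mi_deg Q * (16 / r\<^sup>2)) * norm (x - y)"
      proof -
        have "real (mi_deg Q) * (r / 4) ^ mi_deg Q \<le> (r / 2) ^ mi_deg Q"
          using length_pow_le(2)[of "r / 4" r "mi_deg Q"] r by simp
        also have "\<dots> \<le> r ^ mi_deg Q" using r by (intro power_mono) auto
        finally show ?thesis using True by (intro mult_left_mono mult_right_mono) auto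
      qed
      finally show ?thesis by (simp add: mult_ac)
    qed (use True r in \<open>auto simp: X_def\<close>)
    have xy: "norm x \<le> r" "norm y \<le> r" using x y r \<rho>r by auto
    have "((\<lambda>Q. a Q * mon Q x - a Q * mon Q y) has_sum (mps_eval a x - mps_eval a y)) UNIV"
      using has_sum_add[OF mps_eval_has_sum[OF a xy(1)]
          has_sum_uminusI[OF mps_eval_has_sum[OF a xy(2)]]] by simp
    moreover have "a Q * mon Q x - a Q * mon Q y = a Q * X Q" for Q
      using low[of Q] by (auto simp: X_def algebra_simps)
    ultimately have "mps_eval a x - mps_eval a y = (\<Sum>\<^sub>\<infinity>Q. a Q * X Q)"
      by (simp add: infsumI)
    also have "norm \<dots> \<le> (16 / r\<^sup>2 * \<rho> * norm (x - y)) * S"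
      unfolding S_def by (rule summable_bounded_mult(2)[OF sm Xb])
    finally show ?thesis by (simp add: C_def mult_ac)
  next
    case False
    then have "norm x \<le> 0" "norm y \<le> 0" using x y by linarith+
    then show ?thesis by simp
  qed
  then show thesis using that C0 by blast
qed

lemma mps_eval_vanishes:
  assumes a: "mps_conv a r" and low: "\<And>Q. mi_deg Q < m \<Longrightarrow> a Q = 0"
  shows "vanishes m (mps_eval a)"
proof -
  have r: "r > 0" using a by (simp add: mps_conv_def)
  have sm: "(\<lambda>Q. norm (a Q) * r ^ mi_deg Q) summable_on UNIV" using a by (simp add: mps_conv_def)
  have "norm (mps_eval a z) \<le> ((\<Sum>\<^sub>\<infinity>Q. norm (a Q) * r ^ mi_deg Q) / r ^ m) * norm z ^ m" if z: "norm z < r" for z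
  proof -
    define X where "X = (\<lambda>Q. if mi_deg Q < m then 0 else mon Q z)"
    have "norm (X Q) \<le> (norm z ^ m / r ^ m) * r ^ mi_deg Q" for Q
    proof (cases "mi_deg Q < m")
      case False
      then obtain n where n: "mi_deg Q = n + m" by (metis add.commute le_Suc_ex not_less)
      have "norm (X Q) \<le> norm z ^ mi_deg Q" using False norm_mon_le[of z "norm z" Q] by (simp add: X_def)
      also have "\<dots> = norm z ^ m * norm z ^ n" by (simp add: n power_add)
      also have "\<dots> \<le> norm z ^ m * r ^ n" using z by (intro mult_left_mono power_mono) auto
      finally show ?thesis using r by (simp add: n power_add)
    qed (use r in \<open>auto simp: X_def\<close>)
    note b = summable_bounded_mult(2)[OF sm this]
    have "mps_eval a z = (\<Sum>\<^sub>\<infinity>Q. a Q * X Q)"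
      unfolding mps_eval_def by (rule infsum_cong) (use low in \<open>auto simp: X_def\<close>)
    then show ?thesis using b by (simp add: mult_ac)
  qed
  then show ?thesis
    by (rule vanishesI[OF eventually_nhds_0_ballI[OF r]])
qed

lemma finite_mi_deg_le: "finite {Q::'n::finite \<Rightarrow> nat. mi_deg Q \<le> m}"
proof (rule finite_subset)
  show "{Q::'n \<Rightarrow> nat. mi_deg Q \<le> m} \<subseteq> (UNIV \<rightarrow>\<^sub>E {..m})"
  proof
    fix Q :: "'n \<Rightarrow> nat" assume "Q \<in> {Q. mi_deg Q \<le> m}"
    then have "Q i \<le> m" for i
      using member_le_sum[of i UNIV Q] by (simp add: mi_deg_def)
    then show "Q \<in> (UNIV \<rightarrow>\<^sub>E {..m})" by auto
  qed
qed (auto intro: finite_PiE)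

lemma finite_mi_deg_eq: "finite {Q::'n::finite \<Rightarrow> nat. mi_deg Q = m}"
  by (rule finite_subset[OF _ finite_mi_deg_le[of m]]) auto

lemma mps_eval_split:
  assumes a: "mps_conv a r" and "finite S" "norm z \<le> r"
  shows "mps_eval a z = (\<Sum>Q\<in>S. a Q * mon Q z) + mps_eval (\<lambda>Q. if Q \<in> S then 0 else a Q) z"
proof -
  have "((\<lambda>Q. if Q \<in> S then a Q * mon Q z else 0) has_sum (\<Sum>Q\<in>S. a Q * mon Q z)) UNIV"
    by (rule has_sum_cong_neutral[THEN iffD1, OF _ _ _ has_sum_finite[OF assms(2)]]) auto
  moreover have "mps_conv (\<lambda>Q. if Q \<in> S then 0 else a Q) r"
    by (rule mps_conv_smaller[OF a]) auto
  ultimately have "((\<lambda>Q. (if Q \<in> S then a Q * mon Q z else 0) + (if Q \<in> S then 0 else a Q) * mon Q z)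
     has_sum ((\<Sum>Q\<in>S. a Q * mon Q z) + mps_eval (\<lambda>Q. if Q \<in> S then 0 else a Q) z)) UNIV"
    by (intro has_sum_add mps_eval_has_sum[OF _ assms(3)])
  also have "(\<lambda>Q. (if Q \<in> S then a Q * mon Q z else 0) + (if Q \<in> S then 0 else a Q) * mon Q z) = (\<lambda>Q. a Q * mon Q z)"
    by auto
  finally show ?thesis using has_sum_unique[OF mps_eval_has_sum[OF a assms(3)]] by blast
qed

lemma mon_mult: "mon Q (\<chi> i. y $ i * z $ i) = mon Q y * mon Q z"
  by (simp add: mon_def power_mult_distrib prod.distrib)

text \<open>Monomials are distinct multiplicative characters of $\mathbb{C}^n$, so this is Dedekind's
  independence of characters.\<close>
lemma mon_independent:
  assumes "finite S" "\<And>z. (\<Sum>Q\<in>S. c Q * mon Q z) = 0"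
  shows "\<forall>Q\<in>S. c Q = 0"
  using assms
proof (induction S arbitrary: c rule: finite_induct)
  case (insert R S)
  have S0: "c Q = 0" if Q: "Q \<in> S" for Q
  proof -
    from insert Q have "Q \<noteq> R" by auto
    then obtain i where i: "Q i \<noteq> R i" by auto
    define y :: "complex^'a" where "y = (\<chi> j. if j = i then 2 else 1)"
    have mony: "mon P y = 2 ^ P i" for P
    proof -
      have "mon P y = (\<Prod>j\<in>UNIV. if j = i then 2 ^ P j else 1)"
        unfolding mon_def y_def by (intro prod.cong) auto
      then show ?thesis by simp
    qed
    have "(\<Sum>Q\<in>S. (c Q * (mon Q y - mon R y)) * mon Q z) = 0" for z
    proof -
      have "0 = (\<Sum>Q\<in>insert R S. c Q * mon Q (\<chi> i. y $ i * z $ i)) - mon R y * (\<Sum>Q\<in>insert R S. c Q * mon Q z)"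
        using insert.prems by simp
      also have "\<dots> = (\<Sum>Q\<in>insert R S. (c Q * (mon Q y - mon R y)) * mon Q z)"
        by (simp only: mon_mult sum_distrib_left flip: sum_subtractf) (simp add: algebra_simps)
      also have "\<dots> = (\<Sum>Q\<in>S. (c Q * (mon Q y - mon R y)) * mon Q z)"
        using insert.hyps by simp
      finally show ?thesis by simp
    qed
    from insert.IH[OF this] Q have "c Q * (mon Q y - mon R y) = 0" by blast
    moreover have "(2::complex) ^ Q i \<noteq> 2 ^ R i"
    proof
      assume "(2::complex) ^ Q i = 2 ^ R i"
      then have "norm ((2::complex) ^ Q i) = norm ((2::complex) ^ R i)" by simp
      then show False using i by (simp add: norm_power)
    qed
    ultimately show ?thesis by (simp add: mony)
  qed
  moreover have "c R = 0"
    using insert.prems[of "\<chi> i. 1"] S0 insert.hyps by (simp add: mon_def)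
  ultimately show ?case by auto
qed auto

text \<open>Along t z homogeneity gives |t|^m |p(z)| = O(|t|^(m+1)), so p(z) = 0 as t tends to 0,
  and independence of monomials finishes. Together with \<open>mps_eval_leading\<close> this reads
  off leading coefficients from asymptotics.\<close>

lemma homogeneous_vanishes_imp_zero:
  assumes fin: "finite S" and deg: "\<And>Q. Q \<in> S \<Longrightarrow> mi_deg Q = m"
    and van: "vanishes (Suc m) (\<lambda>z. \<Sum>Q\<in>S. c Q * mon Q z)"
  shows "\<forall>Q\<in>S. c Q = 0"
proof (rule mon_independent[OF fin])
  fix z :: "complex^'a"
  define p where "p = (\<lambda>z. \<Sum>Q\<in>S. c Q * mon Q z)"
  have hom: "p (t *s z) = t ^ m * p z" for t
    by (simp add: p_def mon_scale deg sum_distrib_left mult_ac)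
  obtain C where C: "\<forall>\<^sub>F z in nhds 0. norm (p z) \<le> C * norm z ^ Suc m"
    using van unfolding p_def by (rule vanishesE)
  have bl: "bounded_linear (\<lambda>t::complex. t *s z)"
    by (intro linear_conv_bounded_linear[THEN iffD1] linearI) (auto simp: vec_eq_iff algebra_simps)
  have "((\<lambda>t::complex. t *s z) \<longlongrightarrow> 0 *s z) (nhds 0)"
    using bounded_linear.tendsto[OF bl, of "\<lambda>t. t" 0 "nhds 0"] by (simp add: filterlim_ident)
  then have "\<forall>\<^sub>F t in nhds 0. norm (p (t *s z)) \<le> C * norm (t *s z) ^ Suc m"
    using C by (auto simp: filterlim_iff)
  then have "\<forall>\<^sub>F t in at 0. norm (p (t *s z)) \<le> C * norm (t *s z) ^ Suc m"
    unfolding eventually_at_filter by eventually_elim auto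
  moreover have "\<forall>\<^sub>F t in at (0::complex). t \<noteq> 0" by (simp add: eventually_neq_at_within)
  ultimately have ev: "\<forall>\<^sub>F t in at (0::complex). norm (p z) \<le> C * norm z ^ Suc m * norm t"
  proof eventually_elim
    case (elim t)
    have "norm (p z) * norm t ^ m \<le> (C * norm z ^ Suc m * norm t) * norm t ^ m"
      using elim(1) by (simp add: hom norm_scale_complex norm_mult norm_power power_mult_distrib mult_ac)
    then show ?case using elim(2) by simp
  qed
  have "((\<lambda>t. C * norm z ^ Suc m * norm t) \<longlongrightarrow> C * norm z ^ Suc m * norm (0::complex)) (at (0::complex))"
    by (intro tendsto_intros)
  then have "((\<lambda>t. p z) \<longlongrightarrow> 0) (at (0::complex))"
    by (intro Lim_null_comparison[OF ev]) simp
  then have "p z = 0" using tendsto_unique[OF trivial_limit_at tendsto_const] by blast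
  then show "(\<Sum>Q\<in>S. c Q * mon Q z) = 0" by (simp add: p_def)
qed

lemma mps_eval_leading:
  fixes a :: "'n::finite mps"
  assumes a: "mps_conv a r" and low: "\<And>Q. mi_deg Q < m \<Longrightarrow> a Q = 0"
  shows "vanishes (Suc m) (\<lambda>z. mps_eval a z - (\<Sum>Q\<in>{Q. mi_deg Q = m}. a Q * mon Q z))"
proof -
  define S where "S = {Q::'n \<Rightarrow> nat. mi_deg Q = m}"
  define b where "b = (\<lambda>Q. if Q \<in> S then 0 else a Q)"
  have r: "r > 0" using a by (simp add: mps_conv_def)
  have "vanishes (Suc m) (mps_eval b)"
  proof (rule mps_eval_vanishes)
    show "mps_conv b r" by (rule mps_conv_smaller[OF a]) (auto simp: b_def)
    show "b Q = 0" if "mi_deg Q < Suc m" for Q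
      using that low[of Q] by (auto simp: b_def S_def less_Suc_eq)
  qed
  moreover have "\<forall>\<^sub>F z in nhds 0. mps_eval b z = mps_eval a z - (\<Sum>Q\<in>S. a Q * mon Q z)"
  proof -
    have "mps_eval b z = mps_eval a z - (\<Sum>Q\<in>S. a Q * mon Q z)" if "norm z < r" for z
      using mps_eval_split[OF a finite_mi_deg_eq[of m], of z] that by (simp add: b_def S_def)
    then show ?thesis
      by (rule eventually_nhds_0_ballI[OF r])
  qed
  ultimately show ?thesis unfolding S_def by (rule vanishes_cong[rotated])
qed

text \<open>Fubini for the partition of the index set by exponent. With trees as indices it converts
  an absolutely convergent sum over trees into a power series.\<close>

lemma mps_group:
  fixes q :: "'x \<Rightarrow> ('n::finite \<Rightarrow> nat)" and c :: "'x \<Rightarrow> complex"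
  assumes r: "r > 0" and sm: "(\<lambda>x. norm (c x) * r ^ mi_deg (q x)) summable_on UNIV"
  defines "a \<equiv> \<lambda>Q. \<Sum>\<^sub>\<infinity>x\<in>{x. q x = Q}. c x"
  shows "mps_conv a r"
    and "norm z \<le> r \<Longrightarrow> ((\<lambda>x. c x * mon (q x) z) has_sum mps_eval a z) UNIV"
proof -
  define J where "J = (SIGMA Q:UNIV. {x. q x = Q})"
  have bij: "bij_betw (\<lambda>x. (q x, x)) UNIV J"
    by (rule bij_betwI[where g = snd]) (auto simp: J_def)
  have smJ: "(\<lambda>(Q,x). norm (c x) * r ^ mi_deg Q) summable_on J"
    using summable_on_reindex_bij_betw[OF bij, of "\<lambda>(Q,x). norm (c x) * r ^ mi_deg Q"] sm by simp
  have s1: "(\<lambda>x. norm (c x)) summable_on {x. q x = Q}" for Q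
  proof -
    have "(\<lambda>x. norm (c x) * r ^ mi_deg (q x)) summable_on {x. q x = Q}"
      by (rule summable_on_subset_banach[OF sm]) auto
    then have "(\<lambda>x. norm (c x) * r ^ mi_deg Q) summable_on {x. q x = Q}"
      by (rule summable_on_cong[THEN iffD1, rotated]) auto
    then show ?thesis using r by (subst (asm) summable_on_cmult_left') auto
  qed
  have "(\<lambda>Q. \<Sum>\<^sub>\<infinity>x\<in>{x. q x = Q}. norm (c x) * r ^ mi_deg Q) summable_on UNIV"
    using summable_on_Sigma_banach[OF smJ[unfolded J_def]] by simp
  then have sN: "(\<lambda>Q. (\<Sum>\<^sub>\<infinity>x\<in>{x. q x = Q}. norm (c x)) * r ^ mi_deg Q) summable_on UNIV"
    using s1 by (simp add: infsum_cmult_left')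
  show conv: "mps_conv a r"
    unfolding mps_conv_def
  proof
    show "(\<lambda>Q. norm (a Q) * r ^ mi_deg Q) summable_on UNIV"
      by (rule summable_on_comparison_test[OF sN])
         (use r in \<open>auto simp: a_def intro!: mult_right_mono norm_infsum_bound s1\<close>)
  qed (rule r)
  assume z: "norm z \<le> r"
  have "(\<lambda>x. c x * mon (q x) z) summable_on UNIV"
    by (rule summable_bounded_mult(1)[OF sm, where C = 1]) (use norm_mon_le[OF z] in auto)
  then have sz: "(\<lambda>(Q,x). c x * mon Q z) summable_on J"
    using summable_on_reindex_bij_betw[OF bij, of "\<lambda>(Q,x). c x * mon Q z"] by simp
  have "((\<lambda>(Q,x). c x * mon Q z) has_sum mps_eval a z) J"
    unfolding J_def
  proof (rule has_sum_SigmaI)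
    show "((\<lambda>x. case (Q, x) of (Q, x) \<Rightarrow> c x * mon Q z) has_sum a Q * mon Q z) {x. q x = Q}" for Q
      using has_sum_cmult_left[OF has_sum_infsum[OF abs_summable_summable[OF s1[of Q]]], of "mon Q z"]
      by (simp add: a_def)
    show "((\<lambda>Q. a Q * mon Q z) has_sum mps_eval a z) UNIV"
      by (rule mps_eval_has_sum[OF conv z])
    show "(\<lambda>(Q, x). c x * mon Q z) summable_on (SIGMA Q:UNIV. {x. q x = Q})"
      using sz unfolding J_def .
  qed
  then show "((\<lambda>x. c x * mon (q x) z) has_sum mps_eval a z) UNIV"
    using has_sum_reindex_bij_betw[OF bij, of "\<lambda>(Q,x). c x * mon Q z"] by simp
qed

lemma has_power_series_at0_eval:
  fixes f :: "complex^'n::finite \<Rightarrow> complex^'n"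
  assumes "has_power_series_at0 f a"
  obtains r where "r > 0" "\<And>i. mps_conv (a i) r" "\<And>z i. norm z \<le> r \<Longrightarrow> f z $ i = mps_eval (a i) z"
proof -
  obtain s where s: "s > 0" and sum: "\<And>z i. (\<And>j. norm (z $ j) < s) \<Longrightarrow>
      ((\<lambda>Q. a i Q * mon Q z) has_sum (f z $ i)) UNIV"
    using assms unfolding has_power_series_at0_def mon_def by blast
  define r where "r = s / 2"
  have r: "r > 0" using s by (simp add: r_def)
  show thesis
  proof (rule that[OF r])
    fix i
    \<comment> \<open>At the point (r, ..., r) every monomial equals r^|Q|, and unconditional
      summability of complex numbers is absolute, so a single point controls the
      coefficients.\<close>
    define z :: "complex^'n" where "z = (\<chi> j. of_real r)"
    have "(\<lambda>Q. a i Q * mon Q z) summable_on UNIV"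
      using sum[of z i] r by (auto simp: z_def r_def intro: has_sum_imp_summable)
    then have "(\<lambda>Q. norm (a i Q * mon Q z)) summable_on UNIV"
      by (simp add: summable_on_iff_abs_summable_on_complex)
    moreover have "mon Q z = of_real r ^ mi_deg Q" for Q
      by (simp add: z_def mon_def mi_deg_def power_sum)
    ultimately show "mps_conv (a i) r"
      using r by (simp add: mps_conv_def norm_mult norm_power)
  next
    fix z :: "complex^'n" and i assume z: "norm z \<le> r"
    have "norm (z $ j) < s" for j using norm_nth_le_bound[OF z, of j] r by (simp add: r_def)
    then show "f z $ i = mps_eval (a i) z"
      using infsumI[OF sum[of z i]] by (simp add: mps_eval_def)
  qed
qed

lemma mi_deg_eq_0_iff: "mi_deg Q = 0 \<longleftrightarrow> Q = (\<lambda>_. 0)"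
  by (auto simp: mi_deg_def fun_eq_iff)

lemma mi_deg_eq_1_iff: "mi_deg Q = 1 \<longleftrightarrow> (\<exists>i. Q = mi_unit i)"
proof
  assume "mi_deg Q = 1"
  then have "length (index_word Q) = Suc 0" by simp
  then obtain i where "index_word Q = [i]" by (metis length_0_conv length_Suc_conv)
  then have "Q = count_list [i]" by (metis count_list_index_word)
  then show "\<exists>i. Q = mi_unit i" by (auto simp: mi_unit_def fun_eq_iff)
next
  assume "\<exists>i. Q = mi_unit i"
  then obtain i where "Q = mi_unit i" by auto
  then have "Q = count_list [i]" by (auto simp: mi_unit_def fun_eq_iff)
  then show "mi_deg Q = 1" by (simp only: mi_deg_count_list) simp
qed

lemma mon_0: "mon (\<lambda>_. 0) z = 1" by (simp add: mon_def)

lemma mon_unit: "mon (mi_unit i) z = z $ i"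
proof -
  have "mi_unit i = count_list [i]" by (auto simp: mi_unit_def fun_eq_iff)
  then show ?thesis by (metis wmon_eq_mon mult.right_neutral wmon_simps(1,2))
qed

lemma inj_mi_unit: "inj mi_unit"
  by (rule injI) (metis mi_unit_def zero_neq_one)

lemma linear_part_sum:
  "(\<Sum>Q\<in>{Q. mi_deg Q < 2}. a Q * mon Q z) = a (\<lambda>_. 0) + (\<Sum>j\<in>UNIV. a (mi_unit j) * z $ j)"
proof -
  have eq: "{Q. mi_deg Q < 2} = insert (\<lambda>_. 0) (range mi_unit)"
    using mi_deg_eq_1_iff by (auto simp: mi_deg_eq_0_iff less_2_cases_iff)
  have "(\<lambda>_. 0) \<notin> range mi_unit" by (auto simp: mi_unit_def) (metis zero_neq_one)
  then have "(\<Sum>Q\<in>{Q. mi_deg Q < 2}. a Q * mon Q z)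
      = a (\<lambda>_. 0) * mon (\<lambda>_. 0) z + (\<Sum>Q\<in>range mi_unit. a Q * mon Q z)"
    unfolding eq by (intro sum.insert) auto
  then show ?thesis
    by (simp add: mon_0 sum.reindex[OF inj_mi_unit] mon_unit)
qed

section \<open>Maps given by convergent series, and their linear parts\<close>

definition series_map :: "(complex^'n::finite \<Rightarrow> complex^'n) \<Rightarrow> 'n fmap \<Rightarrow> real \<Rightarrow> bool" where
  "series_map F a r \<longleftrightarrow> r > 0 \<and> (\<forall>i. mps_conv (a i) r) \<and>
     (\<forall>z i. norm z \<le> r \<longrightarrow> F z $ i = mps_eval (a i) z)"

definition linear_part :: "'n::finite fmap \<Rightarrow> complex^'n^'n" where
  "linear_part a = (\<chi> i j. a i (mi_unit j))"

lemma series_map_nonlinear: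
  assumes F: "series_map F a r"
  obtains C where "C \<ge> 0" "\<And>x y \<rho>. norm x \<le> \<rho> \<Longrightarrow> norm y \<le> \<rho> \<Longrightarrow> \<rho> \<le> r / 4 \<Longrightarrow>
     norm (F x - F y - linear_part a *v (x - y)) \<le> C * \<rho> * norm (x - y)"
proof -
  have r: "r > 0" and a: "\<And>i. mps_conv (a i) r"
    and ev: "\<And>z i. norm z \<le> r \<Longrightarrow> F z $ i = mps_eval (a i) z"
    using F by (auto simp: series_map_def)
  define b where "b = (\<lambda>i Q. if Q \<in> {Q. mi_deg Q < 2} then 0 else a i Q)"
  have fin: "finite {Q::'a \<Rightarrow> nat. mi_deg Q < 2}"
    by (rule finite_subset[OF _ finite_mi_deg_le[of 2]]) auto
  have split: "F z $ i = a i (\<lambda>_. 0) + (linear_part a *v z) $ i + mps_eval (b i) z" if "norm z \<le> r" for z i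
    using ev[OF that, of i] mps_eval_split[OF a fin that, of i] linear_part_sum[of "a i" z]
    by (simp add: b_def linear_part_def matrix_vector_mult_def)
  have "\<forall>i. \<exists>C\<ge>0. \<forall>x y \<rho>. norm x \<le> \<rho> \<longrightarrow> norm y \<le> \<rho> \<longrightarrow> \<rho> \<le> r / 4 \<longrightarrow>
     norm (mps_eval (b i) x - mps_eval (b i) y) \<le> C * \<rho> * norm (x - y)"
  proof
    fix i
    have "mps_conv (b i) r" by (rule mps_conv_smaller[OF a[of i]]) (auto simp: b_def)
    moreover have "b i Q = 0" if "mi_deg Q < 2" for Q using that by (simp add: b_def)
    ultimately obtain C where "C \<ge> 0" "\<And>x y \<rho>. norm x \<le> \<rho> \<Longrightarrow> norm y \<le> \<rho> \<Longrightarrow> \<rho> \<le> r / 4 \<Longrightarrow>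
      norm (mps_eval (b i) x - mps_eval (b i) y) \<le> C * \<rho> * norm (x - y)"
      using mps_eval_lipschitz by blast
    then show "\<exists>C\<ge>0. \<forall>x y \<rho>. norm x \<le> \<rho> \<longrightarrow> norm y \<le> \<rho> \<longrightarrow> \<rho> \<le> r / 4 \<longrightarrow>
     norm (mps_eval (b i) x - mps_eval (b i) y) \<le> C * \<rho> * norm (x - y)"
      by blast
  qed
  then obtain C where C: "\<And>i. C i \<ge> 0" "\<And>i x y \<rho>. norm x \<le> \<rho> \<Longrightarrow> norm y \<le> \<rho> \<Longrightarrow> \<rho> \<le> r / 4 \<Longrightarrow>
     norm (mps_eval (b i) x - mps_eval (b i) y) \<le> C i * \<rho> * norm (x - y)" by metis
  show thesis
  proof (rule that)
    show "(\<Sum>i\<in>UNIV. C i) \<ge> 0" by (intro sum_nonneg C)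
    fix x y :: "complex^'a" and \<rho> assume x: "norm x \<le> \<rho>" and y: "norm y \<le> \<rho>" and \<rho>: "\<rho> \<le> r / 4"
    define D where "D = F x - F y - linear_part a *v (x - y)"
    have "D $ i = mps_eval (b i) x - mps_eval (b i) y" for i
      using split[of x i] split[of y i] x y \<rho> r by (simp add: D_def matrix_vector_mult_diff_distrib)
    then have Di: "norm (D $ i) \<le> C i * \<rho> * norm (x - y)" for i
      using C(2)[OF x y \<rho>] by simp
    have "norm D \<le> (\<Sum>i\<in>UNIV. norm (D $ i))"
      unfolding norm_vec_def by (rule L2_set_le_sum) auto
    also have "\<dots> \<le> (\<Sum>i\<in>UNIV. C i * \<rho> * norm (x - y))" by (intro sum_mono Di)
    finally show "norm D \<le> (\<Sum>i\<in>UNIV. C i) * \<rho> * norm (x - y)"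
      by (simp add: sum_distrib_right)
  qed
qed

lemma has_derivative_vecI:
  fixes F :: "complex^'n::finite \<Rightarrow> complex^'m::finite"
  assumes "\<And>i. ((\<lambda>z. F z $ i) has_derivative (L i)) (at x)"
  shows "(F has_derivative (\<lambda>h. \<chi> i. L i h)) (at x)"
proof -
  have bl: "bounded_linear (axis i :: complex \<Rightarrow> complex^'m)" for i
    by (intro linear_conv_bounded_linear[THEN iffD1] linearI) (auto simp: axis_def vec_eq_iff)
  have eq: "v = (\<Sum>i\<in>UNIV. axis i (v $ i))" for v :: "complex^'m"
    by (simp add: vec_eq_iff axis_def)
  have "((\<lambda>z. \<Sum>i\<in>UNIV. axis i (F z $ i)) has_derivative (\<lambda>h. \<Sum>i\<in>UNIV. axis i (L i h))) (at x)"
    by (intro has_derivative_sum bounded_linear.has_derivative[OF bl] assms)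
  also have "(\<lambda>z. \<Sum>i\<in>UNIV. axis i (F z $ i)) = F" by (rule ext) (rule eq[symmetric])
  also have "(\<lambda>h. \<Sum>i\<in>UNIV. axis i (L i h)) = (\<lambda>h. \<chi> i. L i h)"
    by (simp add: fun_eq_iff vec_eq_iff axis_def)
  finally show ?thesis .
qed

lemma series_map_holo_germ:
  assumes F: "series_map F a r" and F0: "F 0 = 0"
  shows "holo_germ F (\<lambda>v. linear_part a *v v)"
  unfolding holo_germ_def
proof (intro conjI allI impI F0 complex_linear_matrix)
  have r: "r > 0" and a: "\<And>i. mps_conv (a i) r"
    and ev: "\<And>z i. norm z \<le> r \<Longrightarrow> F z $ i = mps_eval (a i) z"
    using F by (auto simp: series_map_def)
  show "\<exists>r>0. holo_on F (ball 0 r)"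
  proof (intro exI conjI)
    show "holo_on F (ball 0 (r / 4))"
      unfolding holo_on_def
    proof
      fix x :: "complex^'a" assume x: "x \<in> ball 0 (r / 4)"
      have "\<forall>i. \<exists>L. (mps_eval (a i) has_derivative L) (at x) \<and> (\<forall>c v. L (c *s v) = c * L v)"
        using mps_eval_has_derivative[OF a, of x] x by (metis dist_0_norm mem_ball)
      then obtain L where L: "\<And>i. (mps_eval (a i) has_derivative (L i)) (at x)" "\<And>i c v. L i (c *s v) = c * L i v"
        by metis
      have "((\<lambda>z. F z $ i) has_derivative (L i)) (at x)" for i
        by (rule has_derivative_transform_within_open[OF L(1), of "ball 0 (r / 4)"]) (use x ev r in auto)
      from has_derivative_vecI[OF this]
      show "\<exists>L. (F has_derivative L) (at x) \<and> (\<forall>c v. L (c *s v) = c *s L v)"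
        by (intro exI[of _ "\<lambda>h. \<chi> i. L i h"] conjI) (auto simp: L(2) vec_eq_iff)
    qed
  qed (use r in auto)
  obtain C where C: "C \<ge> 0" "\<And>x y \<rho>. norm x \<le> \<rho> \<Longrightarrow> norm y \<le> \<rho> \<Longrightarrow> \<rho> \<le> r / 4 \<Longrightarrow>
     norm (F x - F y - linear_part a *v (x - y)) \<le> C * \<rho> * norm (x - y)"
    using series_map_nonlinear[OF F] by metis
  fix e :: real assume e: "e > 0"
  define d where "d = min (r / 4) (e / (C + 1))"
  have d: "d > 0" "d \<le> r / 4" "d \<le> e / (C + 1)"
    using r e C(1) min.cobounded1[of "r / 4" "e / (C + 1)"] min.cobounded2[of "r / 4" "e / (C + 1)"]
    unfolding d_def by auto
  have "C * d \<le> (C + 1) * (e / (C + 1))" using C(1) d by (intro mult_mono) auto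
  then have Cd: "C * d \<le> e" using C(1) by simp
  show "\<exists>d>0. \<forall>x y. norm x < d \<longrightarrow> norm y < d \<longrightarrow>
      norm (F x - F y - linear_part a *v (x - y)) \<le> e * norm (x - y)"
  proof (intro exI[of _ d] conjI allI impI d(1))
    fix x y :: "complex^'a" assume xy: "norm x < d" "norm y < d"
    have "norm (F x - F y - linear_part a *v (x - y)) \<le> C * d * norm (x - y)"
      using C(2)[of x d y] xy d(2) by simp
    also have "\<dots> \<le> e * norm (x - y)" by (rule mult_right_mono[OF Cd norm_ge_zero])
    finally show "norm (F x - F y - linear_part a *v (x - y)) \<le> e * norm (x - y)" .
  qed
qed

lemma holo_germ_has_derivative:
  assumes "holo_germ f L"
  shows "(f has_derivative L) (at 0)"
  unfolding has_derivative_at_alt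
proof (intro conjI allI impI)
  show "bounded_linear L" using assms by (simp add: holo_germ_def complex_linear_def)
  fix e :: real assume "e > 0"
  then obtain d where d: "d > 0" "\<And>x y. norm x < d \<Longrightarrow> norm y < d \<Longrightarrow>
        norm (f x - f y - L (x - y)) \<le> e * norm (x - y)"
    using assms unfolding holo_germ_def by meson
  then show "\<exists>d>0. \<forall>y. norm (y - 0) < d \<longrightarrow> norm (f y - f 0 - L (y - 0)) \<le> e * norm (y - 0)"
    using d(2)[of _ 0] by (intro exI[of _ d] conjI allI impI) auto
qed

lemma holo_germ_derivative_unique:
  assumes "holo_germ f L" "(f has_derivative M) (at 0)"
  shows "L = M"
  using has_derivative_unique[OF holo_germ_has_derivative[OF assms(1)] assms(2)] .

text \<open>A germ is Lipschitz near 0, so congruence modulo O(|z|^m) may be pushed through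
  it.\<close>

lemma holo_germ_vanishes_diff:
  assumes G: "holo_germ G L" and X: "vanishes 1 X" and Y: "vanishes 1 Y" and XY: "vanishes m (\<lambda>z. X z - Y z)"
  shows "vanishes m (\<lambda>z. G (X z) - G (Y z))"
proof -
  have L: "bounded_linear L" using G by (auto simp: holo_germ_def complex_linear_def)
  from G obtain d where d: "d > 0" "\<And>x y. norm x < d \<Longrightarrow> norm y < d \<Longrightarrow>
      norm (G x - G y - L (x - y)) \<le> 1 * norm (x - y)"
    unfolding holo_germ_def by (meson zero_less_one)
  from bounded_linear.nonneg_bounded[OF L] obtain K where K: "K \<ge> 0" "\<And>x. norm (L x) \<le> norm x * K" by auto
  obtain C where C: "C > 0" "\<forall>\<^sub>F z in nhds 0. norm (X z - Y z) \<le> C * norm z ^ m" using XY by (rule vanishesE)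
  have nb: "\<forall>\<^sub>F z in nhds (0::complex^'a). norm z < d" using d(1) by (rule eventually_nhds_0_ballI)
  have "\<forall>\<^sub>F z in nhds 0. norm (X z) < d" "\<forall>\<^sub>F z in nhds 0. norm (Y z) < d"
    using vanishes_tendsto[OF X] vanishes_tendsto[OF Y] nb by (auto simp: filterlim_iff)
  with C(2) have "\<forall>\<^sub>F z in nhds 0. norm (G (X z) - G (Y z)) \<le> ((K + 1) * C) * norm z ^ m"
  proof eventually_elim
    case (elim z)
    have "norm (G (X z) - G (Y z)) \<le> norm (L (X z - Y z)) + 1 * norm (X z - Y z)"
      using d(2)[OF elim(2,3)] norm_triangle_sub[of "G (X z) - G (Y z)" "L (X z - Y z)"] by linarith
    also have "\<dots> \<le> (K + 1) * norm (X z - Y z)" using K(2)[of "X z - Y z"] by (simp add: algebra_simps)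
    also have "\<dots> \<le> (K + 1) * (C * norm z ^ m)" using K elim by (intro mult_left_mono) auto
    finally show ?case by simp
  qed
  then show ?thesis by (rule vanishesI)
qed

lemma vanishes_ident: "vanishes 1 (\<lambda>z::complex^'n. z)"
  by (rule vanishesI[where C = 1]) auto

lemma vanishes_scale: "vanishes m f \<Longrightarrow> vanishes m (\<lambda>z. c *s f z)" for f :: "'a::real_normed_vector \<Rightarrow> complex^'n"
  using vanishes_bounded_linear[of "\<lambda>v. c *s v" m f] complex_linear_scale[of c]
  by (auto simp: complex_linear_def)

lemma has_derivative_of_vanishes:
  fixes g M :: "complex^'n \<Rightarrow> complex^'n"
  assumes M: "bounded_linear M" and g0: "g 0 = 0" and v: "vanishes 2 (\<lambda>z. g z - M z)"
  shows "(g has_derivative M) (at 0)"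
  unfolding has_derivative_at_alt
proof (intro conjI allI impI M)
  fix e :: real assume e: "e > 0"
  obtain C where C: "C > 0" "\<forall>\<^sub>F z in nhds 0. norm (g z - M z) \<le> C * norm z ^ 2" using v by (rule vanishesE)
  then obtain d where d: "d > 0" "\<And>z. norm z < d \<Longrightarrow> norm (g z - M z) \<le> C * norm z ^ 2"
    by (auto simp: eventually_nhds_metric)
  have "norm (g z - M z) \<le> e * norm z" if "norm z < min d (e / C)" for z
  proof -
    have "norm (g z - M z) \<le> (C * norm z) * norm z" using d(2)[of z] that by (simp add: power2_eq_square)
    also have "\<dots> \<le> (C * (e / C)) * norm z"
      using that C(1) by (intro mult_left_mono mult_right_mono) auto
    finally show ?thesis using C(1) by simp
  qed
  then show "\<exists>d>0. \<forall>y. norm (y - 0) < d \<longrightarrow> norm (g y - g 0 - M (y - 0)) \<le> e * norm (y - 0)"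
    using d(1) e C(1) g0 by (intro exI[of _ "min d (e / C)"]) auto
qed

text \<open>In the linearizing coordinate \<open>f k\<close> becomes E A_k D, where D and E are the
  derivatives of \<phi> and \<psi> at 0. These maps commute because the A_k do and D E = 1; applying
  \<phi> carries the identity back.\<close>

lemma sim_holo_linearizable_imp_commute:
  fixes f :: "nat \<Rightarrow> complex^'n \<Rightarrow> complex^'n"
  assumes lin: "sim_holo_linearizable f h"
    and f0: "\<And>k. k < h \<Longrightarrow> f k 0 = 0"
    and der: "\<And>k. k < h \<Longrightarrow> (f k has_derivative (\<lambda>v. A k *v v)) (at 0)"
    and comm: "A p ** A q = A q ** A p" and p: "p < h" and q: "q < h"
  shows "\<forall>\<^sub>F z in nhds 0. f p (f q z) = f q (f p z)"
proof -
  obtain \<phi> \<psi> where inv: "biholo_germ0_inv \<phi> \<psi>"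
    and B: "\<And>k. k < h \<Longrightarrow> \<exists>B. \<forall>\<^sub>F z in nhds 0. \<psi> (f k (\<phi> z)) = B *v z"
    using lin unfolding sim_holo_linearizable_def by blast
  obtain U V where UV: "\<phi> 0 = 0" "open U" "open V" "0 \<in> U" "\<phi> ` U = V" "holo_on \<phi> U" "holo_on \<psi> V"
    "\<And>z. z \<in> U \<Longrightarrow> \<psi> (\<phi> z) = z"
    using inv unfolding biholo_germ0_inv_def by blast
  have \<psi>0: "\<psi> 0 = 0" and V0: "0 \<in> V" and \<phi>\<psi>: "\<And>z. z \<in> V \<Longrightarrow> \<phi> (\<psi> z) = z" using UV by force+
  have evV: "\<forall>\<^sub>F z in nhds 0. z \<in> V" using UV(3) V0 by (metis eventually_nhds)
  have cont: "filterlim g (nhds 0) (nhds 0)" if "g 0 = 0" "continuous (at 0) g" for g :: "complex^'n \<Rightarrow> complex^'n"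
    using that tendsto_at_iff_tendsto_nhds[of g 0] by (simp add: isCont_def)
  have \<phi>c: "filterlim \<phi> (nhds 0) (nhds 0)"
    using cont[of \<phi>] UV(1) holo_on_continuous[OF UV(6,4)] by blast
  have \<psi>c: "filterlim \<psi> (nhds 0) (nhds 0)"
    using cont[of \<psi>] \<psi>0 holo_on_continuous[OF UV(7) V0] by blast
  have fc: "filterlim (f k) (nhds 0) (nhds 0)" if "k < h" for k
    using cont[of "f k"] f0[OF that] has_derivative_continuous[OF der[OF that]] by blast
  obtain D where D: "(\<phi> has_derivative D) (at 0)" using UV(4,6) by (auto simp: holo_on_def)
  obtain E where E: "(\<psi> has_derivative E) (at 0)" using V0 UV(7) by (auto simp: holo_on_def)
  have DE: "D (E v) = v" for v
  proof -
    have "((\<lambda>z. \<phi> (\<psi> z)) has_derivative (\<lambda>v. D (E v))) (at 0)"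
      using has_derivative_compose[OF E] D \<psi>0 by simp
    then have "((\<lambda>z. z) has_derivative (\<lambda>v. D (E v))) (at 0)"
      by (rule has_derivative_transform_within_open[OF _ UV(3) V0 \<phi>\<psi>])
    from has_derivative_unique[OF this has_derivative_ident] show ?thesis by metis
  qed
  define Bm where "Bm = (\<lambda>k. SOME B. \<forall>\<^sub>F z in nhds 0. \<psi> (f k (\<phi> z)) = B *v z)"
  have Bm: "\<forall>\<^sub>F z in nhds 0. \<psi> (f k (\<phi> z)) = Bm k *v z" if "k < h" for k
    unfolding Bm_def by (rule someI_ex[OF B[OF that]])
  have BA: "Bm k *v v = E (A k *v D v)" if k: "k < h" for k v
  proof -
    have "((\<lambda>z. \<psi> (f k (\<phi> z))) has_derivative (\<lambda>v. E (A k *v D v))) (at 0)"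
      using has_derivative_compose[OF has_derivative_compose[OF D, of "f k" "\<lambda>v. A k *v v"], of \<psi> E]
        der[OF k] E UV(1) f0[OF k] by simp
    moreover obtain S where "open S" "0 \<in> S" "\<And>z. z \<in> S \<Longrightarrow> \<psi> (f k (\<phi> z)) = Bm k *v z"
      using Bm[OF k] unfolding eventually_nhds by auto
    ultimately have "((\<lambda>z. Bm k *v z) has_derivative (\<lambda>v. E (A k *v D v))) (at 0)"
      by (rule has_derivative_transform_within_open)
    moreover have "((\<lambda>z. Bm k *v z) has_derivative (\<lambda>z. Bm k *v z)) (at 0)"
      using complex_linear_matrix[of "Bm k"] by (auto simp: complex_linear_def intro: bounded_linear_imp_has_derivative)
    ultimately show ?thesis using has_derivative_unique by metis
  qed
  have BB: "Bm p *v (Bm q *v v) = Bm q *v (Bm p *v v)" for v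
    using p q comm by (simp add: BA DE matrix_vector_mul_assoc)
  have fk: "\<forall>\<^sub>F z in nhds 0. \<psi> (f k z) = Bm k *v \<psi> z" if k: "k < h" for k
  proof -
    have "\<forall>\<^sub>F z in nhds 0. \<psi> (f k (\<phi> (\<psi> z))) = Bm k *v \<psi> z"
      using Bm[OF k] \<psi>c by (auto simp: filterlim_iff)
    with evV show ?thesis by eventually_elim (simp add: \<phi>\<psi>)
  qed
  have fk2: "\<forall>\<^sub>F z in nhds 0. \<psi> (f k (f l z)) = Bm k *v \<psi> (f l z)" if "k < h" "l < h" for k l
    using fk[OF that(1)] fc[OF that(2)] by (auto simp: filterlim_iff)
  have fkV: "\<forall>\<^sub>F z in nhds 0. f k (f l z) \<in> V" if "k < h" "l < h" for k l
  proof -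
    have "\<forall>\<^sub>F z in nhds 0. f k z \<in> V" using evV fc[OF that(1)] by (auto simp: filterlim_iff)
    then show ?thesis using fc[OF that(2)] by (auto simp: filterlim_iff)
  qed
  show ?thesis
    using fk[OF p] fk[OF q] fk2[OF p q] fk2[OF q p] fkV[OF p q] fkV[OF q p]
  proof eventually_elim
    case (elim z)
    have "\<psi> (f p (f q z)) = \<psi> (f q (f p z))" using elim BB by simp
    then show ?case using elim \<phi>\<psi> by metis
  qed
qed

section \<open>Trees and small divisors\<close>

text \<open>Two children are explicit, so every inner node has at least two: it stands for a term of
  degree at least 2 of some germ, with the subtrees substituted for the variables.\<close>

datatype 'n tree = Lf 'n | Nd "'n tree" "'n tree" "'n tree list"

primrec leaves :: "'n tree \<Rightarrow> 'n list" where
  "leaves (Lf i) = [i]"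
| "leaves (Nd a b ts) = leaves a @ leaves b @ concat (map leaves ts)"

text \<open>One entry per inner node, namely the word of the leaves below it. Its exponent
  determines the small divisor introduced at that node.\<close>

primrec nodes :: "'n tree \<Rightarrow> 'n list list" where
  "nodes (Lf i) = []"
| "nodes (Nd a b ts) =
     (leaves a @ leaves b @ concat (map leaves ts)) # nodes a @ nodes b @ concat (map nodes ts)"

abbreviation tsize :: "'n tree \<Rightarrow> nat" where
  "tsize t \<equiv> length (leaves t)"

lemma leaves_Nd: "leaves (Nd a b ts) = concat (map leaves (a # b # ts))"
  by simp

lemma nodes_Nd: "nodes (Nd a b ts) = leaves (Nd a b ts) # concat (map nodes (a # b # ts))"
  by simp

lemma tree_induct [case_names Lf Nd]:
  assumes "\<And>i. P (Lf i)" "\<And>a b ts. (\<And>t. t \<in> set (a # b # ts) \<Longrightarrow> P t) \<Longrightarrow> P (Nd a b ts)"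
  shows "P t"
  by (induction t) (auto intro!: assms)

lemma tsize_pos: "tsize t \<ge> 1"
  by (induction t) auto

lemma tsize_Nd: "tsize (Nd a b ts) = sum_list (map tsize (a # b # ts))"
  by (simp add: length_concat comp_def)

lemma tsize_Nd_ge2: "tsize (Nd a b ts) \<ge> 2"
  using tsize_pos[of a] tsize_pos[of b] by simp

lemma tsize_child_less:
  assumes "t \<in> set (a # b # ts)"
  shows "tsize t < tsize (Nd a b ts)"
proof -
  have "t = a \<or> t = b \<or> t \<in> set ts" using assms by auto
  moreover have "tsize t \<le> sum_list (map tsize ts)" if "t \<in> set ts"
    using that by (intro member_le_sum_list) auto
  ultimately show ?thesis using tsize_pos[of a] tsize_pos[of b]
    unfolding tsize_Nd by auto
qed

lemma count_list_child_le:
  assumes "t \<in> set ts"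
  shows "count_list (leaves t) i \<le> count_list (concat (map leaves ts)) i"
  using assms by (induction ts) auto

lemma nodes_subset:
  assumes "v \<in> set (nodes t)"
  shows "count_list v i \<le> count_list (leaves t) i \<and> length v \<le> tsize t \<and> 2 \<le> length v"
  using assms
proof (induction t rule: tree_induct)
  case (Nd a b ts)
  from Nd.prems consider "v = leaves (Nd a b ts)" | t where "t \<in> set (a # b # ts)" "v \<in> set (nodes t)"
    unfolding nodes_Nd by auto
  then show ?case
  proof cases
    case 1
    then show ?thesis using tsize_Nd_ge2[of a b ts] by simp
  next
    case (2 t)
    with Nd.IH[OF 2] count_list_child_le[OF 2(1), of i] tsize_child_less[OF 2(1)]
    show ?thesis unfolding leaves_Nd by (meson le_trans less_imp_le)
  qed
qed auto

text \<open>The alternatives for the children of a node in the counting argument: none, exactly one,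
  or at least two of them are large.\<close>
lemma truncated_sum_cases:
  fixes s :: "'a \<Rightarrow> real"
  assumes s: "\<And>t. s t \<ge> 0"
  defines "G \<equiv> \<lambda>t. max 0 (s t - 1)"
  shows "(\<forall>t\<in>set ts. G t = 0) \<or> (\<exists>us t vs. ts = us @ t # vs \<and> (\<forall>u\<in>set us \<union> set vs. G u = 0))
     \<or> sum_list (map G ts) \<le> sum_list (map s ts) - 2"
proof (induction ts)
  case (Cons x ts)
  have x: "G x \<le> s x" "G x \<ge> 0" "G x = 0 \<or> G x = s x - 1" using s[of x] by (auto simp: G_def)
  from Cons consider "\<forall>t\<in>set ts. G t = 0"
    | us t vs where "ts = us @ t # vs" "\<forall>u\<in>set us \<union> set vs. G u = 0"
    | "sum_list (map G ts) \<le> sum_list (map s ts) - 2" by blast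
  then show ?case
  proof cases
    case 1
    then show ?thesis by (intro disjI2 disjI1 exI[of _ "[]"] exI[of _ x] exI[of _ ts]) auto
  next
    case (2 us t vs)
    show ?thesis
    proof (cases "G x = 0 \<or> G t = 0")
      case True
      then show ?thesis
      proof
        assume "G x = 0"
        then show ?thesis using 2 by (intro disjI2 disjI1 exI[of _ "x # us"] exI[of _ t] exI[of _ vs]) auto
      next
        assume "G t = 0"
        then show ?thesis using 2 by (intro disjI2 disjI1 exI[of _ "[]"] exI[of _ x] exI[of _ ts]) auto
      qed
    next
      case False
      have z: "sum_list (map G us) = 0" "sum_list (map G vs) = 0"
        using 2(2) by (auto intro!: sum_list_0 simp: map_idI cong: map_cong)
      have p: "sum_list (map s us) \<ge> 0" "sum_list (map s vs) \<ge> 0"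
        by (auto intro!: sum_list_nonneg s)
      have "G x = s x - 1" "G t = s t - 1" using False by (auto simp: G_def max_def split: if_splits)
      then show ?thesis using z p 2(1) by simp
    qed
  next
    case 3
    then show ?thesis using x by simp
  qed
qed auto

lemma sum_list_map_eq_0: "\<forall>t\<in>set ts. g t = 0 \<Longrightarrow> sum_list (map g ts) = (0::real)"
  by (induction ts) auto

text \<open>Brjuno's counting argument: once a bad node occurs, the next bad node below it on the same
  branch has at least \<open>m\<close> leaves less, which is the second statement of the induction.\<close>
lemma bad_nodes_count:
  fixes bad :: "'n list \<Rightarrow> bool"
  assumes m: "m > 0" and big: "\<And>v. bad v \<Longrightarrow> m \<le> length v"
    and gap: "\<And>v w. bad v \<Longrightarrow> bad w \<Longrightarrow> (\<And>i. count_list v i \<le> count_list w i) \<Longrightarrow>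
       length v < length w \<Longrightarrow> length v + m \<le> length w"
  shows "real (length (filter bad (nodes t))) \<le> max 0 (2 * real (tsize t) / real m - 1)"
proof -
  define N where "N = (\<lambda>t. real (length (filter bad (nodes t))))"
  \<comment> \<open>\<open>s\<close> is a budget for bad nodes that is additive over the children of
    a node; the claimed bound \<open>G\<close> keeps 1 in reserve.\<close>
  define s where "s = (\<lambda>t::'n tree. 2 * real (tsize t) / real m)"
  define G where "G = (\<lambda>t. max 0 (s t - 1))"
  have s0: "s t \<ge> 0" for t by (simp add: s_def)
  have N_Nd: "N (Nd a b ts) = (if bad (leaves (Nd a b ts)) then 1 else 0) + sum_list (map N (a # b # ts))" for a b ts
  proof -
    have "real (length (filter bad (concat (map nodes us)))) = sum_list (map N us)" for us
      by (induction us) (auto simp: N_def)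
    then show ?thesis unfolding N_def nodes_Nd by simp
  qed
  have s_Nd: "s (Nd a b ts) = sum_list (map s (a # b # ts))" for a b ts
  proof -
    have "s (Nd a b ts) = 2 / real m * real (sum_list (map tsize (a # b # ts)))"
      by (simp only: s_def tsize_Nd) simp
    also have "real (sum_list (map tsize us)) = sum_list (map (\<lambda>t. real (tsize t)) us)" for us :: "'n tree list"
      by (induction us) auto
    also have "2 / real m * sum_list (map (\<lambda>t. real (tsize t)) us) = sum_list (map s us)" for us :: "'n tree list"
      by (induction us) (auto simp: s_def algebra_simps add_divide_distrib)
    finally show ?thesis .
  qed
  have "N t \<le> G t \<and> (\<forall>L. tsize t \<le> L \<longrightarrow> m \<le> L \<longrightarrow> (\<forall>v\<in>set (nodes t). bad v \<longrightarrow> length v + m \<le> L) \<longrightarrow>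
      1 + N t \<le> 2 * real L / real m - 1)" (is "?P t")
  proof (induction t rule: tree_induct)
    case (Lf i)
    have "1 + N (Lf i) \<le> 2 * real L / real m - 1" if "m \<le> L" for L
    proof -
      have "1 \<le> real L / real m" using that m by simp
      then show ?thesis by (simp add: N_def)
    qed
    moreover have "N (Lf i) \<le> G (Lf i)" by (simp add: N_def G_def)
    ultimately show ?case by blast
  next
    case (Nd a b ts)
    let ?T = "Nd a b ts" and ?us = "a # b # ts"
    have IH1: "N t \<le> G t" if "t \<in> set ?us" for t using Nd.IH[OF that] by blast
    have IH2: "1 + N t \<le> 2 * real L / real m - 1" if "t \<in> set ?us" "tsize t \<le> L" "m \<le> L"
      "\<And>v. v \<in> set (nodes t) \<Longrightarrow> bad v \<Longrightarrow> length v + m \<le> L" for t L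
      using Nd.IH[OF that(1)] that by blast
    have sumNG: "sum_list (map N us) \<le> sum_list (map G us)" if "set us \<subseteq> set ?us" for us
      using that IH1 by (intro sum_list_mono) auto
    have sub: "v \<in> set (nodes ?T)" if "t \<in> set ?us" "v \<in> set (nodes t)" for t v
      using that unfolding nodes_Nd by auto
    \<comment> \<open>With no large child there is no bad node below, and L >= m suffices. With
      exactly one large child, its own second statement applies with the same \<open>L\<close>. Two
      large children lose 2 from the budget through their reserves, which pays for one further bad
      node and a new reserve.\<close>
    have key: "1 + sum_list (map N ?us) \<le> 2 * real L / real m - 1"
      if L: "tsize ?T \<le> L" "m \<le> L" and bd: "\<And>t v. t \<in> set ?us \<Longrightarrow> v \<in> set (nodes t) \<Longrightarrow> bad v \<Longrightarrow> length v + m \<le> L" for L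
    proof -
      have one: "1 \<le> real L / real m" using L(2) m by simp
      consider "\<forall>t\<in>set ?us. G t = 0"
        | us t vs where "?us = us @ t # vs" "\<forall>u\<in>set us \<union> set vs. G u = 0"
        | "sum_list (map G ?us) \<le> sum_list (map s ?us) - 2"
        using truncated_sum_cases[of s ?us, OF s0] unfolding G_def by blast
      then show ?thesis
      proof cases
        case 1
        then have "sum_list (map G ?us) = 0" by (rule sum_list_map_eq_0)
        then have "sum_list (map N ?us) \<le> 0" using sumNG[OF order_refl[of "set ?us"]] by simp
        then show ?thesis using one by linarith
      next
        case (2 us t vs)
        then have "sum_list (map G us) = 0" "sum_list (map G vs) = 0"
          by (auto intro: sum_list_map_eq_0)
        moreover have "set us \<subseteq> set ?us" "set vs \<subseteq> set ?us" "t \<in> set ?us" using 2(1) by auto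
        ultimately have "sum_list (map N ?us) \<le> N t" using sumNG[of us] sumNG[of vs] unfolding 2(1) by simp
        moreover have "1 + N t \<le> 2 * real L / real m - 1"
          using tsize_child_less[OF \<open>t \<in> set ?us\<close>] L bd[OF \<open>t \<in> set ?us\<close>] by (intro IH2 \<open>t \<in> set ?us\<close>) auto
        ultimately show ?thesis by linarith
      next
        case 3
        have "s ?T \<le> 2 * real L / real m" using L(1) m unfolding s_def by (intro divide_right_mono) auto
        then show ?thesis using sumNG[OF order_refl[of "set ?us"]] 3 unfolding s_Nd[symmetric] by linarith
      qed
    qed
    have A: "N ?T \<le> G ?T"
    proof (cases "bad (leaves ?T)")
      case True
      have "1 + sum_list (map N ?us) \<le> 2 * real (tsize ?T) / real m - 1"
      proof (rule key)
        show "m \<le> tsize ?T" using big[OF True] .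
        fix t v assume t: "t \<in> set ?us" "v \<in> set (nodes t)" "bad v"
        have "length v < tsize ?T" using nodes_subset[OF t(2)] tsize_child_less[OF t(1)] by (meson le_less_trans)
        moreover have "count_list v i \<le> count_list (leaves ?T) i" for i
          using nodes_subset[OF sub[OF t(1,2)], of i] by blast
        ultimately show "length v + m \<le> tsize ?T" by (intro gap t True)
      qed simp
      then have "N ?T \<le> s ?T - 1" unfolding N_Nd s_def using True by simp
      then show ?thesis by (simp add: G_def)
    next
      case False
      have "N ?T \<le> sum_list (map G ?us)" using sumNG[OF order_refl[of "set ?us"]] False by (simp only: N_Nd) simp
      also consider "\<forall>t\<in>set ?us. G t = 0"
        | us t vs where "?us = us @ t # vs" "\<forall>u\<in>set us \<union> set vs. G u = 0"
        | "sum_list (map G ?us) \<le> sum_list (map s ?us) - 2"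
        using truncated_sum_cases[of s ?us, OF s0] unfolding G_def by blast
      then have "sum_list (map G ?us) \<le> G ?T"
      proof cases
        case 1
        then have "sum_list (map G ?us) = 0" by (rule sum_list_map_eq_0)
        then show ?thesis by (simp add: G_def)
      next
        case (2 us t vs)
        then have "sum_list (map G us) = 0" "sum_list (map G vs) = 0"
          by (auto intro: sum_list_map_eq_0)
        then have "sum_list (map G ?us) = G t" unfolding 2(1) by simp
        moreover have "t \<in> set ?us" using 2(1) by auto
        from tsize_child_less[OF this] have "s t \<le> s ?T" unfolding s_def by (intro divide_right_mono) auto
        ultimately show ?thesis by (auto simp: G_def)
      next
        case 3
        then show ?thesis unfolding s_Nd[symmetric] G_def by linarith
      qed
      finally show ?thesis .
    qed
    \<comment> \<open>Either \<open>L\<close> exceeds the size of the tree by m, which enlarges the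
      budget by 2, or the root is not bad and the claim reduces to the children.\<close>
    have B: "1 + N ?T \<le> 2 * real L / real m - 1"
      if L: "tsize ?T \<le> L" "m \<le> L" and bd: "\<And>v. v \<in> set (nodes ?T) \<Longrightarrow> bad v \<Longrightarrow> length v + m \<le> L" for L
    proof (cases "tsize ?T + m \<le> L")
      case True
      then have "real (tsize ?T) / real m + 1 \<le> real L / real m"
        using m divide_right_mono[of "real (tsize ?T + m)" "real L" "real m"]
        by (simp only: of_nat_add add_divide_distrib of_nat_le_iff) simp
      moreover have "1 \<le> real L / real m" using L(2) m by simp
      ultimately have "max 0 (2 * (real (tsize ?T) / real m) - 1) \<le> 2 * (real L / real m) - 2" by linarith
      then show ?thesis using A unfolding G_def s_def times_divide_eq_right by linarith
    next
      case False
      then have "\<not> bad (leaves ?T)" using bd[of "leaves ?T"] unfolding nodes_Nd by auto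
      then have "N ?T = sum_list (map N ?us)" by (simp only: N_Nd) simp
      moreover have "1 + sum_list (map N ?us) \<le> 2 * real L / real m - 1"
        by (rule key[OF L]) (use bd sub in blast)
      ultimately show ?thesis by simp
    qed
    show ?case using A B by blast
  qed
  then show ?thesis by (simp add: N_def G_def s_def)
qed

text \<open>Each inner node joins at least two subtrees and so reduces their number by at least
  one.\<close>

lemma length_nodes_less: "length (nodes t) < tsize t"
proof (induction t rule: tree_induct)
  case (Nd a b ts)
  have "length (concat (map nodes us)) + length us \<le> length (concat (map leaves us))" if "set us \<subseteq> set (a # b # ts)" for us
    using that
  proof (induction us)
    case (Cons u us)
    have "length (nodes u) < tsize u" using Nd[of u] Cons.prems by auto
    then show ?case using Cons by simp
  qed auto
  from this[of "a # b # ts"] show ?case unfolding nodes_Nd leaves_Nd by simp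
qed auto

text \<open>The terms log(1/\<omega>) are negative where \<omega> > 1. By monotonicity they stay
  positive once one is positive, so passing to positive parts alters only the finitely many terms
  before that index.\<close>

lemma brjuno_positive_part_bounded:
  fixes x w :: "nat \<Rightarrow> real"
  assumes w: "\<And>n. w n \<ge> 0" and x: "mono x" and C: "\<And>N. (\<Sum>n<N. w n * x n) \<le> C"
  obtains C' where "C' \<ge> 0" "\<And>N. (\<Sum>n<N. w n * max 0 (x n)) \<le> C'"
proof (cases "\<exists>n. x n > 0")
  case True
  then obtain n0 where n0: "x n0 > 0" by auto
  define D where "D = (\<Sum>n<n0. w n * \<bar>x n\<bar>)"
  have "(\<Sum>n<N. w n * max 0 (x n)) \<le> C + D" for N
  proof -
    have "w n * max 0 (x n) \<le> w n * x n + (if n < n0 then w n * \<bar>x n\<bar> else 0)" for n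
    proof (cases "n < n0")
      case False
      then have "x n > 0" using n0 monoD[OF x, of n0 n] by simp
      then show ?thesis using False by simp
    next
      case True
      have "w n * max 0 (x n) \<le> w n * (x n + \<bar>x n\<bar>)" by (rule mult_left_mono[OF _ w]) auto
      then show ?thesis using True by (simp add: distrib_left)
    qed
    then have "(\<Sum>n<N. w n * max 0 (x n)) \<le> (\<Sum>n<N. w n * x n + (if n < n0 then w n * \<bar>x n\<bar> else 0))"
      by (intro sum_mono)
    also have "\<dots> = (\<Sum>n<N. w n * x n) + (\<Sum>n\<in>{..<N} \<inter> {..<n0}. w n * \<bar>x n\<bar>)"
      by (simp add: sum.distrib sum.If_cases lessThan_def)
    also have "(\<Sum>n\<in>{..<N} \<inter> {..<n0}. w n * \<bar>x n\<bar>) \<le> D"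
      unfolding D_def by (intro sum_mono2) (auto simp: w)
    finally show ?thesis using C[of N] by linarith
  qed
  then have "\<And>N. (\<Sum>n<N. w n * max 0 (x n)) \<le> max 0 (C + D)" by (meson le_max_iff_disj)
  then show thesis using that[of "max 0 (C + D)"] by auto
next
  case False
  then have "max 0 (x n) = 0" for n by (meson max.absorb1 not_le)
  then show thesis using that[of 0] by simp
qed

text \<open>Here \<open>d j v\<close> plays the part of the largest divisor among the germs in
  component j, and a node costs the inverse of the minimum over j. Level i collects the nodes whose
  minimum lies below \<theta> min(1, \<omega>(p_(i+1))). The gap hypothesis allows at most 2 n |t| /
  p_(i+1) of them in a tree with |t| leaves, and weighting the levels by the increments of
  log(1/\<omega>) reproduces the Brjuno series.\<close>

lemma small_divisor_product_bound:
  fixes d :: "'n::finite \<Rightarrow> 'n list \<Rightarrow> real" and om :: "nat \<Rightarrow> real" and p :: "nat \<Rightarrow> nat"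
  assumes p: "strict_mono p" "p 0 = 1" and \<theta>: "0 < \<theta>" "\<theta> \<le> 1"
    and om_pos: "\<And>m. 2 \<le> m \<Longrightarrow> om m > 0"
    and om_anti: "\<And>m m'. 2 \<le> m \<Longrightarrow> m \<le> m' \<Longrightarrow> om m' \<le> om m"
    and d_low: "\<And>j v. 2 \<le> length v \<Longrightarrow> om (length v) \<le> d j v"
    and gap: "\<And>j v w m. 2 \<le> length v \<Longrightarrow> 2 \<le> length w \<Longrightarrow> 2 \<le> m \<Longrightarrow>
       d j v < \<theta> * min 1 (om m) \<Longrightarrow> d j w < \<theta> * min 1 (om m) \<Longrightarrow>
       (\<And>i. count_list v i \<le> count_list w i) \<Longrightarrow> length v < length w \<Longrightarrow> length v + m \<le> length w"
    and brj: "\<And>N. (\<Sum>\<nu><N. 1 / real (p \<nu>) * ln (1 / om (p (Suc \<nu>)))) \<le> C"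
  obtains K where "K \<ge> 1" "\<And>t. (\<Prod>v\<leftarrow>nodes t. 1 / Min (range (\<lambda>j. d j v))) \<le> K ^ tsize t"
proof -
  define e where "e = (\<lambda>v. Min (range (\<lambda>j. d j v)))"
  define W where "W = (\<lambda>i. min 1 (om (p (Suc i))))"
  define l where "l = (\<lambda>i. - ln (W i))"
  have p2: "p (Suc i) \<ge> i + 2" for i
  proof (induction i)
    case 0
    show ?case using strict_monoD[OF p(1), of 0 1] p(2) by simp
  next
    case (Suc i)
    then show ?case using strict_monoD[OF p(1), of "Suc i" "Suc (Suc i)"] by simp
  qed
  then have p2': "p (Suc i) \<ge> 2" for i using le_trans[OF _ p2[of i]] by simp
  have pmono: "p i \<le> p j" if "i \<le> j" for i j using strict_mono_mono[OF p(1)] that monoD by blast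
  have ppos: "p i > 0" for i using pmono[of 0 i] p(2) by simp
  have W: "0 < W i" "W i \<le> 1" for i using om_pos[OF p2'] by (auto simp: W_def)
  have W_anti: "W j \<le> W i" if "i \<le> j" for i j
    using om_anti[OF p2' pmono[of "Suc i" "Suc j"]] that unfolding W_def by (simp add: min_def)
  have l0: "l i \<ge> 0" for i using W[of i] by (simp add: l_def)
  have l_mono: "l i \<le> l j" if "i \<le> j" for i j using W_anti[OF that] W(1) by (simp add: l_def)
  have l_eq: "l i = max 0 (ln (1 / om (p (Suc i))))" for i
    using om_pos[OF p2'[of i]] by (auto simp: l_def W_def ln_div min_def max_def)
  obtain C' where C': "C' \<ge> 0" "\<And>N. (\<Sum>n<N. 1 / real (p n) * l n) \<le> C'"
  proof (rule brjuno_positive_part_bounded[of "\<lambda>n. 1 / real (p n)" "\<lambda>n. ln (1 / om (p (Suc n)))" C])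
    show "mono (\<lambda>n. ln (1 / om (p (Suc n))))"
    proof (rule monoI)
      fix i j :: nat assume "i \<le> j"
      then have "om (p (Suc j)) \<le> om (p (Suc i))" by (intro om_anti p2' pmono) simp
      then show "ln (1 / om (p (Suc i))) \<le> ln (1 / om (p (Suc j)))"
        using om_pos[OF p2'[of i]] om_pos[OF p2'[of j]] by (simp add: ln_div)
    qed
  qed (use brj that in \<open>auto simp: l_eq\<close>)
  have e_le: "e v \<le> d j v" for v j unfolding e_def by (intro Min_le) auto
  have e_ex: "\<exists>j. e v = d j v" for v
  proof -
    have "e v \<in> range (\<lambda>j. d j v)" unfolding e_def by (rule Min_in) auto
    then show ?thesis by blast
  qed
  have e_low: "om (length v) \<le> e v" "e v > 0" if "2 \<le> length v" for v
    using e_ex[of v] d_low[OF that] om_pos[OF that] by (metis, metis less_le_trans)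
  define bad where "bad = (\<lambda>i j v. 2 \<le> length v \<and> d j v < \<theta> * W i)"
  \<comment> \<open>The counting lemma is used with m = p_(i+1). A shorter word cannot be bad at
    level i, since its divisor is at least \<omega> of its length and \<omega> is antitone.\<close>
  have bad_count: "real (length (filter (bad i j) (nodes t))) \<le> 2 * real (tsize t) / real (p (Suc i))" for i j t
  proof -
    have "real (length (filter (bad i j) (nodes t))) \<le> max 0 (2 * real (tsize t) / real (p (Suc i)) - 1)"
    proof (rule bad_nodes_count)
      show "0 < p (Suc i)" by (rule ppos)
      show "p (Suc i) \<le> length v" if "bad i j v" for v
      proof (rule ccontr)
        assume "\<not> p (Suc i) \<le> length v"
        then have "om (p (Suc i)) \<le> om (length v)" using that by (intro om_anti) (auto simp: bad_def)
        also have "\<dots> \<le> d j v" using that by (intro d_low) (auto simp: bad_def)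
        also have "\<dots> < \<theta> * W i" using that by (simp add: bad_def)
        also have "\<dots> \<le> W i" using \<theta> W(1)[of i] by simp
        also have "\<dots> \<le> om (p (Suc i))" by (simp add: W_def)
        finally show False by simp
      qed
      show "length v + p (Suc i) \<le> length w" if "bad i j v" "bad i j w"
        "\<And>i. count_list v i \<le> count_list w i" "length v < length w" for v w
        using that by (intro gap[of v w "p (Suc i)" j] p2') (auto simp: bad_def W_def)
    qed
    also have "\<dots> \<le> 2 * real (tsize t) / real (p (Suc i))" by simp
    finally show ?thesis .
  qed
  define n where "n = real CARD('n)"
  \<comment> \<open>A node with small minimum is bad for at least one component; summing over the
    components costs the factor n.\<close>
  have small_count: "(\<Sum>v\<leftarrow>nodes t. if e v < \<theta> * W i then 1 else 0) \<le> 2 * n * real (tsize t) / real (p (Suc i))" for i t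
  proof -
    have nodes2: "2 \<le> length v" if "v \<in> set (nodes t)" for v using nodes_subset[OF that] by blast
    have le: "(if e v < \<theta> * W i then 1 else 0) \<le> (\<Sum>j\<in>UNIV. if bad i j v then 1 else (0::real))" if vn: "v \<in> set (nodes t)" for v
    proof (cases "e v < \<theta> * W i")
      case True
      then obtain j where "bad i j v" using e_ex[of v] nodes2[OF vn] by (auto simp: bad_def)
      then have "(1::real) \<le> (\<Sum>j\<in>{j. bad i j v}. 1)"
        by (simp add: Suc_le_eq card_gt_0_iff) blast
      then show ?thesis using True by (simp add: sum.If_cases)
    qed (auto intro: sum_nonneg)
    have "(\<Sum>v\<leftarrow>nodes t. if e v < \<theta> * W i then 1 else 0) \<le> (\<Sum>v\<leftarrow>nodes t. \<Sum>j\<in>UNIV. if bad i j v then 1 else (0::real))"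
      by (intro sum_list_mono le)
    also have "\<dots> = (\<Sum>j\<in>UNIV. real (length (filter (bad i j) vs)))" if "vs = nodes t" for vs
      unfolding that[symmetric] by (induction vs) (auto simp: sum.distrib[symmetric] intro!: sum.cong)
    also have "(\<Sum>j\<in>UNIV. real (length (filter (bad i j) (nodes t)))) \<le> (\<Sum>j\<in>(UNIV::'n set). 2 * real (tsize t) / real (p (Suc i)))"
      by (intro sum_mono bad_count)
    finally show ?thesis by (simp add: n_def mult_ac)
  qed
  text \<open>Layer cake over the thresholds \<open>\<theta> * W i\<close>.\<close>
  have layer: "- ln (e v) \<le> - ln \<theta> + l 0 + (\<Sum>i<M. (if e v < \<theta> * W i then 1 else 0) * (l (Suc i) - l i))"
    if v: "2 \<le> length v" and "\<theta> * W M \<le> e v" for v M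
    using that(2)
  proof (induction M)
    case 0
    have "ln (\<theta> * W 0) \<le> ln (e v)" using 0 e_low(2)[OF v] \<theta> W(1)[of 0] by simp
    then show ?case using \<theta> W(1)[of 0] by (simp add: ln_mult l_def)
  next
    case (Suc M)
    show ?case
    proof (cases "\<theta> * W M \<le> e v")
      case True
      then show ?thesis using Suc.IH l_mono[of M "Suc M"] by simp
    next
      case False
      have small: "e v < \<theta> * W i" if "i \<le> M" for i
        using False W_anti[OF that] \<theta> by (meson less_le_trans mult_left_mono not_le less_imp_le)
      have "(\<Sum>i<Suc M. (if e v < \<theta> * W i then 1 else 0) * (l (Suc i) - l i)) = (\<Sum>i<Suc M. l (Suc i) - l i)"
        using small by (intro sum.cong) auto
      also have "\<dots> = l (Suc M) - l 0" by (rule sum_lessThan_telescope)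
      finally have S: "(\<Sum>i<Suc M. (if e v < \<theta> * W i then 1 else 0) * (l (Suc i) - l i)) = l (Suc M) - l 0" .
      have "ln (\<theta> * W (Suc M)) \<le> ln (e v)" using Suc.prems e_low(2)[OF v] \<theta> W(1)[of "Suc M"] by simp
      then show ?thesis unfolding S using \<theta> W(1)[of "Suc M"] by (simp add: ln_mult l_def)
    qed
  qed
  define K0 where "K0 = - ln \<theta> + l 0"
  define K1 where "K1 = K0 + 2 * n * C'"
  have "ln \<theta> \<le> 0" using \<theta> by simp
  then have K0: "K0 \<ge> 0" using l0[of 0] by (simp add: K0_def)
  have "(\<Sum>v\<leftarrow>nodes t. - ln (e v)) \<le> K1 * real (tsize t)" for t
  proof -
    \<comment> \<open>\<open>p (Suc M)\<close> exceeds the number of leaves and hence the length of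
      every node, so no divisor falls below the threshold of level \<open>M\<close> and finitely
      many layers suffice.\<close>
    define M where "M = tsize t"
    have nodes2: "2 \<le> length v" "length v \<le> tsize t" if "v \<in> set (nodes t)" for v using nodes_subset[OF that] by auto
    have top: "\<theta> * W M \<le> e v" if "v \<in> set (nodes t)" for v
    proof -
      have "length v \<le> p (Suc M)" using nodes2(2)[OF that] p2[of M] by (simp add: M_def)
      then have "om (p (Suc M)) \<le> e v" using om_anti[OF nodes2(1)[OF that]] e_low(1)[OF nodes2(1)[OF that]] by (meson order_trans)
      then have "W M \<le> e v" by (simp add: W_def)
      moreover have "\<theta> * W M \<le> W M" using \<theta> W(1)[of M] by simp
      ultimately show ?thesis by linarith
    qed
    have "(\<Sum>v\<leftarrow>nodes t. - ln (e v)) \<le> (\<Sum>v\<leftarrow>nodes t. K0 + (\<Sum>i<M. (if e v < \<theta> * W i then 1 else 0) * (l (Suc i) - l i)))"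
      unfolding K0_def by (intro sum_list_mono layer nodes2 top)
    also have "(\<Sum>v\<leftarrow>vs. K0 + (\<Sum>i<M. (if e v < \<theta> * W i then 1 else 0) * (l (Suc i) - l i)))
      = K0 * real (length vs) + (\<Sum>i<M. (\<Sum>v\<leftarrow>vs. if e v < \<theta> * W i then 1 else 0) * (l (Suc i) - l i))" for vs
      by (induction vs) (auto simp: algebra_simps sum.distrib sum_subtractf)
    also have "K0 * real (length (nodes t)) \<le> K0 * real (tsize t)"
      using length_nodes_less[of t] K0 by (intro mult_left_mono) auto
    \<comment> \<open>The count at level i carries 1/p_(i+1), while \<open>l (Suc i)\<close> is the
      positive part of log(1/\<omega>(p_(i+2))): the product is the Brjuno term with index i + 1, so
      the shift of indices in the Brjuno condition is met exactly.\<close>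
    also have "(\<Sum>i<M. (\<Sum>v\<leftarrow>nodes t. if e v < \<theta> * W i then 1 else 0) * (l (Suc i) - l i))
      \<le> (\<Sum>i<M. (2 * n * real (tsize t) / real (p (Suc i))) * l (Suc i))"
    proof (intro sum_mono mult_mono small_count)
      fix i
      show "l (Suc i) - l i \<le> l (Suc i)" "0 \<le> l (Suc i) - l i" using l0[of i] l_mono[of i "Suc i"] by auto
    qed (simp add: n_def)
    also have "\<dots> = 2 * n * real (tsize t) * (\<Sum>i<M. 1 / real (p (Suc i)) * l (Suc i))"
      by (simp add: sum_distrib_left mult_ac)
    also have "\<dots> \<le> 2 * n * real (tsize t) * C'"
    proof (rule mult_left_mono)
      have "(\<Sum>i<M. 1 / real (p (Suc i)) * l (Suc i)) = (\<Sum>n<Suc M. 1 / real (p n) * l n) - 1 / real (p 0) * l 0"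
        by (subst sum.lessThan_Suc_shift) simp
      also have "\<dots> \<le> C'" using C'(2)[of "Suc M"] l0[of 0] p(2) by simp
      finally show "(\<Sum>i<M. 1 / real (p (Suc i)) * l (Suc i)) \<le> C'" .
    qed (simp add: n_def)
    finally show ?thesis by (simp add: K1_def algebra_simps)
  qed
  note lnb = this
  show thesis
  proof (rule that[of "exp K1"])
    have "K1 \<ge> 0" using K0 C'(1) by (simp add: K1_def n_def)
    then show "exp K1 \<ge> 1" by simp
    fix t
    have "(\<Prod>v\<leftarrow>vs. 1 / e v) = exp (\<Sum>v\<leftarrow>vs. - ln (e v))" if "\<And>v. v \<in> set vs \<Longrightarrow> 2 \<le> length v" for vs
      using that
    proof (induction vs)
      case (Cons v vs)
      have "e v > 0" using Cons.prems e_low(2) by simp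
      then have "exp (- ln (e v)) = 1 / e v" by (simp add: exp_minus divide_inverse)
      then show ?case using Cons by (simp only: list.map prod_list.Cons sum_list.Cons exp_add) simp
    qed auto
    then have "(\<Prod>v\<leftarrow>nodes t. 1 / e v) = exp (\<Sum>v\<leftarrow>nodes t. - ln (e v))"
      using nodes_subset[where t = t] by simp
    also have "\<dots> \<le> exp (K1 * real (tsize t))" using lnb[of t] by simp
    also have "\<dots> = exp K1 ^ tsize t" by (simp add: exp_of_nat_mult[symmetric] mult.commute)
    finally show "(\<Prod>v\<leftarrow>nodes t. 1 / Min (range (\<lambda>j. d j v))) \<le> exp K1 ^ tsize t" by (simp add: e_def)
  qed
qed

section \<open>Composition of series\<close>

lemma has_sum_Times:
  fixes F :: "'x \<Rightarrow> 'b::{real_normed_field,banach}" and G :: "'y \<Rightarrow> 'b"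
  assumes F: "(F has_sum a) A" "(\<lambda>x. norm (F x)) summable_on A"
    and G: "(G has_sum b) B" "(\<lambda>x. norm (G x)) summable_on B"
  shows "((\<lambda>(x, y). F x * G y) has_sum (a * b)) (A \<times> B)"
    and "(\<lambda>(x, y). norm (F x) * norm (G y)) summable_on (A \<times> B)"
proof -
  show s: "(\<lambda>(x, y). norm (F x) * norm (G y)) summable_on (A \<times> B)"
  proof (rule summable_on_SigmaI[where g = "\<lambda>x. norm (F x) * (\<Sum>\<^sub>\<infinity>y\<in>B. norm (G y))"])
    show "((\<lambda>y. case (x, y) of (x, y) \<Rightarrow> norm (F x) * norm (G y)) has_sum norm (F x) * (\<Sum>\<^sub>\<infinity>y\<in>B. norm (G y))) B" for x
      using has_sum_cmult_right[OF has_sum_infsum[OF G(2)], of "norm (F x)"] by simp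
    show "(\<lambda>x. norm (F x) * (\<Sum>\<^sub>\<infinity>y\<in>B. norm (G y))) summable_on A"
      by (rule summable_on_cmult_left[OF F(2)])
  qed auto
  have "(\<lambda>(x, y). F x * G y) summable_on (A \<times> B)"
    by (rule abs_summable_summable) (use s in \<open>simp add: case_prod_unfold norm_mult\<close>)
  show "((\<lambda>(x, y). F x * G y) has_sum (a * b)) (A \<times> B)"
  proof (rule has_sum_SigmaI)
    show "((\<lambda>y. case (x, y) of (x, y) \<Rightarrow> F x * G y) has_sum F x * b) B" for x
      using has_sum_cmult_right[OF G(1), of "F x"] by simp
    show "((\<lambda>x. F x * b) has_sum a * b) A" by (rule has_sum_cmult_left[OF F(1)])
  qed fact
qed

lemma bij_betw_Cons_length:
  "bij_betw (\<lambda>(x, xs). x # xs) (UNIV \<times> {xs. length xs = n}) {xs. length xs = Suc n}"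
  by (rule bij_betwI[where g = "\<lambda>xs. (hd xs, tl xs)"]) (auto simp: length_Suc_conv)

text \<open>Distributivity for absolutely convergent sums, one letter of the word at a time.\<close>

lemma has_sum_prod_list:
  fixes y :: "'n \<Rightarrow> 'x \<Rightarrow> 'b::{real_normed_field,banach}"
  assumes y: "\<And>i. (y i has_sum a i) UNIV" "\<And>i. (\<lambda>x. norm (y i x)) summable_on UNIV"
  shows "((\<lambda>xs. prod_list (map2 y u xs)) has_sum prod_list (map a u)) {xs. length xs = length u} \<and>
    (\<lambda>xs. norm (prod_list (map2 y u xs))) summable_on {xs. length xs = length u}"
proof (induction u)
  case Nil
  have "{xs::'x list. length xs = length []} = {[]}" by auto
  then show ?case by (simp add: has_sum_finiteI)
next
  case (Cons i u)
  note st = has_sum_Times[OF y(1)[of i] y(2)[of i] conjunct1[OF Cons] conjunct2[OF Cons]]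
  note bij = bij_betw_Cons_length[of "length u"]
  have "((\<lambda>xs. prod_list (map2 y (i # u) xs)) has_sum prod_list (map a (i # u))) {xs. length xs = Suc (length u)}"
    using st(1) by (subst has_sum_reindex_bij_betw[OF bij, symmetric]) (simp add: case_prod_unfold)
  moreover have "(\<lambda>xs. norm (prod_list (map2 y (i # u) xs))) summable_on {xs. length xs = Suc (length u)}"
    using st(2) by (subst summable_on_reindex_bij_betw[OF bij, symmetric]) (simp add: case_prod_unfold norm_mult)
  ultimately show ?case by simp
qed

lemma finite_words [simp]: "finite {u::'n::finite list. length u = d}"
  using finite_lists_length_eq[of "UNIV :: 'n set" d] by simp

lemma prod_list_map2_const: "length xs = length u \<Longrightarrow> prod_list (map2 (\<lambda>i. m) u xs) = prod_list (map m xs)"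
  by (induction u xs rule: list_induct2') auto

lemma prod_list_map_const: "prod_list (map (\<lambda>i. c) u) = c ^ length u"
  by (induction u) auto

lemma norm_prod_list_map2_le:
  fixes y :: "'n \<Rightarrow> 'x \<Rightarrow> complex"
  assumes "\<And>i x. norm (y i x) \<le> m x" "length xs = length u"
  shows "norm (prod_list (map2 y u xs)) \<le> prod_list (map m xs)"
  using assms(2)
proof (induction u xs rule: list_induct2')
  case (4 i u x xs)
  have "0 \<le> m x" using assms(1)[of i x] norm_ge_zero order_trans by blast
  then show ?case using 4 assms(1)[of i x] by (auto simp: norm_mult intro!: mult_mono)
qed auto

text \<open>The double sum over a word and a list of the same length converges absolutely, by the
  common majorant \<open>m\<close>. Summing over the lists first gives the substituted series;
  summing over the finitely many words first leaves one term per list. With trees as inner indices,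
  these lists become the children of a node.\<close>

lemma has_sum_compose_series:
  fixes B :: "'n::finite list \<Rightarrow> complex" and y :: "'n \<Rightarrow> 'x \<Rightarrow> complex" and m :: "'x \<Rightarrow> real"
  assumes ym: "\<And>i x. norm (y i x) \<le> m x" and m: "m summable_on UNIV"
    and S: "S = infsum m UNIV" and B: "(\<lambda>u. norm (B u) * S ^ length u) summable_on UNIV"
  shows "((\<lambda>xs. \<Sum>u\<in>{u. length u = length xs}. B u * prod_list (map2 y u xs)) has_sum
           (\<Sum>\<^sub>\<infinity>u. B u * prod_list (map (\<lambda>i. infsum (y i) UNIV) u))) UNIV"
proof -
  define J where "J = (SIGMA u:UNIV :: 'n list set. {xs::'x list. length xs = length u})"
  define J' where "J' = (SIGMA xs:UNIV :: 'x list set. {u::'n list. length u = length xs})"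
  have bij: "bij_betw (\<lambda>(xs, u). (u, xs)) J' J"
    by (rule bij_betwI[where g = "\<lambda>(u, xs). (xs, u)"]) (auto simp: J_def J'_def)
  have m0: "m x \<ge> 0" for x using ym[of undefined x] norm_ge_zero order_trans by blast
  have pm0: "prod_list (map m xs) \<ge> 0" for xs by (induction xs) (auto simp: m0)
  have ys: "(\<lambda>x. norm (y i x)) summable_on UNIV" for i
    by (rule summable_on_comparison_test[OF m]) (auto simp: ym)
  have "(m has_sum S) UNIV" using m S by (simp add: has_sum_infsum)
  moreover have "(\<lambda>x. norm (m x)) summable_on UNIV" using m m0 by simp
  ultimately have ms: "(prod_list \<circ> map m has_sum S ^ length u) {xs. length xs = length u}" for u :: "'n list"
  proof -
    have "((\<lambda>xs. prod_list (map2 (\<lambda>i. m) u xs)) has_sum prod_list (map (\<lambda>i. S) u)) {xs. length xs = length u}"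
      using has_sum_prod_list[of "\<lambda>i. m" "\<lambda>i. S" u] \<open>(m has_sum S) UNIV\<close> \<open>(\<lambda>x. norm (m x)) summable_on UNIV\<close> by blast
    then show ?thesis
      unfolding prod_list_map_const
      by (rule has_sum_cong[THEN iffD1, rotated]) (simp add: prod_list_map2_const)
  qed
  have sJ: "(\<lambda>(u, xs). norm (B u) * prod_list (map m xs)) summable_on J"
    unfolding J_def
  proof (rule summable_on_SigmaI[OF _ B])
    show "((\<lambda>xs. case (u, xs) of (u, xs) \<Rightarrow> norm (B u) * prod_list (map m xs)) has_sum
        norm (B u) * S ^ length u) {xs. length xs = length u}" for u
      using has_sum_cmult_right[OF ms[of u], of "norm (B u)"] by (simp add: comp_def)
  qed (auto simp: pm0)
  have sJ2: "(\<lambda>(u, xs). B u * prod_list (map2 y u xs)) summable_on J"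
  proof (rule abs_summable_summable, rule summable_on_comparison_test[OF sJ])
    fix ux assume "ux \<in> J"
    then show "norm (case ux of (u, xs) \<Rightarrow> B u * prod_list (map2 y u xs)) \<le> (case ux of (u, xs) \<Rightarrow> norm (B u) * prod_list (map m xs))"
      by (auto simp: J_def norm_mult intro!: mult_left_mono norm_prod_list_map2_le ym)
  qed auto
  define X where "X = infsum (\<lambda>(u, xs). B u * prod_list (map2 y u xs)) J"
  have hs: "((\<lambda>(u, xs). B u * prod_list (map2 y u xs)) has_sum X) J"
    unfolding X_def by (rule has_sum_infsum[OF sJ2])
  have "((\<lambda>u. B u * prod_list (map (\<lambda>i. infsum (y i) UNIV) u)) has_sum X) UNIV"
  proof (rule has_sum_SigmaD[OF hs[unfolded J_def]])
    show "((\<lambda>xs. case (u, xs) of (u, xs) \<Rightarrow> B u * prod_list (map2 y u xs)) has_sum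
        B u * prod_list (map (\<lambda>i. infsum (y i) UNIV) u)) {xs. length xs = length u}" for u
      using has_sum_cmult_right[OF conjunct1[OF has_sum_prod_list[of y "\<lambda>i. infsum (y i) UNIV" u]], of "B u"]
        ys by (simp add: abs_summable_summable)
  qed
  then have X: "X = (\<Sum>\<^sub>\<infinity>u. B u * prod_list (map (\<lambda>i. infsum (y i) UNIV) u))" by (simp add: infsumI)
  have hs': "((\<lambda>(xs, u). B u * prod_list (map2 y u xs)) has_sum X) J'"
    using has_sum_reindex_bij_betw[OF bij, of "\<lambda>(u, xs). B u * prod_list (map2 y u xs)"] hs
    by (simp add: case_prod_unfold)
  show "((\<lambda>xs. \<Sum>u\<in>{u. length u = length xs}. B u * prod_list (map2 y u xs)) has_sum
           (\<Sum>\<^sub>\<infinity>u. B u * prod_list (map (\<lambda>i. infsum (y i) UNIV) u))) UNIV"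
    unfolding X[symmetric]
    by (rule has_sum_SigmaD[OF hs'[unfolded J'_def]]) (simp add: has_sum_finite)
qed

lemma sum_Times_mult:
  fixes f :: "'a \<Rightarrow> real"
  shows "(\<Sum>(x, y)\<in>A \<times> B. f x * g y) = sum f A * sum g B"
  by (simp add: sum_product flip: sum.cartesian_product)

lemma sum_lists_prod_list:
  fixes g :: "'a \<Rightarrow> real"
  assumes "finite F"
  shows "(\<Sum>ts\<in>{ts. set ts \<subseteq> F \<and> length ts = k}. prod_list (map g ts)) = (\<Sum>t\<in>F. g t) ^ k"
proof (induction k)
  case 0
  have "{ts. set ts \<subseteq> F \<and> length ts = 0} = {[]}" by auto
  then show ?case by simp
next
  case (Suc k)
  have "inj_on (\<lambda>(xs, n). n # xs) ({xs. set xs \<subseteq> F \<and> length xs = k} \<times> F)" by (auto simp: inj_on_def)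
  then have "(\<Sum>ts\<in>{ts. set ts \<subseteq> F \<and> length ts = Suc k}. prod_list (map g ts))
      = (\<Sum>(xs, n)\<in>{xs. set xs \<subseteq> F \<and> length xs = k} \<times> F. g n * prod_list (map g xs))"
    unfolding lists_length_Suc_eq by (subst sum.reindex) (auto simp: case_prod_unfold comp_def)
  also have "\<dots> = (\<Sum>xs\<in>{xs. set xs \<subseteq> F \<and> length xs = k}. prod_list (map g xs)) * (\<Sum>t\<in>F. g t)"
    by (simp add: sum_product mult.commute flip: sum.cartesian_product) (rule sum.swap)
  finally show ?case using Suc by simp
qed

text \<open>The generating function of trees satisfies S = n x + S^2 / (1 - S). The bound 1/4
  reproduces itself: the leaves give at most 1/8, the inner nodes at most (1/4)(1/4) 2 = 1/8, where
  2 bounds the geometric series over the further children.\<close>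

lemma tree_sum_bounded:
  fixes x :: real
  assumes x: "x \<ge> 0" "real CARD('n::finite) * x \<le> 1 / 8"
  shows "finite {t::'n tree. tsize t \<le> m} \<and> (\<Sum>t\<in>{t::'n tree. tsize t \<le> m}. x ^ tsize t) \<le> 1 / 4"
proof (induction m)
  case 0
  have "{t::'n tree. tsize t \<le> 0} = {}"
    using tsize_pos by (metis (mono_tags, lifting) Collect_empty_eq le_trans not_one_le_zero)
  then show ?case by (simp only:) simp
next
  case (Suc m)
  define F where "F = {t::'n tree. tsize t \<le> m}"
  define Ls where "Ls = {ts. set ts \<subseteq> F \<and> length ts \<le> m}"
  define S where "S = (\<Sum>t\<in>F. x ^ tsize t)"
  have fin: "finite F" and S: "S \<le> 1 / 4" using Suc by (auto simp: F_def S_def)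
  have S0: "S \<ge> 0" unfolding S_def using x by (intro sum_nonneg) auto
  have finL: "finite Ls" unfolding Ls_def by (rule finite_lists_length_le[OF fin])
  define Nds where "Nds = (\<lambda>(a, b, ts). Nd a b ts) ` (F \<times> F \<times> Ls)"
  have finN: "finite Nds" unfolding Nds_def using fin finL by simp
  have sub: "{t::'n tree. tsize t \<le> Suc m} \<subseteq> range Lf \<union> Nds"
  proof
    fix t :: "'n tree" assume t: "t \<in> {t. tsize t \<le> Suc m}"
    show "t \<in> range Lf \<union> Nds"
    proof (cases t)
      case (Nd a b ts)
      have "u \<in> F" if "u \<in> set (a # b # ts)" for u
        using tsize_child_less[OF that] t Nd by (auto simp: F_def)
      moreover have "length ts \<le> (\<Sum>u\<leftarrow>ts. tsize u)"
      proof (induction ts)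
        case (Cons u us)
        then show ?case using tsize_pos[of u] by simp
      qed simp
      then have "length ts \<le> m" using t Nd tsize_pos[of a] tsize_pos[of b] by (simp add: length_concat comp_def)
      ultimately have "(a, b, ts) \<in> F \<times> F \<times> Ls" by (auto simp: Ls_def)
      then show ?thesis using Nd by (force simp: Nds_def)
    qed auto
  qed
  have x0: "x ^ n \<ge> 0" for n using x by simp
  have plist: "x ^ length (concat (map leaves ts)) = prod_list (map (\<lambda>t. x ^ tsize t) ts)" for ts :: "'n tree list"
    by (induction ts) (auto simp: power_add)
  have L: "(\<Sum>ts\<in>Ls. prod_list (map (\<lambda>t. x ^ tsize t) ts)) \<le> 2"
  proof -
    have "Ls = (\<Union>k\<in>{..m}. {ts. set ts \<subseteq> F \<and> length ts = k})" by (auto simp: Ls_def)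
    then have "(\<Sum>ts\<in>Ls. prod_list (map (\<lambda>t. x ^ tsize t) ts))
        = (\<Sum>k\<le>m. \<Sum>ts\<in>{ts. set ts \<subseteq> F \<and> length ts = k}. prod_list (map (\<lambda>t. x ^ tsize t) ts))"
      by (simp only:) (intro sum.UNION_disjoint, auto intro: finite_lists_length_eq[OF fin])
    also have "\<dots> = (\<Sum>k\<le>m. S ^ k)" by (simp add: sum_lists_prod_list[OF fin] S_def)
    also have "\<dots> \<le> (\<Sum>k\<le>m. (1 / 2) ^ k)" using S S0 by (intro sum_mono power_mono) auto
    also have "(\<Sum>k\<le>m. (1 / 2) ^ k) = 2 - (1 / 2 :: real) ^ m" by (induction m) auto
    also have "\<dots> \<le> 2" by simp
    finally show ?thesis .
  qed
  have "(\<Sum>t\<in>Nds. x ^ tsize t) = (\<Sum>(a, b, ts)\<in>F \<times> F \<times> Ls. x ^ tsize a * (x ^ tsize b * prod_list (map (\<lambda>t. x ^ tsize t) ts)))"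
    unfolding Nds_def
    by (subst sum.reindex) (auto simp: inj_on_def case_prod_unfold comp_def power_add plist intro!: sum.cong)
  also have "\<dots> = S * (S * (\<Sum>ts\<in>Ls. prod_list (map (\<lambda>t. x ^ tsize t) ts)))"
    unfolding S_def sum_Times_mult[symmetric] by (simp add: case_prod_unfold)
  also have "\<dots> \<le> 1 / 4 * (1 / 4 * 2)"
    using S S0 L x by (intro mult_mono) (auto intro!: sum_nonneg mult_nonneg_nonneg prod_list_nonneg)
  finally have N: "(\<Sum>t\<in>Nds. x ^ tsize t) \<le> 1 / 8" by simp
  have "(\<Sum>t\<in>range (Lf :: 'n \<Rightarrow> 'n tree). x ^ tsize t) = real CARD('n) * x"
    by (subst sum.reindex) (auto simp: inj_def)
  then have R: "(\<Sum>t\<in>range (Lf :: 'n \<Rightarrow> 'n tree). x ^ tsize t) \<le> 1 / 8" using x by simp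
  have "(\<Sum>t\<in>{t::'n tree. tsize t \<le> Suc m}. x ^ tsize t) \<le> (\<Sum>t\<in>range Lf \<union> Nds. x ^ tsize t)"
    using sub finN x0 by (intro sum_mono2) auto
  also have "\<dots> \<le> (\<Sum>t\<in>range (Lf :: 'n \<Rightarrow> 'n tree). x ^ tsize t) + (\<Sum>t\<in>Nds. x ^ tsize t)"
    using finN x0 by (subst sum_Un) (auto intro!: sum_nonneg)
  finally have "(\<Sum>t\<in>{t::'n tree. tsize t \<le> Suc m}. x ^ tsize t) \<le> 1 / 4" using N R by linarith
  moreover have "finite {t::'n tree. tsize t \<le> Suc m}" using sub finN by (auto intro: finite_subset)
  ultimately show ?case by blast
qed

lemma tree_summable:
  fixes x :: real
  assumes x: "x \<ge> 0" "real CARD('n::finite) * x \<le> 1 / 8"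
  shows "(\<lambda>t::'n tree. x ^ tsize t) summable_on UNIV"
proof (rule nonneg_bdd_above_summable_on)
  show "bdd_above (sum (\<lambda>t::'n tree. x ^ tsize t) ` {F. F \<subseteq> UNIV \<and> finite F})"
  proof (rule bdd_aboveI2)
    fix F :: "'n tree set" assume "F \<in> {F. F \<subseteq> UNIV \<and> finite F}"
    then have F: "finite F" by simp
    define m where "m = Max (insert 0 (tsize ` F))"
    have "F \<subseteq> {t. tsize t \<le> m}" using F by (auto simp: m_def)
    then have "(\<Sum>t\<in>F. x ^ tsize t) \<le> (\<Sum>t\<in>{t::'n tree. tsize t \<le> m}. x ^ tsize t)"
      using tree_sum_bounded[OF x, of m] x by (intro sum_mono2) auto
    also have "\<dots> \<le> 1 / 4" using tree_sum_bounded[OF x, of m] by blast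
    finally show "(\<Sum>t\<in>F. x ^ tsize t) \<le> 1 / 4" .
  qed
qed (use x in auto)

text \<open>The coefficient of z^Q sits on the canonical word of \<open>Q\<close> alone, so a sum
  over all words counts each monomial once.\<close>

definition word_coeff :: "'n::finite mps \<Rightarrow> 'n list \<Rightarrow> complex" where
  "word_coeff a u = (if u = index_word (count_list u) then a (count_list u) else 0)"

lemma word_coeff_sums:
  fixes X :: "'n::finite list \<Rightarrow> 'b::{comm_monoid_add,topological_space}"
  assumes "\<And>u. u \<noteq> index_word (count_list u) \<Longrightarrow> X u = 0"
  shows "(X has_sum S) UNIV \<longleftrightarrow> ((\<lambda>Q. X (index_word Q)) has_sum S) UNIV"
proof -
  have inj: "inj (index_word :: ('n \<Rightarrow> nat) \<Rightarrow> _)" by (metis count_list_index_word injI)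
  have "(X has_sum S) UNIV \<longleftrightarrow> (X has_sum S) (range index_word)"
    by (rule has_sum_cong_neutral) (use assms in auto)
  then show ?thesis by (simp add: has_sum_reindex[OF inj] comp_def)
qed

lemma word_coeff_index_word [simp]: "word_coeff a (index_word Q) = a Q"
  by (simp add: word_coeff_def)

lemma word_coeff_summable:
  assumes "mps_conv a r"
  shows "(\<lambda>u. norm (word_coeff a u) * r ^ length u) summable_on UNIV"
proof -
  have "(\<lambda>Q. norm (a Q) * r ^ mi_deg Q) summable_on UNIV" using assms by (simp add: mps_conv_def)
  then obtain S where "((\<lambda>Q. norm (a Q) * r ^ mi_deg Q) has_sum S) UNIV" by (auto simp: summable_on_def)
  then have "((\<lambda>u. norm (word_coeff a u) * r ^ length u) has_sum S) UNIV"
    by (subst word_coeff_sums) (auto simp: word_coeff_def)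
  then show ?thesis by (auto simp: summable_on_def)
qed

lemma word_coeff_eval:
  assumes "mps_conv a r" "norm x \<le> r"
  shows "((\<lambda>u. word_coeff a u * wmon u x) has_sum mps_eval a x) UNIV"
  using mps_eval_has_sum[OF assms]
  by (subst word_coeff_sums) (auto simp: word_coeff_def mon_eq_wmon)

lemma lam_pow_count_list: "lam_pow lam k (count_list w) = prod_list (map (lam k) w)"
  by (simp add: lam_pow_def prod_list_map_eq_prod_count)

lemma wmon_diag: "wmon w (\<chi> j. lam k j * z $ j) = lam_pow lam k (count_list w) * wmon w z"
  unfolding lam_pow_count_list by (induction w) auto

section \<open>Linearization without simultaneous resonances\<close>

lemma complex_matrix_bound:
  fixes M :: "complex^'n::finite^'m::finite"
  obtains C where "C > 0" "\<And>v. norm (M *v v) \<le> C * norm v"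
proof -
  have "bounded_linear (\<lambda>v. M *v v)" using complex_linear_matrix[of M] by (simp add: complex_linear_def)
  from bounded_linear.pos_bounded[OF this] show thesis using that by (metis mult.commute)
qed

lemma matrix_vector_axis: "M *v axis i 1 = column i M" for M :: "complex^'n::finite^'m"
  by (simp add: vec_eq_iff matrix_vector_mult_def column_def axis_def if_distrib cong: if_cong)

lemma norm_vec_le_sum: "norm (v::complex^'n) \<le> (\<Sum>i\<in>UNIV. norm (v $ i))"
  unfolding norm_vec_def by (rule L2_set_le_sum) auto

text \<open>At arguments of size O(|z|) the nonlinear part has a Lipschitz constant of order |z|, so
  it gains one order over X - Y. Modulo O(|z|^(m+1)) a perturbation of order m is thus seen only by
  the linear part.\<close>

lemma series_map_nonlinear_vanishes:
  fixes X Y :: "complex^'m \<Rightarrow> complex^'n::finite"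
  assumes F: "series_map F a r" and X: "vanishes 1 X" and Y: "vanishes 1 Y"
    and XY: "vanishes m (\<lambda>z. X z - Y z)"
  shows "vanishes (Suc m) (\<lambda>z. F (X z) - F (Y z) - linear_part a *v (X z - Y z))"
proof -
  obtain C where C: "C \<ge> 0" "\<And>x y \<rho>. norm x \<le> \<rho> \<Longrightarrow> norm y \<le> \<rho> \<Longrightarrow> \<rho> \<le> r / 4 \<Longrightarrow>
     norm (F x - F y - linear_part a *v (x - y)) \<le> C * \<rho> * norm (x - y)"
    using series_map_nonlinear[OF F] by metis
  have r: "r > 0" using F by (simp add: series_map_def)
  obtain a1 where a1: "a1 > 0" "\<forall>\<^sub>F z in nhds 0. norm (X z) \<le> a1 * norm z ^ 1" using X by (rule vanishesE)
  obtain a2 where a2: "a2 > 0" "\<forall>\<^sub>F z in nhds 0. norm (Y z) \<le> a2 * norm z ^ 1" using Y by (rule vanishesE)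
  obtain a3 where a3: "a3 > 0" "\<forall>\<^sub>F z in nhds 0. norm (X z - Y z) \<le> a3 * norm z ^ m" using XY by (rule vanishesE)
  have "\<forall>\<^sub>F z in nhds (0::complex^'m). norm z < r / 4 / (a1 + a2)"
    by (rule eventually_nhds_0_ballI[of "r / 4 / (a1 + a2)"]) (use r a1(1) a2(1) in auto)
  with a1(2) a2(2) a3(2) have "\<forall>\<^sub>F z in nhds 0. norm (F (X z) - F (Y z) - linear_part a *v (X z - Y z))
      \<le> (C * (a1 + a2) * a3) * norm z ^ Suc m"
  proof eventually_elim
    case (elim z)
    define \<rho> where "\<rho> = (a1 + a2) * norm z"
    have 1: "norm (X z) \<le> \<rho>" using elim(1) a2(1) by (simp add: \<rho>_def algebra_simps) (smt (verit) mult_nonneg_nonneg norm_ge_zero)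
    have 2: "norm (Y z) \<le> \<rho>" using elim(2) a1(1) by (simp add: \<rho>_def algebra_simps) (smt (verit) mult_nonneg_nonneg norm_ge_zero)
    have 3: "\<rho> \<le> r / 4" using elim(4) a1(1) a2(1) by (simp add: \<rho>_def field_simps)
    have "norm (F (X z) - F (Y z) - linear_part a *v (X z - Y z)) \<le> C * \<rho> * norm (X z - Y z)"
      by (rule C(2)[OF 1 2 3])
    also have "\<dots> \<le> C * \<rho> * (a3 * norm z ^ m)"
      using elim(3) C(1) a1(1) a2(1) by (intro mult_left_mono) (auto simp: \<rho>_def)
    finally show ?case by (simp add: \<rho>_def mult_ac)
  qed
  then show ?thesis by (rule vanishesI)
qed

lemma has_sum_finite_sum:
  fixes F :: "'i \<Rightarrow> 'x \<Rightarrow> complex"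
  assumes "finite I" "\<And>i. i \<in> I \<Longrightarrow> (F i has_sum S i) X"
  shows "((\<lambda>x. \<Sum>i\<in>I. F i x) has_sum (\<Sum>i\<in>I. S i)) X"
  using assms by (induction I rule: finite_induct) (auto intro: has_sum_add)

lemma has_sum_matrix_vector:
  fixes v :: "'x \<Rightarrow> complex^'n::finite" and M :: "complex^'n^'n"
  assumes "\<And>i. ((\<lambda>t. v t $ i * c t) has_sum V $ i) X"
  shows "((\<lambda>t. (M *v v t) $ j * c t) has_sum (M *v V) $ j) X"
proof -
  have "((\<lambda>t. \<Sum>i\<in>UNIV. M $ j $ i * (v t $ i * c t)) has_sum (\<Sum>i\<in>UNIV. M $ j $ i * V $ i)) X"
    by (intro has_sum_finite_sum has_sum_cmult_right assms) auto
  then show ?thesis by (simp add: matrix_vector_mult_def sum_distrib_left sum_distrib_right mult_ac)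
qed

lemma mps_eval_0:
  fixes a :: "'n::finite mps"
  assumes "mps_conv a r"
  shows "mps_eval a 0 = a (\<lambda>_. 0)"
proof -
  have m0: "mon Q 0 = (if Q = (\<lambda>_. 0) then 1 else 0)" for Q :: "'n \<Rightarrow> nat"
  proof (cases "Q = (\<lambda>_. 0)")
    case False
    then obtain i where "Q i \<noteq> 0" by (metis ext)
    then have "\<exists>j\<in>UNIV. (0 :: complex) ^ Q j = 0" by (intro bexI[of _ i]) auto
    then show ?thesis using False unfolding mon_def by (auto intro!: prod_zero)
  qed (simp add: mon_0)
  have "((\<lambda>Q. a Q * mon Q 0) has_sum a (\<lambda>_. 0)) UNIV"
    by (rule has_sum_cong_neutral[THEN iffD1, of UNIV "{\<lambda>_. 0}", OF _ _ _ has_sum_finite[of "{\<lambda>_. 0}" "\<lambda>Q. a Q * mon Q 0", simplified m0, simplified]])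
       (auto simp: m0)
  then show ?thesis using mps_eval_has_sum[OF assms, of 0] assms
    by (auto simp: mps_conv_def dest: has_sum_unique)
qed

lemma word_coeff_Nil: "word_coeff a [] = a (\<lambda>_. 0)"
proof -
  have "index_word (\<lambda>_. 0) = ([] :: 'a list)" using length_index_word[of "\<lambda>_. 0"] mi_deg_eq_0_iff by (metis length_0_conv)
  then show ?thesis by (metis word_coeff_index_word)
qed

lemma word_coeff_single: "word_coeff a [j] = a (mi_unit j)"
proof -
  have "length (index_word (mi_unit j)) = Suc 0" using mi_deg_eq_1_iff[of "mi_unit j"] by auto
  then obtain i where i: "index_word (mi_unit j) = [i]" by (metis length_0_conv length_Suc_conv)
  then have "count_list [i] = mi_unit j" by (metis count_list_index_word)
  then have "count_list [i] i = mi_unit j i" by (rule fun_cong)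
  then have "i = j" by (cases "i = j") (simp_all add: mi_unit_def)
  then show ?thesis using i by (metis word_coeff_index_word)
qed

text \<open>\<open>sel j Q\<close> is the index of the germ whose divisor is used to define the coefficients of
  \<open>z^Q\<close> in component \<open>j\<close> of the linearization.\<close>

locale nonresonant_family =
  fixes f :: "nat \<Rightarrow> complex^'n::finite \<Rightarrow> complex^'n" and h :: nat
    and A :: "nat \<Rightarrow> complex^'n^'n" and P P' :: "complex^'n^'n"
    and lam :: "nat \<Rightarrow> 'n \<Rightarrow> complex" and a :: "nat \<Rightarrow> 'n fmap" and s :: real
    and sel :: "'n \<Rightarrow> ('n \<Rightarrow> nat) \<Rightarrow> nat" and eps :: "'n list \<Rightarrow> real" and K :: real
  assumes PP': "P ** P' = mat 1" and P'P: "P' ** P = mat 1"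
    and diag: "\<And>k x j. k < h \<Longrightarrow> (P' *v (A k *v x)) $ j = lam k j * (P' *v x) $ j"
    and series: "\<And>k. k < h \<Longrightarrow> series_map (f k) (a k) s"
    and lin: "\<And>k. k < h \<Longrightarrow> linear_part (a k) = A k"
    and f0: "\<And>k. k < h \<Longrightarrow> f k 0 = 0"
    and s: "s > 0"
    and sel_less: "\<And>j Q. sel j Q < h"
    and sel_div: "\<And>j w. 2 \<le> length w \<Longrightarrow>
      eps w \<le> norm (lam_pow lam (sel j (count_list w)) (count_list w) - lam (sel j (count_list w)) j)"
    and eps_pos: "\<And>w. 2 \<le> length w \<Longrightarrow> 0 < eps w"
    and K: "K \<ge> 1" "\<And>t. (\<Prod>v\<leftarrow>nodes t. 1 / eps v) \<le> K ^ tsize t"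
    and commute: "\<And>p q. p < h \<Longrightarrow> q < h \<Longrightarrow> \<forall>\<^sub>F z in nhds 0. f p (f q z) = f q (f p z)"
begin

text \<open>The part of \<open>f k\<close> of degree \<open>length xs\<close>, made multilinear by
  feeding the vectors to successive letters of a word. It is not symmetric, because only canonical
  words carry coefficients; this is harmless, as only sums over all lists are used.\<close>

definition multi :: "nat \<Rightarrow> (complex^'n) list \<Rightarrow> complex^'n" where
  "multi k xs = (\<chi> i. \<Sum>u\<in>{u. length u = length xs}.
     word_coeff (a k i) u * prod_list (map2 (\<lambda>l x. x $ l) u xs))"

definition divisor :: "nat \<Rightarrow> 'n \<Rightarrow> 'n list \<Rightarrow> complex" where
  "divisor k j w = lam_pow lam k (count_list w) - lam k j"

text \<open>The conjugacy equation is diagonal in eigenvector coordinates: \<open>P'\<close> passes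
  to them, each component is divided by the divisor of its own selected germ, and \<open>P\<close>
  returns.\<close>

definition solve :: "'n list \<Rightarrow> (complex^'n) list \<Rightarrow> complex^'n" where
  "solve w xs = P *v (\<chi> j. (P' *v multi (sel j (count_list w)) xs) $ j / divisor (sel j (count_list w)) j w)"

primrec coef :: "'n tree \<Rightarrow> complex^'n" where
  "coef (Lf i) = column i P"
| "coef (Nd t1 t2 ts) = solve (leaves t1 @ leaves t2 @ concat (map leaves ts)) (coef t1 # coef t2 # map coef ts)"

definition nonlin :: "nat \<Rightarrow> 'n tree \<Rightarrow> complex^'n" where
  "nonlin k t = (case t of Lf i \<Rightarrow> 0 | Nd t1 t2 ts \<Rightarrow> multi k (map coef (t1 # t2 # ts)))"

text \<open>The contribution of one tree to f_k o Phi - Phi o Lambda_k, in eigenvector coordinates,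
  with Lambda_k the diagonal map.\<close>

definition defect :: "nat \<Rightarrow> 'n tree \<Rightarrow> complex^'n" where
  "defect k t = P' *v (A k *v coef t + nonlin k t - lam_pow lam k (count_list (leaves t)) *s coef t)"

definition diagonal :: "nat \<Rightarrow> complex^'n \<Rightarrow> complex^'n" where
  "diagonal k z = (\<chi> j. lam k j * z $ j)"

lemma P'P_vec: "P' *v (P *v x) = x" "P *v (P' *v x) = x"
  by (simp_all add: matrix_vector_mul_assoc PP' P'P)

lemma defect_nth:
  assumes "k < h"
  shows "defect k t $ j = (P' *v nonlin k t) $ j - divisor k j (leaves t) * (P' *v coef t) $ j"
proof -
  have "P' *v (c *s x) = c *s (P' *v x)" for c x
    using complex_linear_matrix[of P'] by (simp add: complex_linear_def)
  then show ?thesis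
    by (simp add: defect_def divisor_def matrix_vector_mult_diff_distrib matrix_vector_right_distrib
        diag[OF assms] algebra_simps)
qed

lemma divisor_sel:
  assumes "2 \<le> length w"
  shows "eps w \<le> norm (divisor (sel j (count_list w)) j w)" "divisor (sel j (count_list w)) j w \<noteq> 0"
proof -
  show "eps w \<le> norm (divisor (sel j (count_list w)) j w)" using sel_div[OF assms] by (simp add: divisor_def)
  with eps_pos[OF assms] show "divisor (sel j (count_list w)) j w \<noteq> 0" by auto
qed

text \<open>Leaf coefficients are common eigenvectors, so linear terms leave no defect for any
  germ.\<close>

lemma defect_Lf: "k < h \<Longrightarrow> defect k (Lf i) = 0"
proof -
  assume k: "k < h"
  have c: "P' *v column i P = axis i 1"
    using P'P_vec(1)[of "axis i 1"] by (simp add: matrix_vector_axis)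
  have "divisor k j [i] * axis i 1 $ j = 0" for j
    by (cases "i = j") (simp_all add: divisor_def lam_pow_count_list axis_def)
  then show ?thesis using defect_nth[OF k, of "Lf i"] c by (simp add: vec_eq_iff nonlin_def)
qed

text \<open>This is exactly what the division in \<open>solve\<close> achieves. For the other germs
  the same equation is obtained only later, through commutativity and not tree by tree.\<close>

lemma defect_sel:
  assumes "2 \<le> tsize t"
  shows "defect (sel j (count_list (leaves t))) t $ j = 0"
proof (cases t)
  case (Nd t1 t2 ts)
  have "(P' *v coef t) $ j = (P' *v nonlin (sel j (count_list (leaves t))) t) $ j / divisor (sel j (count_list (leaves t))) j (leaves t)"
    by (simp add: Nd solve_def P'P_vec nonlin_def)
  then show ?thesis using divisor_sel(2)[OF assms, of j] by (simp add: defect_nth[OF sel_less])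
qed (use assms in simp)

lemma conv: "k < h \<Longrightarrow> mps_conv (a k i) s"
  using series by (simp add: series_map_def)

section \<open>Exponential bounds for tree coefficients and convergence\<close>

lemma multi_bound:
  obtains M where "M \<ge> 1" "\<And>k xs. k < h \<Longrightarrow> norm (multi k xs) \<le> M * (1 / s) ^ length xs * prod_list (map norm xs)"
proof -
  define S where "S = (\<lambda>k i. \<Sum>\<^sub>\<infinity>u. norm (word_coeff (a k i) u) * s ^ length u)"
  have S0: "S k i \<ge> 0" for k i unfolding S_def using s by (intro infsum_nonneg) auto
  have fin: "(\<Sum>u\<in>{u. length u = d}. norm (word_coeff (a k i) u)) \<le> S k i * (1 / s) ^ d" if k: "k < h" for k i d
  proof -
    have "(\<Sum>u\<in>{u. length u = d}. norm (word_coeff (a k i) u) * s ^ length u) \<le> S k i"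
      unfolding S_def using s by (intro finite_sum_le_infsum word_coeff_summable[OF conv[OF k]]) auto
    then have "(\<Sum>u\<in>{u. length u = d}. norm (word_coeff (a k i) u)) * s ^ d \<le> S k i"
      by (simp add: sum_distrib_right)
    then show ?thesis using s by (simp add: field_simps power_divide)
  qed
  define M where "M = 1 + (\<Sum>k<h. \<Sum>i\<in>UNIV. S k i)"
  have "norm (multi k xs) \<le> M * (1 / s) ^ length xs * prod_list (map norm xs)" if k: "k < h" for k xs
  proof -
    have p0: "prod_list (map norm xs) \<ge> 0" by (intro prod_list_nonneg) auto
    have "norm (multi k xs $ i) \<le> S k i * (1 / s) ^ length xs * prod_list (map norm xs)" for i
    proof -
      have "norm (multi k xs $ i) \<le> (\<Sum>u\<in>{u. length u = length xs}. norm (word_coeff (a k i) u * prod_list (map2 (\<lambda>l x. x $ l) u xs)))"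
        unfolding multi_def by (simp add: norm_sum)
      also have "\<dots> \<le> (\<Sum>u\<in>{u. length u = length xs}. norm (word_coeff (a k i) u) * prod_list (map norm xs))"
        unfolding norm_mult
        by (intro sum_mono mult_left_mono norm_prod_list_map2_le) (auto simp: Finite_Cartesian_Product.norm_nth_le)
      also have "\<dots> \<le> S k i * (1 / s) ^ length xs * prod_list (map norm xs)"
        using fin[OF k] p0 by (simp add: sum_distrib_right[symmetric] mult_right_mono)
      finally show ?thesis .
    qed
    then have "norm (multi k xs) \<le> (\<Sum>i\<in>UNIV. S k i * (1 / s) ^ length xs * prod_list (map norm xs))"
      by (intro order_trans[OF norm_vec_le_sum] sum_mono)
    also have "\<dots> = (\<Sum>i\<in>UNIV. S k i) * ((1 / s) ^ length xs * prod_list (map norm xs))"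
      by (simp add: sum_distrib_right mult_ac)
    also have "\<dots> \<le> M * ((1 / s) ^ length xs * prod_list (map norm xs))"
    proof (rule mult_right_mono)
      have "(\<Sum>i\<in>UNIV. S k i) \<le> (\<Sum>k<h. \<Sum>i\<in>UNIV. S k i)"
        using k by (intro member_le_sum[of k "{..<h}" "\<lambda>k. \<Sum>i\<in>UNIV. S k i"]) (auto intro!: sum_nonneg S0)
      then show "(\<Sum>i\<in>UNIV. S k i) \<le> M" by (simp add: M_def)
    qed (use s p0 in auto)
    finally show ?thesis by (simp add: mult.assoc)
  qed
  moreover have "M \<ge> 1" unfolding M_def by (simp add: sum_nonneg S0)
  ultimately show thesis using that by blast
qed

text \<open>An inner node contributes one factor 1/\<open>eps\<close> and constants exponential in
  its number of children. Nodes and edges are bounded in terms of the leaves, so the constants fit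
  into a power of the number of leaves; \<open>K\<close> does the same for the divisors.\<close>

lemma coef_bound:
  obtains R where "R \<ge> 1" "\<And>t. norm (coef t) \<le> R ^ tsize t"
proof -
  obtain M where M: "M \<ge> 1" "\<And>k xs. k < h \<Longrightarrow> norm (multi k xs) \<le> M * (1 / s) ^ length xs * prod_list (map norm xs)"
    using multi_bound by metis
  obtain c1 where c1: "c1 > 0" "\<And>v. norm (P *v v) \<le> c1 * norm v" using complex_matrix_bound by metis
  obtain c2 where c2: "c2 > 0" "\<And>v. norm (P' *v v) \<le> c2 * norm v" using complex_matrix_bound by metis
  define n where "n = real CARD('n)"
  define \<kappa> where "\<kappa> = c1 * (n * (c2 * M))"
  \<comment> \<open>One base for everything: \<kappa> collects the constants of a node, 1/s is the
    rate of \<open>multi\<close> per child, and c1 bounds the leaf coefficients.\<close>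
  define \<beta> where "\<beta> = max 1 (max \<kappa> (max (1 / s) c1))"
  have \<beta>: "\<beta> \<ge> 1" "\<kappa> \<le> \<beta>" "1 / s \<le> \<beta>" "c1 \<le> \<beta>" by (auto simp: \<beta>_def)
  have \<kappa>0: "\<kappa> \<ge> 0" using c1(1) c2(1) M(1) by (simp add: \<kappa>_def n_def)
  have solve_bound: "norm (solve w xs) \<le> \<beta> ^ (length xs + 1) * (1 / eps w) * prod_list (map norm xs)"
    if w: "2 \<le> length w" for w xs
  proof -
    let ?B = "c2 * (M * (1 / s) ^ length xs * prod_list (map norm xs)) * (1 / eps w)"
    have p0: "prod_list (map norm xs) \<ge> 0" by (intro prod_list_nonneg) auto
    have e: "eps w > 0" by (rule eps_pos[OF w])
    have comp: "norm ((P' *v multi (sel j (count_list w)) xs) $ j / divisor (sel j (count_list w)) j w) \<le> ?B" for j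
    proof -
      have "norm ((P' *v multi (sel j (count_list w)) xs) $ j) \<le> norm (P' *v multi (sel j (count_list w)) xs)"
        by (rule Finite_Cartesian_Product.norm_nth_le)
      also have "\<dots> \<le> c2 * norm (multi (sel j (count_list w)) xs)" by (rule c2)
      also have "\<dots> \<le> c2 * (M * (1 / s) ^ length xs * prod_list (map norm xs))"
        using c2(1) M(2)[OF sel_less] by (intro mult_left_mono) auto
      finally have 1: "norm ((P' *v multi (sel j (count_list w)) xs) $ j) \<le> c2 * (M * (1 / s) ^ length xs * prod_list (map norm xs))" .
      have 2: "1 / norm (divisor (sel j (count_list w)) j w) \<le> 1 / eps w"
        using divisor_sel(1)[OF w, of j] e by (intro divide_left_mono mult_pos_pos) auto
      have "norm ((P' *v multi (sel j (count_list w)) xs) $ j) * (1 / norm (divisor (sel j (count_list w)) j w)) \<le> ?B"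
        using 1 2 c2(1) M(1) s p0 by (intro mult_mono) auto
      then show ?thesis by (simp add: norm_divide)
    qed
    have "norm (solve w xs) \<le> c1 * norm (\<chi> j. (P' *v multi (sel j (count_list w)) xs) $ j / divisor (sel j (count_list w)) j w)"
      unfolding solve_def by (rule c1)
    also have "\<dots> \<le> c1 * (\<Sum>j\<in>(UNIV::'n set). ?B)"
      using c1(1) comp by (intro mult_left_mono order_trans[OF norm_vec_le_sum] sum_mono) auto
    also have "\<dots> = (\<kappa> * (1 / s) ^ length xs) * ((1 / eps w) * prod_list (map norm xs))"
      by (simp add: \<kappa>_def n_def)
    also have "\<dots> \<le> (\<beta> * \<beta> ^ length xs) * ((1 / eps w) * prod_list (map norm xs))"
      using \<beta> \<kappa>0 s e p0 by (intro mult_right_mono mult_mono power_mono) auto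
    finally show ?thesis by (simp add: mult_ac)
  qed
  have epos: "(\<Prod>v\<leftarrow>nodes t. 1 / eps v) \<ge> 0" for t
    using nodes_subset eps_pos by (intro prod_list_nonneg) (fastforce intro: less_imp_le)
  text \<open>The exponent \<open>4 * tsize t - 3\<close> absorbs the factor of degree \<open>d + 1\<close> of a node with
    \<open>d \<ge> 2\<close> children.\<close>
  have main: "\<beta> ^ 3 * norm (coef t) \<le> \<beta> ^ (4 * tsize t) * (\<Prod>v\<leftarrow>nodes t. 1 / eps v)" for t
  proof (induction t rule: tree_induct)
    case (Lf i)
    have "norm (column i P) \<le> c1 * norm (axis i 1 :: complex^'n)"
      using c1(2)[of "axis i 1"] by (simp add: matrix_vector_axis)
    also have "\<dots> \<le> \<beta>" using \<beta>(4) by (simp add: norm_axis_1)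
    finally show ?case using \<beta>(1) by (simp add: power_numeral_reduce mult_left_mono)
  next
    case (Nd t1 t2 ts)
    let ?us = "t1 # t2 # ts" and ?T = "Nd t1 t2 ts"
    have lists: "\<beta> ^ (3 * length us) * prod_list (map (\<lambda>t. norm (coef t)) us)
        \<le> \<beta> ^ (4 * length (concat (map leaves us))) * (\<Prod>v\<leftarrow>concat (map nodes us). 1 / eps v)" if "set us \<subseteq> set ?us" for us
      using that
    proof (induction us)
      case (Cons u us)
      have "(\<beta> ^ 3 * norm (coef u)) * (\<beta> ^ (3 * length us) * prod_list (map (\<lambda>t. norm (coef t)) us))
         \<le> (\<beta> ^ (4 * tsize u) * (\<Prod>v\<leftarrow>nodes u. 1 / eps v)) *
           (\<beta> ^ (4 * length (concat (map leaves us))) * (\<Prod>v\<leftarrow>concat (map nodes us). 1 / eps v))"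
      proof (rule mult_mono)
        show "\<beta> ^ 3 * norm (coef u) \<le> \<beta> ^ (4 * tsize u) * (\<Prod>v\<leftarrow>nodes u. 1 / eps v)"
          using Cons.prems by (intro Nd) auto
        show "\<beta> ^ (3 * length us) * prod_list (map (\<lambda>t. norm (coef t)) us)
          \<le> \<beta> ^ (4 * length (concat (map leaves us))) * (\<Prod>v\<leftarrow>concat (map nodes us). 1 / eps v)"
          using Cons by auto
        show "0 \<le> \<beta> ^ (4 * tsize u) * (\<Prod>v\<leftarrow>nodes u. 1 / eps v)"
          using \<beta>(1) epos[of u] by (intro mult_nonneg_nonneg) auto
        show "0 \<le> \<beta> ^ (3 * length us) * prod_list (map (\<lambda>t. norm (coef t)) us)"
          using \<beta>(1) by (intro mult_nonneg_nonneg prod_list_nonneg) auto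
      qed
      then show ?case by (simp add: power_add algebra_simps)
    qed auto
    have w: "2 \<le> length (leaves ?T)" by (rule tsize_Nd_ge2)
    have e: "eps (leaves ?T) > 0" by (rule eps_pos[OF w])
    have p0: "prod_list (map (\<lambda>t. norm (coef t)) ?us) \<ge> 0" by (intro prod_list_nonneg) auto
    have "\<beta> ^ 3 * norm (coef ?T) \<le> \<beta> ^ 3 * (\<beta> ^ (length ?us + 1) * (1 / eps (leaves ?T)) * prod_list (map (\<lambda>t. norm (coef t)) ?us))"
      using solve_bound[OF w, of "map coef ?us"] \<beta>(1) by (intro mult_left_mono) (auto simp: comp_def)
    also have "\<dots> = (1 / eps (leaves ?T)) * (\<beta> ^ (length ?us + 4) * prod_list (map (\<lambda>t. norm (coef t)) ?us))"
      by (simp add: power_add power_numeral_reduce mult_ac)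
    also have "\<dots> \<le> (1 / eps (leaves ?T)) * (\<beta> ^ (3 * length ?us) * prod_list (map (\<lambda>t. norm (coef t)) ?us))"
      using e \<beta>(1) p0 by (intro mult_left_mono mult_right_mono power_increasing) auto
    also have "\<dots> \<le> (1 / eps (leaves ?T)) * (\<beta> ^ (4 * length (concat (map leaves ?us))) * (\<Prod>v\<leftarrow>concat (map nodes ?us). 1 / eps v))"
      using e lists[of ?us] by (intro mult_left_mono) auto
    also have "\<dots> = \<beta> ^ (4 * tsize ?T) * (\<Prod>v\<leftarrow>nodes ?T. 1 / eps v)"
      unfolding nodes_Nd leaves_Nd by (simp add: mult_ac)
    finally show ?case .
  qed
  show thesis
  proof (rule that)
    show "1 \<le> \<beta> ^ 4 * K"
      using mult_mono[of 1 "\<beta> ^ 4" 1 K] one_le_power[OF \<beta>(1), of 4] K(1) by simp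
    fix t
    have "norm (coef t) \<le> \<beta> ^ 3 * norm (coef t)"
      using mult_right_mono[OF one_le_power[OF \<beta>(1), of 3] norm_ge_zero[of "coef t"]] by simp
    also have "\<dots> \<le> \<beta> ^ (4 * tsize t) * (\<Prod>v\<leftarrow>nodes t. 1 / eps v)" by (rule main)
    also have "\<dots> \<le> \<beta> ^ (4 * tsize t) * K ^ tsize t" using K(2) \<beta>(1) by (intro mult_left_mono) auto
    finally show "norm (coef t) \<le> (\<beta> ^ 4 * K) ^ tsize t" by (simp add: power_mult power_mult_distrib)
  qed
qed

text \<open>The factor n + 1 serves two bounds at once: n times the sum dominates |Phi z|, and the
  sum itself is at most \<open>s\<close>. So \<open>f k\<close> may be expanded at
  \<open>Phi z\<close>.\<close>

definition admissible :: "real \<Rightarrow> bool" where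
  "admissible r \<longleftrightarrow> r > 0 \<and> (\<lambda>t. norm (coef t) * r ^ tsize t) summable_on UNIV \<and>
     (\<Sum>\<^sub>\<infinity>t. norm (coef t) * r ^ tsize t) * (real CARD('n) + 1) \<le> s"

lemma admissible_exists: obtains r where "admissible r"
proof -
  obtain R where R: "R \<ge> 1" "\<And>t. norm (coef t) \<le> R ^ tsize t" using coef_bound by metis
  define x where "x = 1 / (8 * real CARD('n))"
  have x: "x > 0" "real CARD('n) * x \<le> 1 / 8" by (auto simp: x_def)
  define r1 where "r1 = x / R"
  have r1: "r1 > 0" using x R by (simp add: r1_def)
  have le: "norm (coef t) * r1 ^ tsize t \<le> x ^ tsize t" for t
  proof -
    have "norm (coef t) * r1 ^ tsize t \<le> R ^ tsize t * r1 ^ tsize t"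
      using R(2) r1 by (intro mult_right_mono) auto
    then show ?thesis using R(1) by (simp add: r1_def flip: power_mult_distrib)
  qed
  have s1: "(\<lambda>t. norm (coef t) * r1 ^ tsize t) summable_on UNIV"
    by (rule summable_on_comparison_test[OF tree_summable[of x]]) (use x r1 le in auto)
  define S where "S = (\<Sum>\<^sub>\<infinity>t. norm (coef t) * r1 ^ tsize t)"
  have S0: "S \<ge> 0" unfolding S_def using r1 by (intro infsum_nonneg) auto
  \<comment> \<open>Every tree has a leaf, so scaling the radius by c <= 1 scales the sum by at most
    c, which brings it below the required size.\<close>
  define c where "c = min 1 (s / ((S + 1) * (real CARD('n) + 1)))"
  have c: "c > 0" "c \<le> 1" using s S0 by (auto simp: c_def)
  have le2: "norm (coef t) * (c * r1) ^ tsize t \<le> c * (norm (coef t) * r1 ^ tsize t)" for t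
  proof -
    have "c ^ tsize t \<le> c ^ 1" using c tsize_pos[of t] by (intro power_decreasing) auto
    then have "c ^ tsize t * (norm (coef t) * r1 ^ tsize t) \<le> c * (norm (coef t) * r1 ^ tsize t)"
      using r1 by (intro mult_right_mono) auto
    then show ?thesis by (simp add: power_mult_distrib mult_ac)
  qed
  have s2: "(\<lambda>t. c * (norm (coef t) * r1 ^ tsize t)) summable_on UNIV" by (rule summable_on_cmult_right[OF s1])
  have s3: "(\<lambda>t. norm (coef t) * (c * r1) ^ tsize t) summable_on UNIV"
    by (rule summable_on_comparison_test[OF s2]) (use le2 c r1 in auto)
  have "(\<Sum>\<^sub>\<infinity>t. norm (coef t) * (c * r1) ^ tsize t) \<le> (\<Sum>\<^sub>\<infinity>t. c * (norm (coef t) * r1 ^ tsize t))"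
    by (rule infsum_mono[OF s3 s2 le2])
  also have "\<dots> = c * S" unfolding S_def by (rule infsum_cmult_right[OF s1])
  also have "\<dots> \<le> c * (S + 1)" using c by simp
  finally have "(\<Sum>\<^sub>\<infinity>t. norm (coef t) * (c * r1) ^ tsize t) * (real CARD('n) + 1) \<le> c * (S + 1) * (real CARD('n) + 1)"
    by (intro mult_right_mono) auto
  also have "c * (S + 1) * (real CARD('n) + 1) = c * ((S + 1) * (real CARD('n) + 1))" by simp
  also have "\<dots> \<le> s / ((S + 1) * (real CARD('n) + 1)) * ((S + 1) * (real CARD('n) + 1))"
  proof (rule mult_right_mono)
    show "c \<le> s / ((S + 1) * (real CARD('n) + 1))" unfolding c_def by (rule min.cobounded2)
  qed (use S0 in auto)
  also have "\<dots> = s" using S0 by (simp add: add_nonneg_eq_0_iff)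
  finally have "admissible (c * r1)" using s3 c r1 by (simp add: admissible_def)
  then show thesis by (rule that)
qed

section \<open>The transformation and its composition with the germs\<close>

definition lz_series :: "'n fmap" where
  "lz_series i Q = (\<Sum>\<^sub>\<infinity>t\<in>{t. count_list (leaves t) = Q}. coef t $ i)"

lemma lz_series_eq: "lz_series i = (\<lambda>Q. \<Sum>\<^sub>\<infinity>t\<in>{t. count_list (leaves t) = Q}. coef t $ i)"
  by (rule ext) (rule lz_series_def)

definition Phi :: "complex^'n \<Rightarrow> complex^'n" where
  "Phi z = (\<chi> i. mps_eval (lz_series i) z)"

lemma coef_nth_summable:
  assumes "admissible r"
  shows "(\<lambda>t. norm (coef t $ i) * r ^ mi_deg (count_list (leaves t))) summable_on UNIV"
proof (rule summable_on_comparison_test)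
  show "(\<lambda>t. norm (coef t) * r ^ tsize t) summable_on UNIV" using assms by (simp add: admissible_def)
qed (use assms in \<open>auto simp: admissible_def mi_deg_count_list intro!: mult_right_mono Finite_Cartesian_Product.norm_nth_le\<close>)

lemma lz_series_conv: "admissible r \<Longrightarrow> mps_conv (lz_series i) r"
  using mps_group(1)[OF _ coef_nth_summable[of r i]] by (simp add: admissible_def lz_series_eq)

lemma Phi_has_sum:
  assumes "admissible r" "norm z \<le> r"
  shows "((\<lambda>t. coef t $ i * wmon (leaves t) z) has_sum Phi z $ i) UNIV"
  using mps_group(2)[OF _ coef_nth_summable[OF assms(1), of i] assms(2)] assms(1)
  by (simp add: Phi_def lz_series_eq wmon_eq_mon admissible_def)

lemma series_map_Phi: "admissible r \<Longrightarrow> series_map Phi lz_series r"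
  using lz_series_conv by (auto simp: series_map_def Phi_def admissible_def)

lemma Phi_0: "Phi 0 = 0"
proof -
  obtain r where r: "admissible r" using admissible_exists by metis
  have "wmon (leaves t) 0 = 0" for t :: "'n tree" using tsize_pos[of t] by (cases "leaves t") auto
  then have "Phi 0 $ i = 0" for i
    using Phi_has_sum[OF r, of 0 i] r by (auto simp: admissible_def dest: has_sum_unique[OF has_sum_0_simp])
  then show ?thesis by (simp add: vec_eq_iff)
qed

lemma count_list_leaves_unit: "{t::'n tree. count_list (leaves t) = mi_unit j} = {Lf j}"
proof -
  have "t = Lf j" if "count_list (leaves t) = mi_unit j" for t :: "'n tree"
  proof -
    have "tsize t = 1" using that mi_deg_eq_1_iff[of "mi_unit j"] by (metis mi_deg_count_list)
    then have "\<exists>i. t = Lf i"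
    proof (cases t)
      case (Nd t1 t2 ts)
      then show ?thesis using \<open>tsize t = 1\<close> tsize_Nd_ge2[of t1 t2 ts] by simp
    qed auto
    then obtain i where i: "t = Lf i" ..
    then have "count_list [i] i = mi_unit j i" using that by simp
    then have "i = j" by (cases "i = j") (simp_all add: mi_unit_def)
    then show ?thesis using i by simp
  qed
  then show ?thesis by (auto simp: mi_unit_def fun_eq_iff)
qed

lemma linear_part_lz_series: "linear_part lz_series = P"
  by (simp add: linear_part_def lz_series_def count_list_leaves_unit vec_eq_iff column_def)

lemma holo_germ_Phi: "holo_germ Phi (\<lambda>v. P *v v)"
  using admissible_exists series_map_holo_germ[OF series_map_Phi Phi_0] linear_part_lz_series by metis

lemma norm_Phi_le:
  assumes r: "admissible r" and z: "norm z \<le> r"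
  shows "norm (Phi z) \<le> s"
proof -
  define S where "S = (\<Sum>\<^sub>\<infinity>t. norm (coef t) * r ^ tsize t)"
  have sm: "(\<lambda>t. norm (coef t) * r ^ tsize t) summable_on UNIV" and r0: "r > 0"
    and S: "S * (real CARD('n) + 1) \<le> s"
    using r by (auto simp: admissible_def S_def)
  have S0: "S \<ge> 0" unfolding S_def using r0 by (intro infsum_nonneg) auto
  have le: "norm (coef t $ i * wmon (leaves t) z) \<le> norm (coef t) * r ^ tsize t" for t i
    unfolding norm_mult by (intro mult_mono norm_wmon_le z Finite_Cartesian_Product.norm_nth_le) (use r0 in auto)
  have "norm (Phi z $ i) \<le> S" for i
  proof -
    have abs: "(\<lambda>t. norm (coef t $ i * wmon (leaves t) z)) summable_on UNIV"
      by (rule summable_on_comparison_test[OF sm]) (use le in auto)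
    have "norm (Phi z $ i) \<le> (\<Sum>\<^sub>\<infinity>t. norm (coef t $ i * wmon (leaves t) z))"
      using norm_infsum_bound[OF abs] infsumI[OF Phi_has_sum[OF r z, of i]] by simp
    also have "\<dots> \<le> S" unfolding S_def by (rule infsum_mono[OF abs sm]) (use le in auto)
    finally show ?thesis .
  qed
  then have "norm (Phi z) \<le> (\<Sum>i\<in>(UNIV::'n set). S)"
    by (intro order_trans[OF norm_vec_le_sum] sum_mono)
  also have "\<dots> \<le> S * (real CARD('n) + 1)" using S0 by (simp add: algebra_simps)
  finally show ?thesis using S by simp
qed

lemma multi_single:
  assumes "k < h"
  shows "multi k [x] = A k *v x"
proof -
  have "(\<Sum>u\<in>{u. length u = 1}. word_coeff (a k i) u * prod_list (map2 (\<lambda>l x. x $ l) u [x]))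
      = (\<Sum>j\<in>UNIV. word_coeff (a k i) [j] * x $ j)" for i
    by (rule sum.reindex_bij_witness[of _ "\<lambda>j. [j]" hd]) (auto simp: length_Suc_conv)
  then show ?thesis
    using lin[OF assms]
    by (simp add: multi_def vec_eq_iff word_coeff_single matrix_vector_mult_def linear_part_def)
qed

lemma multi_Nil:
  assumes "k < h"
  shows "multi k [] = 0"
proof -
  have "a k i (\<lambda>_. 0) = 0" for i
    using series[OF assms] f0[OF assms] mps_eval_0[OF conv[OF assms], of i] s
    unfolding series_map_def by (metis norm_zero order_less_imp_le zero_index)
  moreover have "{u::'n list. length u = 0} = {[]}" by auto
  ultimately show ?thesis by (simp add: multi_def vec_eq_iff word_coeff_Nil)
qed

lemma prod_list_map2_coef:
  assumes "length u = length ts"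
  shows "prod_list (map2 (\<lambda>i t. coef t $ i * wmon (leaves t) z) u ts)
    = prod_list (map2 (\<lambda>l x. x $ l) u (map coef ts)) * wmon (concat (map leaves ts)) z"
  using assms by (induction u ts rule: list_induct2) auto

text \<open>Expanding f_k at a sum over trees gives a sum over lists of trees. The empty list
  contributes f_k(0) = 0 and the singletons give A_k; a list with at least two entries is the list
  of children of a unique inner node, so the remainder is again a sum over trees.\<close>

lemma compose_has_sum:
  assumes k: "k < h" and r: "admissible r" and z: "norm z \<le> r"
  shows "((\<lambda>t. (A k *v coef t + nonlin k t) $ i * wmon (leaves t) z) has_sum f k (Phi z) $ i) UNIV"
proof -
  define m where "m = (\<lambda>t. norm (coef t) * r ^ tsize t)"
  define y where "y = (\<lambda>i t. coef t $ i * wmon (leaves t) z)"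
  define B where "B = word_coeff (a k i)"
  define S where "S = infsum m UNIV"
  have sm: "m summable_on UNIV" and r0: "r > 0" and S: "S * (real CARD('n) + 1) \<le> s"
    using r by (auto simp: admissible_def m_def S_def)
  have S0: "S \<ge> 0" unfolding S_def m_def using r0 by (intro infsum_nonneg) auto
  have "S \<le> S * (real CARD('n) + 1)" using S0 by (simp add: algebra_simps)
  then have Ss: "S \<le> s" using S by linarith
  have ym: "norm (y i t) \<le> m t" for t i
    unfolding norm_mult y_def m_def
    by (intro mult_mono norm_wmon_le z Finite_Cartesian_Product.norm_nth_le) (use r0 in auto)
  have "(\<lambda>u. norm (B u) * S ^ length u) summable_on UNIV"
    by (rule summable_on_comparison_test[OF word_coeff_summable[OF conv[OF k, of i]]])
       (use S0 Ss in \<open>auto simp: B_def intro!: mult_left_mono power_mono\<close>)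
  note comp = has_sum_compose_series[where y = y, OF ym sm S_def this]
  define T where "T = (\<lambda>ts. multi k (map coef ts) $ i * wmon (concat (map leaves ts)) z)"
  have "(\<Sum>u\<in>{u. length u = length ts}. B u * prod_list (map2 y u ts)) = T ts" for ts
  proof -
    have "(\<Sum>u\<in>{u. length u = length ts}. B u * prod_list (map2 y u ts))
      = (\<Sum>u\<in>{u. length u = length ts}. B u * prod_list (map2 (\<lambda>l x. x $ l) u (map coef ts)) * wmon (concat (map leaves ts)) z)"
      unfolding y_def by (intro sum.cong refl) (simp add: prod_list_map2_coef)
    then show ?thesis by (simp add: T_def multi_def B_def sum_distrib_right)
  qed
  moreover have "(\<Sum>\<^sub>\<infinity>u. B u * prod_list (map (\<lambda>i. infsum (y i) UNIV) u)) = f k (Phi z) $ i"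
  proof -
    have "infsum (y i) UNIV = Phi z $ i" for i
      unfolding y_def by (rule infsumI[OF Phi_has_sum[OF r z]])
    then have "(\<Sum>\<^sub>\<infinity>u. B u * prod_list (map (\<lambda>i. infsum (y i) UNIV) u)) = (\<Sum>\<^sub>\<infinity>u. B u * wmon u (Phi z))"
      by (simp add: wmon_def)
    also have "\<dots> = mps_eval (a k i) (Phi z)"
      unfolding B_def by (rule infsumI[OF word_coeff_eval[OF conv[OF k] norm_Phi_le[OF r z]]])
    also have "\<dots> = f k (Phi z) $ i"
      using series[OF k] norm_Phi_le[OF r z] by (simp add: series_map_def)
    finally show ?thesis .
  qed
  ultimately have T: "(T has_sum f k (Phi z) $ i) UNIV" using comp by simp
  have lin_sum: "((\<lambda>t. (A k *v coef t) $ i * wmon (leaves t) z) has_sum (A k *v Phi z) $ i) UNIV"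
    by (rule has_sum_matrix_vector) (rule Phi_has_sum[OF r z])
  have T1: "(T has_sum (A k *v Phi z) $ i) (range (\<lambda>t. [t]))"
    using lin_sum by (subst has_sum_reindex) (auto simp: inj_on_def T_def comp_def multi_single[OF k])
  have T2: "(T has_sum (f k (Phi z) $ i - (A k *v Phi z) $ i)) (UNIV - range (\<lambda>t. [t]))"
    by (rule has_sum_Diff[OF T T1]) auto
  define L2 where "L2 = range (\<lambda>(t1, t2, ts). t1 # t2 # ts :: 'n tree list)"
  define N2 where "N2 = range (\<lambda>(t1, t2, ts). Nd t1 t2 ts :: 'n tree)"
  have "(T has_sum (f k (Phi z) $ i - (A k *v Phi z) $ i)) L2"
  proof (rule has_sum_cong_neutral[THEN iffD1, OF _ _ _ T2])
    show "T ts = 0" if "ts \<in> (UNIV - range (\<lambda>t. [t])) - L2" for ts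
    proof (cases ts)
      case Nil
      then show ?thesis by (simp add: T_def multi_Nil[OF k])
    next
      case (Cons t1 us)
      then show ?thesis using that by (cases us) (auto simp: L2_def image_iff)
    qed
  qed (auto simp: L2_def)
  then have "((\<lambda>(t1, t2, ts). T (t1 # t2 # ts)) has_sum (f k (Phi z) $ i - (A k *v Phi z) $ i)) UNIV"
    unfolding L2_def by (subst (asm) has_sum_reindex) (auto simp: inj_on_def comp_def case_prod_unfold)
  then have "((\<lambda>(t1, t2, ts). nonlin k (Nd t1 t2 ts) $ i * wmon (leaves (Nd t1 t2 ts)) z)
       has_sum (f k (Phi z) $ i - (A k *v Phi z) $ i)) UNIV"
    by (simp add: T_def nonlin_def)
  then have "((\<lambda>t. nonlin k t $ i * wmon (leaves t) z) has_sum (f k (Phi z) $ i - (A k *v Phi z) $ i)) N2"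
    unfolding N2_def by (subst has_sum_reindex) (auto simp: inj_on_def comp_def case_prod_unfold simp del: leaves.simps)
  then have "((\<lambda>t. nonlin k t $ i * wmon (leaves t) z) has_sum (f k (Phi z) $ i - (A k *v Phi z) $ i)) UNIV"
  proof (rule has_sum_cong_neutral[THEN iffD1, rotated -1])
    show "nonlin k t $ i * wmon (leaves t) z = 0" if "t \<in> UNIV - N2" for t
      using that by (cases t) (auto simp: N2_def nonlin_def image_iff)
  qed auto
  from has_sum_add[OF lin_sum this] show ?thesis by (simp add: algebra_simps)
qed

section \<open>The defects of the conjugacy equations and their Taylor coefficients\<close>

definition lam_bound :: real where
  "lam_bound = 1 + (\<Sum>k<h. \<Sum>j\<in>UNIV. norm (lam k j))"

lemma norm_diagonal_le:
  assumes "k < h"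
  shows "norm (diagonal k z) \<le> lam_bound * norm z" "lam_bound \<ge> 1"
proof -
  show L1: "lam_bound \<ge> 1" by (simp add: lam_bound_def sum_nonneg)
  have "norm (lam k j) \<le> lam_bound" for j
  proof -
    have "norm (lam k j) \<le> (\<Sum>j\<in>UNIV. norm (lam k j))" by (rule member_le_sum) auto
    also have "\<dots> \<le> (\<Sum>k<h. \<Sum>j\<in>UNIV. norm (lam k j))"
      using assms by (intro member_le_sum[of k "{..<h}" "\<lambda>k. \<Sum>j\<in>UNIV. norm (lam k j)"]) (auto intro: sum_nonneg)
    finally show ?thesis by (simp add: lam_bound_def)
  qed
  then have "norm (diagonal k z) \<le> L2_set (\<lambda>j. lam_bound * norm (z $ j)) UNIV"
    unfolding norm_vec_def by (intro L2_set_mono) (auto simp: diagonal_def norm_mult intro!: mult_right_mono)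
  also have "\<dots> = lam_bound * norm z" using L1 by (simp add: norm_vec_def L2_set_right_distrib)
  finally show "norm (diagonal k z) \<le> lam_bound * norm z" .
qed

definition H :: "nat \<Rightarrow> complex^'n \<Rightarrow> complex^'n" where
  "H k z = P' *v (f k (Phi z) - Phi (diagonal k z))"

lemma H_has_sum:
  assumes k: "k < h" and r: "admissible r" and z: "lam_bound * norm z \<le> r"
  shows "((\<lambda>t. defect k t $ j * wmon (leaves t) z) has_sum H k z $ j) UNIV"
  unfolding defect_def H_def
proof (rule has_sum_matrix_vector)
  fix i
  have zr: "norm z \<le> r" using z norm_diagonal_le(2)[OF k] mult_right_mono[of 1 lam_bound "norm z"] by simp
  have dz: "norm (diagonal k z) \<le> r" using norm_diagonal_le(1)[OF k, of z] z by simp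
  have "((\<lambda>t. coef t $ i * wmon (leaves t) (diagonal k z)) has_sum Phi (diagonal k z) $ i) UNIV"
    by (rule Phi_has_sum[OF r dz])
  then have "((\<lambda>t. (lam_pow lam k (count_list (leaves t)) *s coef t) $ i * wmon (leaves t) z) has_sum Phi (diagonal k z) $ i) UNIV"
    unfolding diagonal_def wmon_diag by (simp add: mult_ac)
  from has_sum_add[OF compose_has_sum[OF k r zr, of i] has_sum_uminusI[OF this]]
  show "((\<lambda>t. (A k *v coef t + nonlin k t - lam_pow lam k (count_list (leaves t)) *s coef t) $ i * wmon (leaves t) z)
      has_sum (f k (Phi z) - Phi (diagonal k z)) $ i) UNIV"
    by (simp add: algebra_simps)
qed

definition gamma :: "nat \<Rightarrow> 'n fmap" where
  "gamma k j Q = (\<Sum>\<^sub>\<infinity>t\<in>{t. count_list (leaves t) = Q}. defect k t $ j)"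

lemma gamma_series:
  assumes k: "k < h"
  obtains r where "series_map (H k) (gamma k) r"
proof -
  obtain r0 where r0: "admissible r0" using admissible_exists by metis
  have L: "lam_bound \<ge> 1" by (rule norm_diagonal_le(2)[OF k])
  \<comment> \<open>Division by \<open>lam_bound\<close> keeps \<open>diagonal k z\<close> within
    the radius \<open>r0\<close>; division by n admits the point (r, ..., r), where summability
    yields absolute convergence of the coefficients.\<close>
  define r where "r = r0 / (lam_bound * real CARD('n))"
  have r: "r > 0" using r0 L by (simp add: r_def admissible_def)
  have rr: "lam_bound * (real CARD('n) * r) \<le> r0" using L by (simp add: r_def)
  have "(\<lambda>t. norm (defect k t $ j) * r ^ mi_deg (count_list (leaves t))) summable_on UNIV" for j
  proof -
    define z :: "complex^'n" where "z = (\<chi> i. of_real r)"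
    have "norm z \<le> (\<Sum>i\<in>UNIV. norm (z $ i))" by (rule norm_vec_le_sum)
    also have "\<dots> = real CARD('n) * r" using r by (simp add: z_def)
    finally have "lam_bound * norm z \<le> lam_bound * (real CARD('n) * r)" using L by (intro mult_left_mono) auto
    then have "((\<lambda>t. defect k t $ j * wmon (leaves t) z) has_sum H k z $ j) UNIV"
      using rr by (intro H_has_sum[OF k r0]) simp
    moreover have "wmon w z = of_real r ^ length w" for w by (induction w) (auto simp: z_def)
    ultimately have "(\<lambda>t. defect k t $ j * of_real r ^ tsize t) summable_on UNIV"
      by (auto intro: has_sum_imp_summable)
    then have "(\<lambda>t. norm (defect k t $ j * of_real r ^ tsize t)) summable_on UNIV"
      by (simp add: summable_on_iff_abs_summable_on_complex)
    then show ?thesis using r by (simp add: norm_mult norm_power mi_deg_count_list)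
  qed
  note grp = mps_group[OF r this]
  have "series_map (H k) (gamma k) r"
    unfolding series_map_def
  proof (intro conjI allI impI r)
    show "mps_conv (gamma k j) r" for j unfolding gamma_def by (rule grp(1))
    fix z :: "complex^'n" and j assume z: "norm z \<le> r"
    have "1 * r \<le> real CARD('n) * r" using r by (intro mult_right_mono) (auto simp: Suc_le_eq)
    then have "norm z \<le> real CARD('n) * r" using z by simp
    then have "lam_bound * norm z \<le> lam_bound * (real CARD('n) * r)" using L by (intro mult_left_mono) auto
    then have "lam_bound * norm z \<le> r0" using rr by simp
    from H_has_sum[OF k r0 this, of j] grp(2)[OF z, of j]
    show "H k z $ j = mps_eval (gamma k j) z"
      unfolding gamma_def by (simp add: wmon_eq_mon has_sum_unique)
  qed
  then show thesis by (rule that)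
qed

lemma gamma_low:
  assumes "k < h" "mi_deg Q < 2"
  shows "gamma k j Q = 0"
proof -
  have "defect k t $ j = 0" if "count_list (leaves t) = Q" for t
  proof (cases t)
    case (Lf i)
    then show ?thesis using defect_Lf[OF assms(1)] by simp
  next
    case (Nd t1 t2 ts)
    then show ?thesis using that assms(2) tsize_Nd_ge2[of t1 t2 ts] mi_deg_count_list[of "leaves t"] by simp
  qed
  then show ?thesis unfolding gamma_def by (intro infsum_0) auto
qed

lemma gamma_sel:
  assumes "2 \<le> mi_deg Q"
  shows "gamma (sel j Q) j Q = 0"
proof -
  have "defect (sel j Q) t $ j = 0" if "count_list (leaves t) = Q" for t
    using defect_sel[of t j] that assms mi_deg_count_list[of "leaves t"] by simp
  then show ?thesis unfolding gamma_def by (intro infsum_0) auto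
qed

section \<open>Commutativity removes the defects\<close>

lemma complex_linear_diagonal: "complex_linear (diagonal k)"
proof -
  have "diagonal k = (\<lambda>v. (\<chi> i j. if i = j then lam k i else 0) *v v)"
    by (auto simp: diagonal_def fun_eq_iff vec_eq_iff matrix_vector_mult_def if_distrib if_distribR cong: if_cong)
  then show ?thesis by (simp only: complex_linear_matrix)
qed

lemma holo_germ_f: "k < h \<Longrightarrow> holo_germ (f k) (\<lambda>v. A k *v v)"
  using series_map_holo_germ[OF series f0, of k] lin[of k] by simp

lemma f_Phi_eq: "f k (Phi z) = Phi (diagonal k z) + P *v H k z"
  by (simp add: H_def P'P_vec)

lemma diagonal_commute: "diagonal p (diagonal q z) = diagonal q (diagonal p z)"
  by (simp add: diagonal_def mult_ac)

text \<open>If the defects vanish to order \<open>m\<close>, commutativity makes their leading parts a cocycle,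
  \<open>(\<Lambda>\<^sub>q^Q - \<lambda>\<^sub>q\<^sub>j) \<gamma>\<^sub>p = (\<Lambda>\<^sub>p^Q - \<lambda>\<^sub>p\<^sub>j) \<gamma>\<^sub>q\<close>; choose \<open>q\<close> to be the selected germ.\<close>
lemma gamma_zero_step:
  assumes IH: "\<And>k j Q. k < h \<Longrightarrow> mi_deg Q < m \<Longrightarrow> gamma k j Q = 0" and m: "2 \<le> m"
    and p: "p < h" and Q0: "mi_deg Q0 = m"
  shows "gamma p j Q0 = 0"
proof -
  define q where "q = sel j Q0"
  have q: "q < h" by (simp add: q_def sel_less)
  define S where "S = {Q::'n \<Rightarrow> nat. mi_deg Q = m}"
  have finS: "finite S" unfolding S_def by (rule finite_mi_deg_eq)
  have comp: "\<forall>\<^sub>F z in nhds 0. mps_eval (gamma k i) z = H k z $ i" if k: "k < h" for k i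
  proof -
    obtain r where r: "series_map (H k) (gamma k) r" using gamma_series[OF k] by metis
    then show ?thesis by (intro eventually_nhds_0_ballI[of r]) (auto simp: series_map_def)
  qed
  have lead: "vanishes (Suc m) (\<lambda>z. H k z $ i - (\<Sum>Q\<in>S. gamma k i Q * mon Q z))" if k: "k < h" for k i
  proof -
    obtain r where r: "series_map (H k) (gamma k) r" using gamma_series[OF k] by metis
    then have "vanishes (Suc m) (\<lambda>z. mps_eval (gamma k i) z - (\<Sum>Q\<in>S. gamma k i Q * mon Q z))"
      unfolding S_def by (intro mps_eval_leading[of _ r]) (auto simp: series_map_def IH[OF k])
    then show ?thesis
      by (rule vanishes_cong[rotated]) (use comp[OF k, of i] in \<open>auto elim: eventually_mono\<close>)
  qed
  have vH: "vanishes m (H k)" if k: "k < h" for k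
  proof (rule vanishes_vec)
    fix i
    obtain r where r: "series_map (H k) (gamma k) r" using gamma_series[OF k] by metis
    then have "vanishes m (mps_eval (gamma k i))"
      by (intro mps_eval_vanishes[of _ r]) (auto simp: series_map_def IH[OF k])
    then show "vanishes m (\<lambda>z. H k z $ i)"
      by (rule vanishes_cong[OF comp[OF k, of i]])
  qed
  have bl: "bounded_linear (\<lambda>v. M *v v)" for M :: "complex^'n^'n"
    using complex_linear_matrix[of M] by (simp add: complex_linear_def)
  have vPhi: "vanishes 1 Phi" by (rule holo_germ_vanishes[OF holo_germ_Phi])
  have vdiag: "vanishes 1 (diagonal k)" for k
    by (rule holo_germ_vanishes[OF holo_germ_linear[OF complex_linear_diagonal]])
  \<comment> \<open>f_l(Phi z) differs from Phi(D_l z) by P H_l(z) = O(|z|^m), with D_l the diagonal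
    map, so modulo O(|z|^(m+1)) applying f_k adds just A_k P H_l(z). The main term f_k(Phi(D_l z))
    is then rewritten by means of H_k at D_l z.\<close>
  have exp: "vanishes (Suc m) (\<lambda>z. f k (f l (Phi z)) -
      (Phi (diagonal k (diagonal l z)) + P *v H k (diagonal l z) + A k *v (P *v H l z)))" if k: "k < h" and l: "l < h" for k l
  proof -
    have "vanishes (Suc m) (\<lambda>z. f k (f l (Phi z)) - f k (Phi (diagonal l z))
        - linear_part (a k) *v (f l (Phi z) - Phi (diagonal l z)))"
    proof (rule series_map_nonlinear_vanishes[OF series[OF k]])
      show "vanishes 1 (\<lambda>z. f l (Phi z))"
        by (rule vanishes_compose[OF holo_germ_vanishes[OF holo_germ_f[OF l]] vPhi])
      show "vanishes 1 (\<lambda>z. Phi (diagonal l z))" by (rule vanishes_compose[OF vPhi vdiag])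
      show "vanishes m (\<lambda>z. f l (Phi z) - Phi (diagonal l z))"
        using vanishes_bounded_linear[OF bl[of P] vH[OF l]] by (simp add: f_Phi_eq)
    qed
    then show ?thesis by (simp add: f_Phi_eq lin[OF k] diff_diff_eq)
  qed
  have ev: "\<forall>\<^sub>F z in nhds 0. f p (f q (Phi z)) = f q (f p (Phi z))"
    by (rule holo_germ_eventually[OF holo_germ_Phi commute[OF p q]])
  \<comment> \<open>Both orders of composition have the main term Phi(D_p D_q z); it cancels, and
    commutativity becomes a relation among the defects alone.\<close>
  have "vanishes (Suc m) (\<lambda>z. (P *v H p (diagonal q z) + A p *v (P *v H q z))
      - (P *v H q (diagonal p z) + A q *v (P *v H p z)))"
  proof (rule vanishes_cong[OF _ vanishes_diff[OF exp[OF q p] exp[OF p q]]], use ev in eventually_elim)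
    case (elim z)
    show ?case by (simp add: elim diagonal_commute[of p q])
  qed
  from vanishes_nth[OF vanishes_bounded_linear[OF bl[of P'] this], of j]
  have van: "vanishes (Suc m) (\<lambda>z. (H p (diagonal q z) $ j + lam p j * H q z $ j)
      - (H q (diagonal p z) $ j + lam q j * H p z $ j))"
    by (simp add: matrix_vector_mult_diff_distrib matrix_vector_right_distrib P'P_vec diag[OF p] diag[OF q])
  define c where "c = (\<lambda>Q. gamma p j Q * (lam_pow lam q Q - lam q j) - gamma q j Q * (lam_pow lam p Q - lam p j))"
  have monD: "mon Q (diagonal k z) = lam_pow lam k Q * mon Q z" for Q k z
    using wmon_diag[of "index_word Q" lam k z] by (simp add: diagonal_def mon_eq_wmon)
  have lead1: "vanishes (Suc m) (\<lambda>z. H k (diagonal l z) $ j - (\<Sum>Q\<in>S. gamma k j Q * (lam_pow lam l Q * mon Q z)))" if "k < h" for k l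
    using vanishes_compose[OF lead[OF that, of j] vdiag[of l]] by (simp add: monD)
  have sc: "vanishes (Suc m) (\<lambda>z. c * g z)" if "vanishes (Suc m) g" for g :: "complex^'n \<Rightarrow> complex" and c
    by (rule vanishes_bounded_linear[OF bounded_linear_mult_right that])
  have "vanishes (Suc m) (\<lambda>z. ((H p (diagonal q z) $ j + lam p j * H q z $ j)
      - (H q (diagonal p z) $ j + lam q j * H p z $ j))
      - ((H p (diagonal q z) $ j - (\<Sum>Q\<in>S. gamma p j Q * (lam_pow lam q Q * mon Q z)))
        + lam p j * (H q z $ j - (\<Sum>Q\<in>S. gamma q j Q * mon Q z))
        - (H q (diagonal p z) $ j - (\<Sum>Q\<in>S. gamma q j Q * (lam_pow lam p Q * mon Q z)))
        - lam q j * (H p z $ j - (\<Sum>Q\<in>S. gamma p j Q * mon Q z))))"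
    by (intro vanishes_diff vanishes_add van lead1 sc lead p q)
  also have "(\<lambda>z. ((H p (diagonal q z) $ j + lam p j * H q z $ j)
      - (H q (diagonal p z) $ j + lam q j * H p z $ j))
      - ((H p (diagonal q z) $ j - (\<Sum>Q\<in>S. gamma p j Q * (lam_pow lam q Q * mon Q z)))
        + lam p j * (H q z $ j - (\<Sum>Q\<in>S. gamma q j Q * mon Q z))
        - (H q (diagonal p z) $ j - (\<Sum>Q\<in>S. gamma q j Q * (lam_pow lam p Q * mon Q z)))
        - lam q j * (H p z $ j - (\<Sum>Q\<in>S. gamma p j Q * mon Q z)))) = (\<lambda>z. \<Sum>Q\<in>S. c Q * mon Q z)"
    by (auto simp: c_def algebra_simps sum.distrib sum_subtractf sum_distrib_left)
  finally have "\<forall>Q\<in>S. c Q = 0"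
    by (intro homogeneous_vanishes_imp_zero[OF finS, of m]) (auto simp: S_def)
  then have "c Q0 = 0" using Q0 by (simp add: S_def)
  moreover have "gamma q j Q0 = 0" unfolding q_def using gamma_sel m Q0 by simp
  moreover have "lam_pow lam q Q0 - lam q j \<noteq> 0"
    using divisor_sel(2)[of "index_word Q0" j] m Q0 by (simp add: divisor_def q_def)
  ultimately show ?thesis by (simp add: c_def)
qed

lemma gamma_zero: "k < h \<Longrightarrow> gamma k j Q = 0"
proof (induction "mi_deg Q" arbitrary: k j Q rule: less_induct)
  case less
  show ?case
  proof (cases "mi_deg Q < 2")
    case True
    then show ?thesis using gamma_low less.prems by blast
  next
    case False
    show ?thesis
      by (rule gamma_zero_step[of "mi_deg Q"]) (use less False in auto)
  qed
qed

lemma Phi_linearizes: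
  assumes "k < h"
  shows "\<forall>\<^sub>F z in nhds 0. f k (Phi z) = Phi (diagonal k z)"
proof -
  obtain r where r: "series_map (H k) (gamma k) r" using gamma_series[OF assms] by metis
  have "H k z = 0" if "norm z < r" for z
    using r that gamma_zero[OF assms] by (simp add: series_map_def mps_eval_def vec_eq_iff)
  then show ?thesis
    using r by (intro eventually_nhds_0_ballI[of r]) (auto simp: f_Phi_eq series_map_def)
qed

theorem sim_linearizable: "sim_holo_linearizable f h"
proof -
  obtain g where g: "biholo_germ0_inv Phi g"
    using holo_germ_inverse[OF holo_germ_Phi complex_linear_matrix[of P']] P'P_vec by metis
  then obtain U where U: "open U" "0 \<in> U" "\<And>z. z \<in> U \<Longrightarrow> g (Phi z) = z"
    unfolding biholo_germ0_inv_def by blast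
  have evU: "\<forall>\<^sub>F z in nhds 0. z \<in> U" using U by (metis eventually_nhds)
  have "\<exists>B::complex^'n^'n. \<forall>\<^sub>F z in nhds 0. g (f k (Phi z)) = B *v z" if k: "k < h" for k
  proof
    have "\<forall>\<^sub>F z in nhds 0. diagonal k z \<in> U"
      by (rule holo_germ_eventually[OF holo_germ_linear[OF complex_linear_diagonal] evU])
    with Phi_linearizes[OF k]
    show "\<forall>\<^sub>F z in nhds 0. g (f k (Phi z)) = (\<chi> i j. if i = j then lam k i else 0) *v z"
    proof eventually_elim
      case (elim z)
      then have "g (f k (Phi z)) = diagonal k z" using U(3) by simp
      also have "\<dots> = (\<chi> i j. if i = j then lam k i else 0) *v z"
        by (auto simp: diagonal_def vec_eq_iff matrix_vector_mult_def if_distrib if_distribR cong: if_cong)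
      finally show ?case .
    qed
  qed
  then show ?thesis unfolding sim_holo_linearizable_def using g by blast
qed

end

section \<open>Scalar linear parts of finite order\<close>

definition mps_trunc :: "nat \<Rightarrow> 'n::finite mps \<Rightarrow> complex^'n \<Rightarrow> complex" where
  "mps_trunc m a z = (\<Sum>Q\<in>{Q. mi_deg Q \<le> m}. a Q * mon Q z)"

text \<open>A Taylor expansion to order m of a map that need not be analytic. It links formal
  composition of possibly divergent series with honest maps modulo O(|z|^(m+1)).\<close>

definition expands :: "nat \<Rightarrow> (complex^'n::finite \<Rightarrow> complex) \<Rightarrow> 'n mps \<Rightarrow> bool" where
  "expands m f a \<longleftrightarrow> vanishes (Suc m) (\<lambda>z. f z - mps_trunc m a z)"

lemma vanishes_mon: "vanishes (mi_deg Q) (mon Q)"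
  by (rule vanishesI[where C = 1]) (simp add: norm_mon_le)

lemma vanishes_cmult: "vanishes m g \<Longrightarrow> vanishes m (\<lambda>z. c * g z)" for g :: "'a::real_normed_vector \<Rightarrow> complex"
  by (rule vanishes_bounded_linear[OF bounded_linear_mult_right])

lemma vanishes_mps_trunc:
  assumes "\<And>Q. mi_deg Q < k \<Longrightarrow> a Q = 0"
  shows "vanishes k (mps_trunc m a)"
  unfolding mps_trunc_def
proof (rule vanishes_sum)
  fix Q :: "'a \<Rightarrow> nat"
  show "vanishes k (\<lambda>z. a Q * mon Q z)"
  proof (cases "mi_deg Q < k")
    case False
    then show ?thesis by (intro vanishes_cmult vanishes_mono[OF vanishes_mon]) simp
  qed (simp add: assms)
qed

lemma expands_vanishes_0:
  assumes "expands m f a"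
  shows "vanishes 0 f"
  using vanishes_add[OF vanishes_mono[OF assms[unfolded expands_def], of 0] vanishes_mps_trunc[of 0 a m]] by simp

lemma expands_mps_trunc: "expands m (mps_trunc m a) a"
  by (simp add: expands_def)

lemma expands_mps_eval:
  assumes "mps_conv a r"
  shows "expands m (mps_eval a) a"
proof -
  have r: "r > 0" using assms by (simp add: mps_conv_def)
  define b where "b = (\<lambda>Q. if Q \<in> {Q. mi_deg Q \<le> m} then 0 else a Q)"
  have "vanishes (Suc m) (mps_eval b)"
  proof (rule mps_eval_vanishes)
    show "mps_conv b r" by (rule mps_conv_smaller[OF assms]) (auto simp: b_def)
  qed (auto simp: b_def)
  moreover have "\<forall>\<^sub>F z in nhds 0. mps_eval b z = mps_eval a z - mps_trunc m a z"
  proof (rule eventually_nhds_0_ballI[OF r])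
    fix z :: "complex^'a" assume "norm z < r"
    then show "mps_eval b z = mps_eval a z - mps_trunc m a z"
      using mps_eval_split[OF assms finite_mi_deg_le[of m], of z] by (simp add: b_def mps_trunc_def)
  qed
  ultimately show ?thesis unfolding expands_def by (rule vanishes_cong[rotated])
qed

lemma expands_one: "expands m (\<lambda>z. 1) mps_one"
proof -
  have "mps_trunc m mps_one z = 1" for z :: "complex^'a"
  proof -
    have "mps_trunc m mps_one z = (\<Sum>Q\<in>{Q::'a \<Rightarrow> nat. mi_deg Q \<le> m}. if Q = (\<lambda>_. 0) then 1 else 0)"
      unfolding mps_trunc_def by (intro sum.cong) (auto simp: mps_one_def mon_0)
    also have "\<dots> = (if (\<lambda>_. 0) \<in> {Q::'a \<Rightarrow> nat. mi_deg Q \<le> m} then 1 else 0)"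
      by (rule sum.delta[OF finite_mi_deg_le])
    also have "\<dots> = 1" by (simp add: mi_deg_def)
    finally show ?thesis .
  qed
  then show ?thesis by (simp add: expands_def)
qed

lemma mon_add: "mon (\<lambda>i. P i + R i) z = mon P z * mon R z"
  by (simp add: mon_def power_add prod.distrib)

lemma mi_deg_add: "mi_deg (\<lambda>i. P i + R i) = mi_deg P + mi_deg R"
  by (simp add: mi_deg_def sum.distrib)

lemma mps_trunc_mult:
  "mps_trunc m (mps_mult a b) z
    = (\<Sum>(P, R)\<in>{(P, R). mi_deg P + mi_deg R \<le> m}. (a P * mon P z) * (b R * mon R z))"
proof -
  have fin: "finite {P::'a \<Rightarrow> nat. \<forall>i. P i \<le> Q i}" for Q
    by (rule finite_subset[OF _ finite_mi_deg_le[of "mi_deg Q"]]) (auto simp: mi_deg_def intro: sum_mono)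
  have sub: "(\<lambda>i. P i + (Q i - P i)) = Q" if "\<forall>i. P i \<le> Q i" for P Q :: "'a \<Rightarrow> nat"
    using that by (simp add: fun_eq_iff)
  have "mps_trunc m (mps_mult a b) z
    = (\<Sum>Q\<in>{Q. mi_deg Q \<le> m}. \<Sum>P\<in>{P. \<forall>i. P i \<le> Q i}. (a P * mon P z) * (b (\<lambda>i. Q i - P i) * mon (\<lambda>i. Q i - P i) z))"
    unfolding mps_trunc_def mps_mult_def sum_distrib_right
  proof (intro sum.cong refl)
    fix Q P :: "'a \<Rightarrow> nat" assume "P \<in> {P. \<forall>i. P i \<le> Q i}"
    then have "mon Q z = mon P z * mon (\<lambda>i. Q i - P i) z" by (simp add: sub flip: mon_add)
    then show "a P * b (\<lambda>i. Q i - P i) * mon Q z = (a P * mon P z) * (b (\<lambda>i. Q i - P i) * mon (\<lambda>i. Q i - P i) z)"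
      by simp
  qed
  also have "\<dots> = (\<Sum>(Q, P)\<in>(SIGMA Q:{Q. mi_deg Q \<le> m}. {P. \<forall>i. P i \<le> Q i}).
      (a P * mon P z) * (b (\<lambda>i. Q i - P i) * mon (\<lambda>i. Q i - P i) z))"
    by (rule sum.Sigma) (auto simp: finite_mi_deg_le fin)
  also have "\<dots> = (\<Sum>(P, R)\<in>{(P, R). mi_deg P + mi_deg R \<le> m}. (a P * mon P z) * (b R * mon R z))"
  proof (rule sum.reindex_bij_witness[of _ "\<lambda>(P, R). (\<lambda>i. P i + R i, P)" "\<lambda>(Q, P). (P, \<lambda>i. Q i - P i)"])
    fix QP :: "('a \<Rightarrow> nat) \<times> ('a \<Rightarrow> nat)"
    assume "QP \<in> (SIGMA Q:{Q. mi_deg Q \<le> m}. {P. \<forall>i. P i \<le> Q i})"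
    then obtain Q P where QP: "QP = (Q, P)" "mi_deg Q \<le> m" "\<forall>i. P i \<le> Q i" by auto
    show "(case case QP of (Q, P) \<Rightarrow> (P, \<lambda>i. Q i - P i) of (P, R) \<Rightarrow> (\<lambda>i. P i + R i, P)) = QP"
      using sub[OF QP(3)] QP(1) by simp
    show "(case QP of (Q, P) \<Rightarrow> (P, \<lambda>i. Q i - P i)) \<in> {(P, R). mi_deg P + mi_deg R \<le> m}"
      using QP(2) sub[OF QP(3)] by (simp add: QP(1) flip: mi_deg_add)
  qed (auto simp: mi_deg_add)
  finally show ?thesis .
qed

lemma expands_mult:
  assumes f: "expands m f a" and g: "expands m g b"
  shows "expands m (\<lambda>z. f z * g z) (mps_mult a b)"
proof -
  define D where "D = {Q::'a \<Rightarrow> nat. mi_deg Q \<le> m}"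
  have finD: "finite D" unfolding D_def by (rule finite_mi_deg_le)
  \<comment> \<open>The pairs of total degree above m: products that truncation drops, each of order
    at least m + 1.\<close>
  define E where "E = (D \<times> D) - {(P, R). mi_deg P + mi_deg R \<le> m}"
  have "mps_trunc m a z * mps_trunc m b z - mps_trunc m (mps_mult a b) z
     = (\<Sum>(P, R)\<in>E. (a P * mon P z) * (b R * mon R z))" for z
  proof -
    have "mps_trunc m a z * mps_trunc m b z = (\<Sum>(P, R)\<in>D \<times> D. (a P * mon P z) * (b R * mon R z))"
      unfolding mps_trunc_def D_def[symmetric] by (simp add: sum_product sum.cartesian_product)
    also have "\<dots> = (\<Sum>(P, R)\<in>E. (a P * mon P z) * (b R * mon R z))
       + (\<Sum>(P, R)\<in>{(P, R). mi_deg P + mi_deg R \<le> m}. (a P * mon P z) * (b R * mon R z))"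
      unfolding E_def by (rule sum.subset_diff) (use finD in \<open>auto simp: D_def\<close>)
    finally show ?thesis by (simp add: mps_trunc_mult)
  qed
  moreover have "vanishes (Suc m) (\<lambda>z. \<Sum>(P, R)\<in>E. (a P * mon P z) * (b R * mon R z))"
  proof (rule vanishes_sum)
    fix PR assume "PR \<in> E"
    then obtain P R where PR: "PR = (P, R)" "Suc m \<le> mi_deg P + mi_deg R" by (auto simp: E_def)
    have "vanishes (mi_deg P + mi_deg R) (\<lambda>z. (a P * mon P z) * (b R * mon R z))"
      by (intro vanishes_mult vanishes_cmult vanishes_mon)
    from vanishes_mono[OF this PR(2)]
    show "vanishes (Suc m) (\<lambda>z. case PR of (P, R) \<Rightarrow> (a P * mon P z) * (b R * mon R z))"
      by (simp add: PR(1))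
  qed
  ultimately have 1: "vanishes (Suc m) (\<lambda>z. mps_trunc m a z * mps_trunc m b z - mps_trunc m (mps_mult a b) z)"
    by simp
  have 2: "vanishes (Suc m + 0) (\<lambda>z. (f z - mps_trunc m a z) * g z)"
    using f by (intro vanishes_mult expands_vanishes_0[OF g]) (simp add: expands_def)
  have 3: "vanishes (0 + Suc m) (\<lambda>z. mps_trunc m a z * (g z - mps_trunc m b z))"
    using g by (intro vanishes_mult vanishes_mps_trunc) (auto simp: expands_def)
  have "vanishes (Suc m) (\<lambda>z. (f z - mps_trunc m a z) * g z + mps_trunc m a z * (g z - mps_trunc m b z)
      + (mps_trunc m a z * mps_trunc m b z - mps_trunc m (mps_mult a b) z))"
    using 1 2 3 by (intro vanishes_add) auto
  then show ?thesis by (simp add: expands_def algebra_simps)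
qed

lemma fmap_monpow_eq: "fmap_monpow \<phi> P = foldr mps_mult (map \<phi> (index_word P)) mps_one"
  by (simp add: fmap_monpow_def mps_prod_list_def index_word_def map_concat comp_def)

lemma expands_monpow:
  assumes "\<And>i. expands m (\<lambda>z. Y z $ i) (\<phi> i)"
  shows "expands m (\<lambda>z. mon P (Y z)) (fmap_monpow \<phi> P)"
proof -
  have "expands m (\<lambda>z. wmon w (Y z)) (foldr mps_mult (map \<phi> w) mps_one)" for w
    by (induction w) (auto intro: expands_one expands_mult assms)
  then show ?thesis by (simp add: mon_eq_wmon fmap_monpow_eq)
qed

text \<open>A product of series without constant terms has order at least the number of factors.
  Hence the cutoff |P| <= |Q| in \<open>mps_comp\<close> discards only zeros, and the sum may be
  extended to all |P| <= m.\<close>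

lemma foldr_mps_mult_low:
  assumes \<phi>: "fmap_fixes0 \<phi>" and "mi_deg Q < length w"
  shows "foldr mps_mult (map \<phi> w) mps_one Q = 0"
  using assms(2)
proof (induction w arbitrary: Q)
  case (Cons i w)
  have "\<phi> i P * foldr mps_mult (map \<phi> w) mps_one (\<lambda>j. Q j - P j) = 0" if P: "\<forall>j. P j \<le> Q j" for P
  proof (cases "P = (\<lambda>_. 0)")
    case True
    then show ?thesis using \<phi> by (simp add: fmap_fixes0_def)
  next
    case False
    have "mi_deg Q = mi_deg P + mi_deg (\<lambda>j. Q j - P j)"
      using P by (simp flip: mi_deg_add)
    moreover have "mi_deg P > 0" using False mi_deg_eq_0_iff by blast
    ultimately have "mi_deg (\<lambda>j. Q j - P j) < length w" using Cons.prems by simp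
    then show ?thesis using Cons.IH by simp
  qed
  then have "mps_mult (\<phi> i) (foldr mps_mult (map \<phi> w) mps_one) Q = 0"
    unfolding mps_mult_def[of "\<phi> i"] by (intro sum.neutral) blast
  then show ?case by simp
qed simp

text \<open>First G is replaced by its Taylor polynomial, then every monomial in Y by the truncation
  of the corresponding formal power; both errors are O(|z|^(m+1)).\<close>

lemma expands_comp:
  assumes G: "expands m G a" and Y: "\<And>i. expands m (\<lambda>z. Y z $ i) (\<phi> i)"
    and \<phi>: "fmap_fixes0 \<phi>" and van: "vanishes 1 Y"
  shows "expands m (\<lambda>z. G (Y z)) (mps_comp a \<phi>)"
proof -
  define D where "D = {Q::'a \<Rightarrow> nat. mi_deg Q \<le> m}"
  have 1: "vanishes (Suc m) (\<lambda>z. G (Y z) - mps_trunc m a (Y z))"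
    using vanishes_compose[OF G[unfolded expands_def] van] .
  have 2: "vanishes (Suc m) (\<lambda>z. \<Sum>P\<in>D. a P * (mon P (Y z) - mps_trunc m (fmap_monpow \<phi> P) z))"
    using expands_monpow[of m Y \<phi>, OF Y] by (intro vanishes_sum vanishes_cmult) (simp add: expands_def)
  have "mps_trunc m (mps_comp a \<phi>) z = (\<Sum>P\<in>D. a P * mps_trunc m (fmap_monpow \<phi> P) z)" for z
  proof -
    have "mps_trunc m (mps_comp a \<phi>) z = (\<Sum>Q\<in>D. \<Sum>P\<in>D. a P * (fmap_monpow \<phi> P Q * mon Q z))"
      unfolding mps_trunc_def D_def[symmetric] mps_comp_def sum_distrib_right
    proof (rule sum.cong[OF refl])
      fix Q assume Q: "Q \<in> D"
      show "(\<Sum>P\<in>{P. mi_deg P \<le> mi_deg Q}. a P * fmap_monpow \<phi> P Q * mon Q z) = (\<Sum>P\<in>D. a P * (fmap_monpow \<phi> P Q * mon Q z))"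
      proof (rule sum.mono_neutral_cong_left)
        show "finite D" unfolding D_def by (rule finite_mi_deg_le)
        show "\<forall>P\<in>D - {P. mi_deg P \<le> mi_deg Q}. a P * (fmap_monpow \<phi> P Q * mon Q z) = 0"
          using foldr_mps_mult_low[OF \<phi>] by (auto simp: fmap_monpow_eq)
      qed (use Q in \<open>auto simp: D_def mult_ac\<close>)
    qed
    also have "\<dots> = (\<Sum>P\<in>D. \<Sum>Q\<in>D. a P * (fmap_monpow \<phi> P Q * mon Q z))" by (rule sum.swap)
    finally show ?thesis unfolding mps_trunc_def D_def[symmetric] by (simp add: sum_distrib_left)
  qed
  then have eq: "G (Y z) - mps_trunc m (mps_comp a \<phi>) z = (G (Y z) - mps_trunc m a (Y z))
      + (\<Sum>P\<in>D. a P * (mon P (Y z) - mps_trunc m (fmap_monpow \<phi> P) z))" for z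
    by (simp add: mps_trunc_def[of m a "Y z"] D_def[symmetric] right_diff_distrib sum_subtractf)
  show ?thesis unfolding expands_def eq by (rule vanishes_add[OF 1 2])
qed

definition map_expands :: "nat \<Rightarrow> (complex^'n::finite \<Rightarrow> complex^'n) \<Rightarrow> 'n fmap \<Rightarrow> bool" where
  "map_expands m F a \<longleftrightarrow> (\<forall>i. expands m (\<lambda>z. F z $ i) (a i))"

definition map_trunc :: "nat \<Rightarrow> 'n::finite fmap \<Rightarrow> complex^'n \<Rightarrow> complex^'n" where
  "map_trunc m a z = (\<chi> i. mps_trunc m (a i) z)"

lemma map_expands_comp:
  assumes "map_expands m G g" "map_expands m Y \<phi>" "fmap_fixes0 \<phi>" "vanishes 1 Y"
  shows "map_expands m (\<lambda>z. G (Y z)) (fmap_comp g \<phi>)"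
  using assms unfolding map_expands_def fmap_comp_def by (auto intro: expands_comp)

lemma map_expands_trunc: "map_expands m (map_trunc m a) a"
  by (simp add: map_expands_def map_trunc_def expands_mps_trunc)

lemma map_expands_unique:
  assumes "map_expands m F a" "map_expands m G a"
  shows "vanishes (Suc m) (\<lambda>z. F z - G z)"
proof (rule vanishes_vec)
  fix i
  show "vanishes (Suc m) (\<lambda>z. (F z - G z) $ i)"
    using vanishes_diff[of "Suc m" "\<lambda>z. F z $ i - mps_trunc m (a i) z" "\<lambda>z. G z $ i - mps_trunc m (a i) z"] assms
    by (simp add: map_expands_def expands_def)
qed

lemma map_expands_lin:
  assumes "1 \<le> m"
  shows "map_expands m (\<lambda>z. B *v z) (fmap_lin B)"
  unfolding map_expands_def expands_def
proof
  fix i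
  have inj: "inj mi_unit" by (rule inj_mi_unit)
  have "mps_trunc m (fmap_lin B i) z = (B *v z) $ i" for z
  proof -
    have z: "fmap_lin B i Q = 0" if "Q \<notin> range mi_unit" for Q using that by (auto simp: fmap_lin_def intro!: sum.neutral)
    have u: "fmap_lin B i (mi_unit j) = B $ i $ j" for j
      by (simp add: fmap_lin_def inj_eq[OF inj] if_distrib[of "\<lambda>x. _ * x"] cong: if_cong)
    have "mps_trunc m (fmap_lin B i) z = (\<Sum>Q\<in>range mi_unit. fmap_lin B i Q * mon Q z)"
      unfolding mps_trunc_def
    proof (rule sum.mono_neutral_right[OF finite_mi_deg_le])
      show "range mi_unit \<subseteq> {Q. mi_deg Q \<le> m}" using assms mi_deg_eq_1_iff by (auto, metis)
    qed (use z in auto)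
    also have "\<dots> = (\<Sum>j\<in>UNIV. B $ i $ j * z $ j)" by (simp add: sum.reindex[OF inj] u mon_unit)
    finally show ?thesis by (simp add: matrix_vector_mult_def)
  qed
  then show "vanishes (Suc m) (\<lambda>z. (B *v z) $ i - mps_trunc m (fmap_lin B i) z)" by simp
qed

lemma fmap_lin_id: "fmap_lin (mat 1) = fmap_id"
proof (intro ext)
  fix i :: 'a and Q
  have "fmap_lin (mat 1) i Q = (\<Sum>j\<in>UNIV. if j = i then (if Q = mi_unit i then 1 else 0) else 0)"
    unfolding fmap_lin_def by (intro sum.cong) (auto simp: mat_def)
  then show "fmap_lin (mat 1) i Q = fmap_id i Q" by (simp add: fmap_id_def)
qed

lemma holo_germ_map_trunc:
  assumes "fmap_fixes0 \<phi>"
  obtains L where "holo_germ (map_trunc m \<phi>) L"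
proof -
  define b where "b = (\<lambda>i Q. if mi_deg Q \<le> m then \<phi> i Q else 0)"
  have sup: "((\<lambda>Q. b i Q * mon Q z) has_sum mps_trunc m (\<phi> i) z) UNIV" for i z
    unfolding mps_trunc_def
    by (rule has_sum_cong_neutral[THEN iffD1, OF _ _ _ has_sum_finite[OF finite_mi_deg_le[of m]]])
       (auto simp: b_def)
  have "series_map (map_trunc m \<phi>) b 1"
    unfolding series_map_def
  proof (intro conjI allI impI)
    fix i
    have "((\<lambda>Q. norm (b i Q) * 1 ^ mi_deg Q) has_sum (\<Sum>Q\<in>{Q. mi_deg Q \<le> m}. norm (\<phi> i Q))) UNIV"
      by (rule has_sum_cong_neutral[THEN iffD1, OF _ _ _ has_sum_finite[OF finite_mi_deg_le[of m]]])
         (auto simp: b_def)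
    then show "mps_conv (b i) 1" by (auto simp: mps_conv_def summable_on_def)
  next
    fix z i
    show "map_trunc m \<phi> z $ i = mps_eval (b i) z"
      using infsumI[OF sup[of i z]] by (simp add: map_trunc_def mps_eval_def)
  qed simp
  moreover have "map_trunc m \<phi> 0 = 0"
  proof -
    have "\<phi> i Q * mon Q 0 = 0" for i Q
    proof (cases "Q = (\<lambda>_. 0)")
      case True
      then show ?thesis using assms by (simp add: fmap_fixes0_def)
    next
      case False
      then obtain j where "Q j \<noteq> 0" by (metis ext)
      then show ?thesis by (auto simp: mon_def)
    qed
    then show ?thesis by (simp add: map_trunc_def mps_trunc_def vec_eq_iff sum.neutral del: mult_eq_0_iff)
  qed
  ultimately show thesis using series_map_holo_germ that by blast
qed

text \<open>A germ with scalar linear part \<open>c\<close> that is formally conjugate to a linear map is, to every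
  order, conjugate to multiplication by \<open>c\<close>; the conjugacies are truncations of the formal one.\<close>
lemma formally_linearizable_scalar:
  fixes f :: "complex^'n::finite \<Rightarrow> complex^'n"
  assumes ps: "has_power_series_at0 f a" and flin: "formally_linearizable a"
    and f: "holo_germ f (\<lambda>v. c *s v)" and m: "1 \<le> m"
  obtains \<Phi> \<Psi> L M where "holo_germ \<Phi> L" "holo_germ \<Psi> M"
    "vanishes (Suc m) (\<lambda>z. \<Phi> (\<Psi> z) - z)" "vanishes (Suc m) (\<lambda>z. f (\<Phi> z) - \<Phi> (c *s z))"
proof -
  obtain \<phi> \<psi> B where \<phi>: "fmap_fixes0 \<phi>" and \<psi>: "fmap_fixes0 \<psi>"
    and \<psi>\<phi>: "fmap_comp \<psi> \<phi> = fmap_id" and \<phi>\<psi>: "fmap_comp \<phi> \<psi> = fmap_id"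
    and B: "fmap_comp \<psi> (fmap_comp a \<phi>) = fmap_lin B"
    using flin unfolding formally_linearizable_def by blast
  define \<Phi> \<Psi> where "\<Phi> = map_trunc m \<phi>" and "\<Psi> = map_trunc m \<psi>"
  obtain L where L: "holo_germ \<Phi> L" using holo_germ_map_trunc[OF \<phi>] unfolding \<Phi>_def by metis
  obtain M where M: "holo_germ \<Psi> M" using holo_germ_map_trunc[OF \<psi>] unfolding \<Psi>_def by metis
  note v1 = holo_germ_vanishes[OF L] holo_germ_vanishes[OF M] holo_germ_vanishes[OF f]
  obtain r where r: "r > 0" "\<And>i. mps_conv (a i) r" "\<And>z i. norm z \<le> r \<Longrightarrow> f z $ i = mps_eval (a i) z"
    using has_power_series_at0_eval[OF ps] by metis
  have fa: "map_expands m f a"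
    unfolding map_expands_def
  proof
    fix i
    have "vanishes (Suc m) (\<lambda>z. mps_eval (a i) z - mps_trunc m (a i) z)"
      using expands_mps_eval[OF r(2)] by (simp add: expands_def)
    then show "expands m (\<lambda>z. f z $ i) (a i)"
      unfolding expands_def
      by (rule vanishes_cong[rotated]) (rule eventually_nhds_0_ballI[OF r(1)], simp add: r(3))
  qed
  have a\<phi>: "map_expands m (\<lambda>z. f (\<Phi> z)) (fmap_comp a \<phi>)"
    unfolding \<Phi>_def by (rule map_expands_comp[OF fa map_expands_trunc \<phi>]) (use v1 \<Phi>_def in simp)
  have fix0: "fmap_fixes0 (fmap_comp a \<phi>)"
  proof -
    have "{P::'n \<Rightarrow> nat. mi_deg P = 0} = {\<lambda>_. 0}" by (auto simp: mi_deg_eq_0_iff)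
    moreover have "a i (\<lambda>_. 0) = 0" for i
      using r(3)[of 0 i] r(1) f mps_eval_0[OF r(2), of i] by (simp add: holo_germ_def)
    ultimately show ?thesis
      by (simp add: fmap_fixes0_def fmap_comp_def mps_comp_def mi_deg_eq_0_iff[THEN iffD2])
  qed
  have "map_expands m (\<lambda>z. \<Psi> (f (\<Phi> z))) (fmap_lin B)"
    using map_expands_comp[OF map_expands_trunc a\<phi> fix0 vanishes_compose[OF v1(3,1)], of \<psi>]
    unfolding B \<Psi>_def .
  from map_expands_unique[OF this map_expands_lin[OF m]]
  have conj: "vanishes (Suc m) (\<lambda>z. \<Psi> (f (\<Phi> z)) - B *v z)" .
  have id: "map_expands m (\<lambda>z. z) fmap_id"
    using map_expands_lin[OF m, of "mat 1"] by (simp add: fmap_lin_id)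
  have "map_expands m (\<lambda>z. \<Phi> (\<Psi> z)) fmap_id"
    using map_expands_comp[OF map_expands_trunc map_expands_trunc \<psi>, of m \<phi>] v1(2)
    unfolding \<phi>\<psi> \<Phi>_def \<Psi>_def by blast
  from map_expands_unique[OF this id] have \<Phi>\<Psi>: "vanishes (Suc m) (\<lambda>z. \<Phi> (\<Psi> z) - z)" .
  have "map_expands m (\<lambda>z. \<Psi> (\<Phi> z)) fmap_id"
    using map_expands_comp[OF map_expands_trunc map_expands_trunc \<phi>, of m \<psi>] v1(1)
    unfolding \<psi>\<phi> \<Phi>_def \<Psi>_def by blast
  from map_expands_unique[OF this id] have \<Psi>\<Phi>: "vanishes (Suc m) (\<lambda>z. \<Psi> (\<Phi> z) - z)" .
  have der: "G = (\<lambda>v. N *v v)" if "holo_germ g G" "vanishes (Suc m) (\<lambda>z. g z - N *v z)" for g G N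
  proof (rule holo_germ_derivative_unique[OF that(1)])
    have "vanishes 2 (\<lambda>z. g z - N *v z)" using vanishes_mono[OF that(2)] m by simp
    then show "(g has_derivative (\<lambda>v. N *v v)) (at 0)"
      using that(1) complex_linear_matrix[of N]
      by (intro has_derivative_of_vanishes) (auto simp: holo_germ_def complex_linear_def)
  qed
  \<comment> \<open>Comparing linear parts gives M L = 1 and B = M c L; as M is complex linear, the
    formal normal form is again multiplication by c.\<close>
  have invL: "M (L v) = v" for v
    using der[OF holo_germ_compose[OF M L], of "mat 1"] \<Psi>\<Phi> by (simp add: fun_eq_iff)
  have "B *v v = M (c *s L v)" for v
    using der[OF holo_germ_compose[OF M holo_germ_compose[OF f L]] conj] by (simp add: fun_eq_iff)
  then have Bc: "B *v v = c *s v" for v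
    using M invL by (simp add: holo_germ_def complex_linear_def)
  \<comment> \<open>Modulo O(|z|^(m+1)), f o \<Phi> equals \<Phi> o \<Psi> o f o \<Phi>, which
    equals \<Phi> after multiplication by c.\<close>
  have 1: "vanishes (Suc m) (\<lambda>z. \<Phi> (\<Psi> (f (\<Phi> z))) - f (\<Phi> z))"
    by (rule vanishes_compose[OF \<Phi>\<Psi> vanishes_compose[OF v1(3,1)]])
  have 2: "vanishes (Suc m) (\<lambda>z. \<Phi> (\<Psi> (f (\<Phi> z))) - \<Phi> (c *s z))"
  proof (rule holo_germ_vanishes_diff[OF L])
    show "vanishes 1 (\<lambda>z. \<Psi> (f (\<Phi> z)))"
      by (rule vanishes_compose[OF v1(2) vanishes_compose[OF v1(3,1)]])
    show "vanishes 1 (\<lambda>z. c *s z)" by (rule vanishes_scale[OF vanishes_ident])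
    show "vanishes (Suc m) (\<lambda>z. \<Psi> (f (\<Phi> z)) - c *s z)" using conj by (simp add: Bc)
  qed
  have "vanishes (Suc m) (\<lambda>z. f (\<Phi> z) - \<Phi> (c *s z))"
    using vanishes_diff[OF 2 1] by simp
  then show thesis using that[OF L M \<Phi>\<Psi>] by blast
qed

lemma complex_linear_ident: "complex_linear (\<lambda>v. v)"
  by (simp add: complex_linear_def)

lemma holo_germ_funpow:
  assumes "holo_germ f (\<lambda>v. c *s v)"
  shows "holo_germ (f ^^ n) (\<lambda>v. c ^ n *s v)"
proof (induction n)
  case 0
  show ?case using holo_germ_linear[OF complex_linear_ident] by (simp add: id_def)
next
  case (Suc n)
  show ?case using holo_germ_compose[OF assms Suc] by (simp add: comp_def)
qed

text \<open>To every order f is conjugate to multiplication by c, whose d-th power is the identity,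
  so f^d - id is flat and hence zero. The conjugacies for different orders are unrelated, which is
  harmless because none of them occurs in the conclusion.\<close>

lemma formally_linearizable_finite_order:
  fixes f :: "complex^'n::finite \<Rightarrow> complex^'n"
  assumes ps: "has_power_series_at0 f a" and flin: "formally_linearizable a"
    and f: "holo_germ f (\<lambda>v. c *s v)" and c: "c ^ d = 1"
  shows "\<forall>\<^sub>F z in nhds 0. (f ^^ d) z = z"
proof -
  have hd: "holo_germ (f ^^ d) (\<lambda>v. v)" using holo_germ_funpow[OF f, of d] c by simp
  have van: "vanishes (Suc m) (\<lambda>z. (f ^^ d) z - z)" if m: "1 \<le> m" for m
  proof -
    obtain \<Phi> \<Psi> L M where L: "holo_germ \<Phi> L" and M: "holo_germ \<Psi> M"
      and \<Phi>\<Psi>: "vanishes (Suc m) (\<lambda>z. \<Phi> (\<Psi> z) - z)"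
      and conj: "vanishes (Suc m) (\<lambda>z. f (\<Phi> z) - \<Phi> (c *s z))"
      by (rule formally_linearizable_scalar[OF ps flin f m])
    note v1 = holo_germ_vanishes[OF L] holo_germ_vanishes[OF M] holo_germ_vanishes[OF f]
    have vs: "vanishes 1 (\<lambda>z::complex^'n. b *s z)" for b by (rule vanishes_scale[OF vanishes_ident])
    have it: "vanishes (Suc m) (\<lambda>z. (f ^^ n) (\<Phi> z) - \<Phi> (c ^ n *s z))" for n
    proof (induction n)
      case (Suc n)
      have 1: "vanishes (Suc m) (\<lambda>z. f ((f ^^ n) (\<Phi> z)) - f (\<Phi> (c ^ n *s z)))"
        by (rule holo_germ_vanishes_diff[OF f vanishes_compose[OF holo_germ_vanishes[OF holo_germ_funpow[OF f]] v1(1)]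
            vanishes_compose[OF v1(1) vs] Suc])
      have 2: "vanishes (Suc m) (\<lambda>z. f (\<Phi> (c ^ n *s z)) - \<Phi> (c *s (c ^ n *s z)))"
        by (rule vanishes_compose[OF conj vs])
      show ?case using vanishes_add[OF 1 2] by simp
    qed simp
    have 1: "vanishes (Suc m) (\<lambda>z. (f ^^ d) (\<Phi> (\<Psi> z)) - \<Phi> (\<Psi> z))"
      using vanishes_compose[OF it[of d] v1(2)] by (simp add: c)
    have 2: "vanishes (Suc m) (\<lambda>z. (f ^^ d) (\<Phi> (\<Psi> z)) - (f ^^ d) z)"
      by (rule holo_germ_vanishes_diff[OF hd vanishes_compose[OF v1(1,2)] vanishes_ident \<Phi>\<Psi>])
    show ?thesis using vanishes_add[OF vanishes_diff[OF 1 2] \<Phi>\<Psi>] by simp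
  qed
  have vall: "vanishes m (\<lambda>z. (f ^^ d) z - z)" for m
    by (rule vanishes_mono[OF van[of "Suc m"]]) auto
  have "holo_germ (\<lambda>z. (f ^^ d) z + (-1) *s z) (\<lambda>v. v + (-1) *s v)"
    by (intro holo_germ_add hd holo_germ_linear complex_linear_scale)
  moreover have "(\<lambda>z. (f ^^ d) z + (-1) *s z) = (\<lambda>z. (f ^^ d) z - z)"
    by (simp add: fun_eq_iff vec_eq_iff)
  ultimately obtain r where r: "r > 0" "holo_on (\<lambda>z. (f ^^ d) z - z) (ball 0 r)"
    by (auto simp: holo_germ_def)
  have "(f ^^ d) z - z = 0" if "norm z < r" for z
    by (rule holo_on_vanishes_imp_zero[OF r(2) vall that])
  then show ?thesis by (intro eventually_nhds_0_ballI[OF r(1)]) simp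
qed

text \<open>Averaging over the finite abelian group generated by the germs linearizes them one after
  another without destroying what was achieved before.\<close>
lemma scalar_family_average:
  fixes f :: "nat \<Rightarrow> complex^'n::finite \<Rightarrow> complex^'n"
  assumes f: "\<And>k. k < h \<Longrightarrow> holo_germ (f k) (\<lambda>v. c k *s v)"
    and d: "d > 0" and c: "\<And>k. k < h \<Longrightarrow> c k ^ d = 1"
    and per: "\<And>k. k < h \<Longrightarrow> \<forall>\<^sub>F z in nhds 0. (f k ^^ d) z = z"
    and comm: "\<And>p q. p < h \<Longrightarrow> q < h \<Longrightarrow> \<forall>\<^sub>F z in nhds 0. f p (f q z) = f q (f p z)"
    and K: "K \<le> h"
  shows "\<exists>\<psi>. holo_germ \<psi> (\<lambda>v. v) \<and> (\<forall>k<K. \<forall>\<^sub>F z in nhds 0. \<psi> (f k z) = c k *s \<psi> z)"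
  using K
proof (induction K)
  case 0
  show ?case using holo_germ_linear[OF complex_linear_ident] by auto
next
  case (Suc K)
  then obtain \<psi> where \<psi>: "holo_germ \<psi> (\<lambda>v. v)"
    and \<psi>f: "\<And>k. k < K \<Longrightarrow> \<forall>\<^sub>F z in nhds 0. \<psi> (f k z) = c k *s \<psi> z" by auto
  have Kh: "K < h" using Suc.prems by simp
  define b where "b = inverse (c K)"
  have cK: "c K \<noteq> 0" using c[OF Kh] d by (auto simp: power_0_left)
  \<comment> \<open>The average of \<psi> o f_K^e against the character c_K^(-e) of Z/d, which
    projects onto the solutions of \<psi> o f_K = c_K \<psi>. The weights also keep the derivative
    at 0 equal to the identity.\<close>
  define w where "w = (\<lambda>e. b ^ e / of_nat d)"
  define \<psi>' where "\<psi>' = (\<lambda>z. \<Sum>e<d. w e *s \<psi> ((f K ^^ e) z))"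
  have germ: "holo_germ (\<lambda>z. w e *s \<psi> ((f K ^^ e) z)) (\<lambda>v. w e *s (c K ^ e *s v))" for e
    by (rule holo_germ_scale[OF holo_germ_compose[OF \<psi> holo_germ_funpow[OF f[OF Kh]]]])
  have "holo_germ \<psi>' (\<lambda>v. \<Sum>e<d. w e *s (c K ^ e *s v))"
    unfolding \<psi>'_def by (rule holo_germ_sum[OF finite_lessThan germ])
  moreover have "(\<Sum>e<d. w e *s (c K ^ e *s v)) = v" for v :: "complex^'n"
  proof -
    have "w e * c K ^ e = 1 / of_nat d" for e
      using cK by (simp add: w_def b_def power_inverse)
    then have "w e *s (c K ^ e *s v) = (1 / of_nat d) *s v" for e by (simp only: vector_smult_assoc)
    then have "(\<Sum>e<d. w e *s (c K ^ e *s v)) = (\<Sum>e<d. (1 / of_nat d) *s v)" by (simp only:)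
    also have "(\<Sum>e<n. b *s v) = (of_nat n * b) *s v" for n b
      by (induction n) (simp_all add: vec_eq_iff algebra_simps del: sum_constant)
    also have "(of_nat d * (1 / of_nat d)) *s v = v" using d by simp
    finally show ?thesis .
  qed
  ultimately have \<psi>'1: "holo_germ \<psi>' (\<lambda>v. v)" by simp
  have \<psi>'f: "\<forall>\<^sub>F z in nhds 0. \<psi>' (f k z) = c k *s \<psi>' z" if k: "k < Suc K" for k
  proof (cases "k = K")
    case True
    show ?thesis using per[OF Kh]
    proof eventually_elim
      case (elim z)
      \<comment> \<open>Because f_K^d fixes z and c_K^d = 1, the summand takes the same value at 0
        and d, so shifting the index leaves the sum unchanged.\<close>
      define g where "g = (\<lambda>e. w e *s \<psi> ((f K ^^ e) z))"
      have "g d = g 0"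
        using c[OF Kh] elim by (simp add: g_def w_def b_def power_inverse)
      then have shift: "(\<Sum>e<d. g (Suc e)) = (\<Sum>e<d. g e)"
        using sum.lessThan_Suc_shift[of g d] sum.lessThan_Suc[of g d] by simp
      have wS: "w e = c K * w (Suc e)" for e using cK by (simp add: w_def b_def)
      have "w e *s \<psi> ((f K ^^ e) (f K z)) = c K *s g (Suc e)" for e
        by (subst wS) (simp add: g_def funpow_swap1)
      then have "\<psi>' (f K z) = c K *s (\<Sum>e<d. g (Suc e))"
        by (simp add: \<psi>'_def vec_eq_iff sum_distrib_left)
      then show ?case using True shift by (simp add: \<psi>'_def g_def)
    qed
  next
    case False
    then have kK: "k < K" "k < h" using k Kh by auto
    \<comment> \<open>Commutativity carries the relation already achieved for f_k through every
      summand of the average.\<close>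
    have it: "\<forall>\<^sub>F z in nhds 0. (f K ^^ e) (f k z) = f k ((f K ^^ e) z)" for e
    proof (induction e)
      case (Suc e)
      have "\<forall>\<^sub>F z in nhds 0. f K (f k ((f K ^^ e) z)) = f k (f K ((f K ^^ e) z))"
        by (rule holo_germ_eventually[OF holo_germ_funpow[OF f[OF Kh]] comm[OF Kh kK(2)]])
      with Suc show ?case by eventually_elim simp
    qed simp
    have "\<forall>\<^sub>F z in nhds 0. \<psi> ((f K ^^ e) (f k z)) = c k *s \<psi> ((f K ^^ e) z)" for e
      using it[of e] holo_germ_eventually[OF holo_germ_funpow[OF f[OF Kh]] \<psi>f[OF kK(1)], of e]
      by eventually_elim simp
    then have "\<forall>\<^sub>F z in nhds 0. \<forall>e\<in>{..<d}. \<psi> ((f K ^^ e) (f k z)) = c k *s \<psi> ((f K ^^ e) z)"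
      by (intro eventually_ball_finite) auto
    then show ?thesis
    proof eventually_elim
      case (elim z)
      then show ?case by (simp add: \<psi>'_def vec_eq_iff sum_distrib_left mult_ac)
    qed
  qed
  show ?case using \<psi>'1 \<psi>'f by blast
qed

text \<open>The averaged map satisfies \<psi> o f_k = c_k \<psi>, so it leads into the linear
  coordinate and its inverse is the required linearizing germ.\<close>

lemma scalar_family_linearizable:
  fixes f :: "nat \<Rightarrow> complex^'n::finite \<Rightarrow> complex^'n"
  assumes f: "\<And>k. k < h \<Longrightarrow> holo_germ (f k) (\<lambda>v. c k *s v)"
    and formal: "\<And>k. k < h \<Longrightarrow> \<exists>a. has_power_series_at0 (f k) a \<and> formally_linearizable a"
    and d: "d > 0" and c: "\<And>k. k < h \<Longrightarrow> c k ^ d = 1"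
    and comm: "\<And>p q. p < h \<Longrightarrow> q < h \<Longrightarrow> \<forall>\<^sub>F z in nhds 0. f p (f q z) = f q (f p z)"
  shows "sim_holo_linearizable f h"
proof -
  have per: "\<forall>\<^sub>F z in nhds 0. (f k ^^ d) z = z" if "k < h" for k
    using formal[OF that] formally_linearizable_finite_order[OF _ _ f[OF that] c[OF that]] by blast
  obtain \<psi> where \<psi>: "holo_germ \<psi> (\<lambda>v. v)"
    and \<psi>f: "\<And>k. k < h \<Longrightarrow> \<forall>\<^sub>F z in nhds 0. \<psi> (f k z) = c k *s \<psi> z"
    using scalar_family_average[where f = f and c = c and h = h and d = d, OF f d c per comm order_refl] by blast
  obtain g where g: "biholo_germ0_inv \<psi> g"
    using holo_germ_inverse[OF \<psi> complex_linear_ident] by blast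
  have inv: "biholo_germ0_inv g \<psi>" by (rule biholo_germ0_inv_sym[OF g])
  then obtain U where U: "g 0 = 0" "open U" "0 \<in> U" "holo_on g U" "\<And>z. z \<in> U \<Longrightarrow> \<psi> (g z) = z"
    unfolding biholo_germ0_inv_def by blast
  have evU: "\<forall>\<^sub>F z in nhds 0. z \<in> U" using U by (metis eventually_nhds)
  have "filterlim g (nhds 0) (nhds 0)"
    using holo_on_continuous[OF U(4,3)] U(1) tendsto_at_iff_tendsto_nhds[of g 0] by (simp add: isCont_def)
  then have gev: "\<forall>\<^sub>F z in nhds 0. Q (g z)" if "\<forall>\<^sub>F z in nhds 0. Q z" for Q
    using that by (auto simp: filterlim_iff)
  have "\<exists>B::complex^'n^'n. \<forall>\<^sub>F z in nhds 0. \<psi> (f k (g z)) = B *v z" if k: "k < h" for k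
  proof
    show "\<forall>\<^sub>F z in nhds 0. \<psi> (f k (g z)) = mat (c k) *v z"
      using gev[OF \<psi>f[OF k]] evU
    proof eventually_elim
      case (elim z)
      then have "\<psi> (f k (g z)) = c k *s z" using U(5) by simp
      also have "\<dots> = mat (c k) *v z"
        by (auto simp: vec_eq_iff matrix_vector_mult_def mat_def if_distrib if_distribR cong: if_cong)
      finally show ?case .
    qed
  qed
  then show ?thesis unfolding sim_holo_linearizable_def using inv by blast
qed

section \<open>The linearization theorem\<close>

lemma series_map_smaller:
  assumes "series_map F a r" "0 < r'" "r' \<le> r"
  shows "series_map F a r'"
  using assms mps_conv_mono[OF _ assms(2,3)] unfolding series_map_def by auto

lemma lam_pow_add: "lam_pow lam k (\<lambda>i. Q i + R i) = lam_pow lam k Q * lam_pow lam k R"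
  by (simp add: lam_pow_def power_add prod.distrib)

lemma lam_pow_unit: "lam_pow lam k (mi_unit j) = lam k j"
proof -
  have "mi_unit j = count_list [j]" by (auto simp: mi_unit_def fun_eq_iff)
  then show ?thesis by (simp only: lam_pow_count_list) simp
qed

section \<open>Divisors of the family and the Brjuno condition without resonances\<close>

definition max_divisor :: "(nat \<Rightarrow> 'n::finite \<Rightarrow> complex) \<Rightarrow> nat \<Rightarrow> 'n \<Rightarrow> ('n \<Rightarrow> nat) \<Rightarrow> real" where
  "max_divisor lam h j Q = Max ((\<lambda>k. cmod (lam_pow lam k Q - lam k j)) ` {..<h})"

lemma eps_Q_eq: "eps_Q lam h Q = Min (range (\<lambda>j. max_divisor lam h j Q))"
  by (simp add: eps_Q_def max_divisor_def)

lemma max_divisor_attained: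
  assumes "h > 0"
  obtains k where "k < h" "max_divisor lam h j Q = cmod (lam_pow lam k Q - lam k j)"
proof -
  have "max_divisor lam h j Q \<in> (\<lambda>k. cmod (lam_pow lam k Q - lam k j)) ` {..<h}"
    unfolding max_divisor_def using assms by (intro Max_in) auto
  then show thesis using that by auto
qed

lemma max_divisor_less_iff:
  assumes "h > 0"
  shows "max_divisor lam h j Q < x \<longleftrightarrow> (\<forall>k<h. cmod (lam_pow lam k Q - lam k j) < x)"
  unfolding max_divisor_def using assms by (subst Max_less_iff) auto

lemma eps_Q_le: "eps_Q lam h Q \<le> max_divisor lam h j Q"
  unfolding eps_Q_eq by (intro Min_le) auto

lemma eps_Q_nonneg:
  assumes "h > 0"
  shows "eps_Q lam h Q \<ge> 0"
proof -
  have "eps_Q lam h Q \<in> range (\<lambda>j. max_divisor lam h j Q)"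
    unfolding eps_Q_eq by (rule Min_in) auto
  then obtain j where "eps_Q lam h Q = max_divisor lam h j Q" by blast
  then show ?thesis using max_divisor_attained[OF assms, of lam j Q] by (metis norm_ge_zero)
qed

text \<open>Two nested exponents with small divisors in the same component \<open>j\<close> differ by a large
  exponent, since the quotient of the two monomials has a small divisor in component \<open>j\<close> as well.\<close>
lemma small_divisors_gap:
  fixes lam :: "nat \<Rightarrow> 'n::finite \<Rightarrow> complex"
  assumes h: "h > 0" and \<theta>: "0 < \<theta>" "\<theta> \<le> 1 / 4" "\<And>k. k < h \<Longrightarrow> \<theta> \<le> cmod (lam k j) / 2"
    and \<omega>: "\<omega> > 0" "\<And>Q. 2 \<le> mi_deg Q \<Longrightarrow> mi_deg Q \<le> m \<Longrightarrow> \<omega> \<le> eps_Q lam h Q"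
    and v: "max_divisor lam h j V < \<theta> * min 1 \<omega>" and w: "max_divisor lam h j W < \<theta> * min 1 \<omega>"
    and sub: "\<And>i. V i \<le> W i" and deg: "mi_deg V < mi_deg W"
  shows "mi_deg V + m \<le> mi_deg W"
proof (rule ccontr)
  assume neg: "\<not> mi_deg V + m \<le> mi_deg W"
  define \<tau> where "\<tau> = \<theta> * min 1 \<omega>"
  have \<tau>: "\<tau> > 0" "\<tau> \<le> \<theta>" "4 * \<tau> \<le> \<omega>"
  proof -
    show "\<tau> > 0" using \<theta>(1) \<omega>(1) by (simp add: \<tau>_def)
    show "\<tau> \<le> \<theta>" using \<theta>(1) by (simp add: \<tau>_def mult_left_le)
    have "4 * \<tau> = (4 * \<theta>) * min 1 \<omega>" by (simp add: \<tau>_def)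
    also have "\<dots> \<le> 1 * min 1 \<omega>" using \<theta>(2) \<omega>(1) by (intro mult_right_mono) auto
    finally show "4 * \<tau> \<le> \<omega>" by simp
  qed
  define R where "R = (\<lambda>i. W i - V i)"
  have W: "W = (\<lambda>i. V i + R i)" using sub by (auto simp: R_def)
  have degR: "mi_deg W = mi_deg V + mi_deg R" unfolding W by (rule mi_deg_add)
  \<comment> \<open>If both exponents are nearly resonant for j, the eigenvalue monomial of R is
    close to 1, so R + e_j is nearly resonant for j too. Were |R| at most m - 1, then 2 <= |Q| <= m,
    the range in which \<omega> bounds the divisors.\<close>
  define Q where "Q = (\<lambda>i. R i + mi_unit j i)"
  have "mi_deg (mi_unit j) = 1" using mi_deg_eq_1_iff by blast
  then have degQ: "mi_deg Q = mi_deg R + 1" unfolding Q_def by (simp add: mi_deg_add)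
  have "\<omega> \<le> eps_Q lam h Q" using \<omega>(2)[of Q] neg deg degR degQ by simp
  also have "\<dots> \<le> max_divisor lam h j Q" by (rule eps_Q_le)
  also have "\<dots> < 4 * \<tau>"
    unfolding max_divisor_less_iff[OF h]
  proof (intro allI impI)
    fix k assume k: "k < h"
    define x \<rho> l where "x = lam_pow lam k V" and "\<rho> = lam_pow lam k R" and "l = lam k j"
    have 1: "cmod (x - l) < \<tau>" using v k by (simp add: max_divisor_less_iff[OF h] x_def l_def \<tau>_def)
    have 2: "cmod (x * \<rho> - l) < \<tau>"
      using w k by (simp add: max_divisor_less_iff[OF h] x_def \<rho>_def l_def \<tau>_def W lam_pow_add)
    have "cmod (x * (\<rho> - 1)) = cmod ((x * \<rho> - l) - (x - l))" by (simp add: algebra_simps)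
    also have "\<dots> < 2 * \<tau>" using norm_triangle_ineq4[of "x * \<rho> - l" "x - l"] 1 2 by linarith
    finally have 3: "cmod x * cmod (\<rho> - 1) < 2 * \<tau>" by (simp add: norm_mult)
    \<comment> \<open>\<tau> <= \<theta> <= |l|/2 keeps x away from 0, so division by x costs a
      factor 2. The resulting bound 4 \<tau> explains the requirement \<theta> <= 1/4.\<close>
    have "cmod l \<le> 2 * cmod x"
      using norm_triangle_ineq2[of l x] 1 \<tau>(2) \<theta>(3)[OF k] by (simp add: l_def norm_minus_commute)
    then have "cmod l * cmod (\<rho> - 1) \<le> 2 * cmod x * cmod (\<rho> - 1)" by (intro mult_right_mono) auto
    then have "cmod ((\<rho> - 1) * l) < 4 * \<tau>" using 3 by (simp add: norm_mult mult_ac)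
    then show "cmod (lam_pow lam k Q - lam k j) < 4 * \<tau>"
      by (simp add: Q_def lam_pow_add lam_pow_unit \<rho>_def l_def algebra_simps)
  qed
  finally show False using \<tau>(3) by simp
qed

text \<open>With no exponent removed, \<omega>(m) for m >= 2 is a minimum over a nonempty finite
  set, hence real. If it vanished once, antitonicity would produce an infinite term of the series,
  which bounded partial sums exclude; so all values are positive.\<close>

lemma nonresonant_brjuno:
  fixes lam :: "nat \<Rightarrow> 'n::finite \<Rightarrow> complex"
  assumes h: "h > 0" and brj: "sim_brjuno lam h"
    and nonres: "\<And>Q. 2 \<le> mi_deg Q \<Longrightarrow> Q \<notin> (\<Inter>k\<in>{..<h}. \<Inter>j. res_set lam k j)"
  obtains om p C where "\<And>m. 2 \<le> m \<Longrightarrow> om m > 0" "\<And>m m'. 2 \<le> m \<Longrightarrow> m \<le> m' \<Longrightarrow> om m' \<le> om m"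
    "\<And>m Q. 2 \<le> mi_deg Q \<Longrightarrow> mi_deg Q \<le> m \<Longrightarrow> om m \<le> eps_Q lam h Q"
    "strict_mono p" "p 0 = 1" "\<And>N. (\<Sum>\<nu><N. 1 / real (p \<nu>) * ln (1 / om (p (Suc \<nu>)))) \<le> C"
proof -
  define X where "X = (\<lambda>m. {Q::'n \<Rightarrow> nat. 2 \<le> mi_deg Q \<and> mi_deg Q \<le> m})"
  define om where "om = (\<lambda>m. Min (eps_Q lam h ` X m))"
  have fin: "finite (X m)" for m unfolding X_def by (rule finite_subset[OF _ finite_mi_deg_le[of m]]) auto
  have ne: "X m \<noteq> {}" if "2 \<le> m" for m
  proof -
    have "mi_deg (count_list [undefined, undefined :: 'n]) = 2" by (simp only: mi_deg_count_list) simp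
    then show ?thesis using that unfolding X_def by (metis (mono_tags, lifting) empty_iff mem_Collect_eq order_refl)
  qed
  have om_eps: "om m \<le> eps_Q lam h Q" if "2 \<le> mi_deg Q" "mi_deg Q \<le> m" for m Q
    unfolding om_def using that fin by (intro Min_le) (auto simp: X_def)
  have om_anti: "om m' \<le> om m" if "2 \<le> m" "m \<le> m'" for m m'
    unfolding om_def using that ne[of m] fin by (intro Min_antimono) (auto simp: X_def)
  have om_nonneg: "om m \<ge> 0" if "2 \<le> m" for m
    unfolding om_def using fin ne[OF that] eps_Q_nonneg[OF h] by (subst Min_ge_iff) auto
  have omega: "omega_B lam h m = ereal (om m)" if "2 \<le> m" for m
  proof -
    have "{Q. 2 \<le> mi_deg Q \<and> mi_deg Q \<le> m \<and> Q \<notin> (\<Inter>k\<in>{..<h}. \<Inter>j. res_set lam k j)} = X m"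
      using nonres by (auto simp: X_def)
    then have "omega_B lam h m = Inf (ereal ` (eps_Q lam h ` X m))"
      unfolding omega_B_def by (simp add: image_image)
    also have "\<dots> = Min (ereal ` (eps_Q lam h ` X m))"
      using fin ne[OF that] by (intro Min_Inf[symmetric]) auto
    also have "\<dots> = ereal (om m)"
      unfolding om_def using fin ne[OF that] by (intro mono_Min_commute[symmetric]) (auto simp: mono_def)
    finally show ?thesis .
  qed
  obtain p C where p: "strict_mono p" "p 0 = 1"
    and C: "\<And>N. (\<Sum>\<nu><N. ereal (1 / real (p \<nu>)) * log_inv (omega_B lam h (p (Suc \<nu>)))) \<le> ereal C"
    using brj unfolding sim_brjuno_def by blast
  have pge: "\<nu> + 1 \<le> p \<nu>" for \<nu>
  proof (induction \<nu>)
    case (Suc \<nu>)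
    then show ?case using strict_monoD[OF p(1), of \<nu> "Suc \<nu>"] by simp
  qed (simp add: p(2))
  have p2: "2 \<le> p (Suc \<nu>)" for \<nu> using pge[of "Suc \<nu>"] by simp
  have om_pos: "om m > 0" if m: "2 \<le> m" for m
  proof (rule ccontr)
    assume "\<not> om m > 0"
    then have "om m = 0" using om_nonneg[OF m] by simp
    then have "om (p (Suc m)) = 0" using om_anti[OF m, of "p (Suc m)"] om_nonneg[OF p2, of m] pge[of "Suc m"] by simp
    then have "ereal (1 / real (p m)) * log_inv (omega_B lam h (p (Suc m))) = \<infinity>"
      using pge[of m] by (simp add: omega[OF p2] log_inv_def)
    then have "(\<Sum>\<nu><Suc m. ereal (1 / real (p \<nu>)) * log_inv (omega_B lam h (p (Suc \<nu>)))) = \<infinity>"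
      unfolding sum_Pinfty by blast
    with C[of "Suc m"] have "\<infinity> \<le> ereal C" by (simp only:)
    then show False by simp
  qed
  show thesis
  proof (rule that[OF om_pos om_anti om_eps p])
    fix N
    have "ereal (1 / real (p \<nu>)) * log_inv (omega_B lam h (p (Suc \<nu>))) = ereal (1 / real (p \<nu>) * ln (1 / om (p (Suc \<nu>))))" for \<nu>
      using om_pos[OF p2, of \<nu>] by (simp add: omega[OF p2] log_inv_def)
    then show "(\<Sum>\<nu><N. 1 / real (p \<nu>) * ln (1 / om (p (Suc \<nu>)))) \<le> C"
      using C[of N] by (simp only: sum_ereal ereal_less_eq)
  qed
qed

lemma biholo_germ0_imp_injective_derivative:
  assumes "biholo_germ0 f" "(f has_derivative L) (at 0)"
  shows "f 0 = 0" "L v = 0 \<Longrightarrow> v = 0"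
proof -
  obtain g U V where *: "f 0 = 0" "open U" "0 \<in> U" "f ` U = V" "holo_on g V" "\<And>z. z \<in> U \<Longrightarrow> g (f z) = z"
    using assms(1) unfolding biholo_germ0_def biholo_germ0_inv_def by metis
  show "f 0 = 0" by fact
  have "0 \<in> V" using * by force
  then obtain E where E: "(g has_derivative E) (at 0)" using *(5) by (auto simp: holo_on_def)
  have "((\<lambda>z. g (f z)) has_derivative (\<lambda>v. E (L v))) (at 0)"
    using has_derivative_compose[OF assms(2)] E *(1) by simp
  then have "((\<lambda>z. z) has_derivative (\<lambda>v. E (L v))) (at 0)"
    by (rule has_derivative_transform_within_open[OF _ *(2,3,6)])
  then have "(\<lambda>v. E (L v)) = (\<lambda>v. v)" by (rule has_derivative_unique[OF _ has_derivative_ident])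
  then have EL: "E (L v) = v" for v by metis
  assume "L v = 0"
  then show "v = 0" using EL[of v] linear_0[OF has_derivative_linear[OF E]] by simp
qed

theorem theorem3p5:
  fixes f :: "nat \<Rightarrow> complex^'n \<Rightarrow> complex^'n"
    and h :: nat
    and A :: "nat \<Rightarrow> complex^'n^'n"
    and P :: "complex^'n^'n"
  assumes h2: "2 \<le> h"
    and germ: "\<And>k. k < h \<Longrightarrow> biholo_germ0 (f k)"
    and linpart: "\<And>k. k < h \<Longrightarrow> (f k has_derivative (\<lambda>v. A k *v v)) (at 0)"
    and formal: "\<And>k. k < h \<Longrightarrow> \<exists>a. has_power_series_at0 (f k) a \<and> formally_linearizable a"
    and P_inv: "invertible P"
    and diag: "\<And>k i j. k < h \<Longrightarrow> i \<noteq> j \<Longrightarrow> (matrix_inv P ** A k ** P) $ i $ j = 0"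
    and brjuno: "sim_brjuno (\<lambda>k j. (matrix_inv P ** A k ** P) $ j $ j) h"
  shows "sim_holo_linearizable f h \<longleftrightarrow>
         (\<forall>p<h. \<forall>q<h. eventually (\<lambda>z. f p (f q z) = f q (f p z)) (nhds 0))"
proof -
  define lam where "lam = (\<lambda>k j. (matrix_inv P ** A k ** P) $ j $ j)"
  have h0: "h > 0" using h2 by simp
  have "P ** matrix_inv P = mat 1 \<and> matrix_inv P ** P = mat 1"
    using P_inv unfolding invertible_def matrix_inv_def by (rule someI_ex)
  then have PP': "P ** matrix_inv P = mat 1" and P'P: "matrix_inv P ** P = mat 1" by auto
  have P'_inj: "x = y" if "matrix_inv P *v x = matrix_inv P *v y" for x y
    using that PP' by (metis matrix_vector_mul_assoc matrix_vector_mul_lid)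
  have diag': "(matrix_inv P *v (A k *v x)) $ j = lam k j * (matrix_inv P *v x) $ j" if k: "k < h" for k x j
  proof -
    have "matrix_inv P *v (A k *v x) = (matrix_inv P ** A k ** P) *v (matrix_inv P *v x)"
      using PP' by (simp add: matrix_vector_mul_assoc matrix_mul_assoc[symmetric])
    then have "(matrix_inv P *v (A k *v x)) $ j = (\<Sum>i\<in>UNIV. (matrix_inv P ** A k ** P) $ j $ i * (matrix_inv P *v x) $ i)"
      by (simp add: matrix_vector_mult_def)
    also have "\<dots> = (\<Sum>i\<in>UNIV. if i = j then lam k j * (matrix_inv P *v x) $ j else 0)"
      by (intro sum.cong) (auto simp: lam_def diag[OF k])
    finally show ?thesis by simp
  qed
  note germ_facts = biholo_germ0_imp_injective_derivative[OF germ linpart]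
  have f0: "f k 0 = 0" if "k < h" for k by (rule germ_facts(1)[OF that that])
  \<comment> \<open>Invertibility of the derivatives enters here. It is needed to cancel c_k in the
    resonant case and to have \<theta> > 0 in the other one.\<close>
  have lam0: "lam k j \<noteq> 0" if k: "k < h" for k j
  proof
    assume "lam k j = 0"
    define x where "x = P *v axis j 1"
    have P'x: "matrix_inv P *v x = axis j 1" using P'P by (simp add: x_def matrix_vector_mul_assoc)
    have "matrix_inv P *v (A k *v x) = matrix_inv P *v 0"
      unfolding vec_eq_iff diag'[OF k] P'x using \<open>lam k j = 0\<close> by (auto simp: axis_def)
    then have "A k *v x = 0" by (rule P'_inj)
    then have "x = 0" by (rule germ_facts(2)[OF k k])
    then show False using P'x by (metis axis_eq_0_iff matrix_vector_mult_0_right zero_neq_one)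
  qed
  have A_comm: "A p ** A q = A q ** A p" if pq: "p < h" "q < h" for p q
  proof -
    have "A p *v (A q *v x) = A q *v (A p *v x)" for x
      by (rule P'_inj) (simp add: vec_eq_iff diag'[OF pq(1)] diag'[OF pq(2)])
    then show ?thesis by (simp add: matrix_eq matrix_vector_mul_assoc)
  qed
  have "\<forall>k\<in>{..<h}. \<exists>a r. series_map (f k) a r"
  proof
    fix k assume "k \<in> {..<h}"
    then obtain a where "has_power_series_at0 (f k) a" using formal by blast
    then show "\<exists>a r. series_map (f k) a r"
      using has_power_series_at0_eval[of "f k" a] unfolding series_map_def by metis
  qed
  then obtain a r where ar: "\<And>k. k < h \<Longrightarrow> series_map (f k) (a k) (r k)" by (metis lessThan_iff)
  define s where "s = Min (r ` {..<h})"
  have s_in: "s \<in> r ` {..<h}" unfolding s_def using h0 by (intro Min_in) auto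
  have s: "s > 0" using s_in ar by (auto simp: series_map_def)
  have series: "series_map (f k) (a k) s" if "k < h" for k
    by (rule series_map_smaller[OF ar[OF that] s]) (use that in \<open>auto simp: s_def\<close>)
  have lin: "linear_part (a k) = A k" if k: "k < h" for k
    using holo_germ_derivative_unique[OF series_map_holo_germ[OF series[OF k] f0[OF k]] linpart[OF k]]
    by (simp add: matrix_eq fun_eq_iff)
  have f_germ: "holo_germ (f k) (\<lambda>v. A k *v v)" if "k < h" for k
    using series_map_holo_germ[OF series f0, OF that that] lin[OF that] by simp
  show ?thesis
  proof
    assume L: "sim_holo_linearizable f h"
    show "\<forall>p<h. \<forall>q<h. eventually (\<lambda>z. f p (f q z) = f q (f p z)) (nhds 0)"
      using sim_holo_linearizable_imp_commute[OF L f0 linpart A_comm] by blast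
  next
    assume "\<forall>p<h. \<forall>q<h. eventually (\<lambda>z. f p (f q z) = f q (f p z)) (nhds 0)"
    then have comm: "\<And>p q. p < h \<Longrightarrow> q < h \<Longrightarrow> \<forall>\<^sub>F z in nhds 0. f p (f q z) = f q (f p z)" by blast
    show "sim_holo_linearizable f h"
    proof (cases "\<exists>Q. 2 \<le> mi_deg Q \<and> Q \<in> (\<Inter>k\<in>{..<h}. \<Inter>j. res_set lam k j)")
      case True
      then obtain Q where Q: "2 \<le> mi_deg Q" "\<And>k j. k < h \<Longrightarrow> lam_pow lam k Q = lam k j"
        by (auto simp: res_set_def)
      \<comment> \<open>The value lam_k^Q equals every eigenvalue of the k-th germ, so they all
        coincide, and lam_k^Q is the power c_k^|Q|.\<close>
      define c where "c = (\<lambda>k. lam_pow lam k Q)"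
      have lam_c: "lam k j = c k" if "k < h" for k j using Q(2)[OF that] by (simp add: c_def)
      have c: "c k ^ (mi_deg Q - 1) = 1" if k: "k < h" for k
      proof -
        have "c k ^ mi_deg Q = lam_pow lam k Q"
          by (simp add: lam_pow_def mi_deg_def power_sum lam_c[OF k])
        also have "\<dots> = c k" by (simp add: c_def)
        also have "mi_deg Q = Suc (mi_deg Q - 1)" using Q(1) by simp
        finally have "c k ^ (mi_deg Q - 1) * c k = c k" by (metis power_Suc2)
        moreover have "c k \<noteq> 0" using lam0[OF k] lam_c[OF k] by metis
        ultimately show ?thesis by simp
      qed
      have "(\<lambda>v. A k *v v) = (\<lambda>v. c k *s v)" if k: "k < h" for k
      proof
        fix v
        have eq: "matrix_inv P *v (c k *s v) = c k *s (matrix_inv P *v v)"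
          using complex_linear_matrix[of "matrix_inv P"] by (simp add: complex_linear_def)
        show "A k *v v = c k *s v"
          by (rule P'_inj) (simp add: eq vec_eq_iff diag'[OF k] lam_c[OF k])
      qed
      then have "holo_germ (f k) (\<lambda>v. c k *s v)" if "k < h" for k using f_germ[OF that] that by simp
      then show ?thesis
        by (rule scalar_family_linearizable[where d = "mi_deg Q - 1"]) (use formal c comm Q(1) in auto)
    next
      case False
      then have nonres: "\<And>Q. 2 \<le> mi_deg Q \<Longrightarrow> Q \<notin> (\<Inter>k\<in>{..<h}. \<Inter>j. res_set lam k j)" by blast
      obtain om p C where om_pos: "\<And>m. 2 \<le> m \<Longrightarrow> om m > 0"
        and om_anti: "\<And>m m'. 2 \<le> m \<Longrightarrow> m \<le> m' \<Longrightarrow> om m' \<le> om m"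
        and om_eps: "\<And>m Q. 2 \<le> mi_deg Q \<Longrightarrow> mi_deg Q \<le> m \<Longrightarrow> om m \<le> eps_Q lam h Q"
        and p: "strict_mono p" "p 0 = 1"
        and C: "\<And>N. (\<Sum>\<nu><N. 1 / real (p \<nu>) * ln (1 / om (p (Suc \<nu>)))) \<le> C"
        by (rule nonresonant_brjuno[OF h0 brjuno[folded lam_def]], erule nonres, rule that)
      \<comment> \<open>The two requirements of the gap estimate: 1/4 and half the least modulus of
        an eigenvalue.\<close>
      define \<theta> where "\<theta> = Min (insert (1 / 4) ((\<lambda>(k, j). cmod (lam k j) / 2) ` ({..<h} \<times> UNIV)))"
      have \<theta>1: "\<theta> \<le> 1 / 4" unfolding \<theta>_def by (rule Min_le) auto
      have \<theta>2: "\<theta> \<le> cmod (lam k j) / 2" if "k < h" for k j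
        unfolding \<theta>_def by (rule Min_le) (use that in auto)
      have \<theta>0: "\<theta> > 0" unfolding \<theta>_def using lam0 by (subst Min_gr_iff) auto
      obtain K where K: "K \<ge> 1"
        "\<And>t. (\<Prod>v\<leftarrow>nodes t. 1 / Min (range (\<lambda>j. max_divisor lam h j (count_list v)))) \<le> K ^ tsize t"
      proof (rule small_divisor_product_bound[of p \<theta> om "\<lambda>j v. max_divisor lam h j (count_list v)" C,
            OF p \<theta>0 _ om_pos om_anti _ _ C])
        show "\<theta> \<le> 1" using \<theta>1 by simp
        show "om (length v) \<le> max_divisor lam h j (count_list v)" if "2 \<le> length v" for j v
          using om_eps[of "count_list v" "length v"] eps_Q_le[of lam h "count_list v" j] that
          by (simp add: mi_deg_count_list)
        show "length v + m \<le> length w"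
          if "2 \<le> length v" "2 \<le> length w" "2 \<le> m"
            "max_divisor lam h j (count_list v) < \<theta> * min 1 (om m)"
            "max_divisor lam h j (count_list w) < \<theta> * min 1 (om m)"
            "\<And>i. count_list v i \<le> count_list w i" "length v < length w" for j v w m
          using small_divisors_gap[OF h0 \<theta>0 \<theta>1 \<theta>2 om_pos[OF that(3)] om_eps that(4,5,6)] that(7)
          by (simp add: mi_deg_count_list)
      qed (assumption | rule that)+
      \<comment> \<open>A germ that attains the maximum in component j; its divisor is then at least
        \<open>eps_Q\<close>, as the locale demands.\<close>
      define sel where "sel = (\<lambda>j Q. SOME k. k < h \<and> max_divisor lam h j Q = cmod (lam_pow lam k Q - lam k j))"
      have sel: "sel j Q < h \<and> max_divisor lam h j Q = cmod (lam_pow lam (sel j Q) Q - lam (sel j Q) j)" for j Q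
        unfolding sel_def by (rule someI_ex) (use max_divisor_attained[OF h0] in metis)
      interpret nonresonant_family f h A P "matrix_inv P" lam a s sel "\<lambda>w. eps_Q lam h (count_list w)" K
      proof
        show "eps_Q lam h (count_list w) \<le> cmod (lam_pow lam (sel j (count_list w)) (count_list w) - lam (sel j (count_list w)) j)" for j w
          using eps_Q_le[of lam h "count_list w" j] sel by metis
        show "0 < eps_Q lam h (count_list w)" if "2 \<le> length w" for w
          using om_eps[of "count_list w" "length w"] om_pos[OF that] that by (simp add: mi_deg_count_list)
        show "(\<Prod>v\<leftarrow>nodes t. 1 / eps_Q lam h (count_list v)) \<le> K ^ tsize t" for t
          using K(2)[of t] by (simp add: eps_Q_eq)
      qed (use PP' P'P diag' series lin f0 s sel K(1) comm in auto)
      show ?thesis by (rule sim_linearizable)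
    qed
  qed
qed

end
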